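(* Let $p\in(1,p_N)$, let $\Omega\subset\mathbb{R}^N$, $N\geq 2$, be a bounded domain of class $C^4$, $|\Omega|=1$, for which the Alternative (either (i) or (ii), as formulated in the context; it holds for most such domains) is satisfied, and let $(\lambda(s),\alpha(s),\psi(s))$, $s\in[0,s_\infty)$, denote the curve of positive solutions of $(\mathbf{P})_\lambda$ satisfying either (i) or (ii) (in case (i), $\lambda(s)=s$, $s_\infty=\lambda_\infty(\Omega,p)$). Then there exists $\lambda_\infty(\Omega,p)\in(\frac1p\Lambda(\Omega,2p),\overline{\lambda}(\Omega,p)]$ such that the Rabinowitz unbounded continuum of solutions of $$-\Delta u=\mu(1+u)^p\ \text{ in }\Omega,\qquad u=0\ \text{ on }\partial\Omega\qquad(\ast)$$ is a continuous parametrization $$\mathcal{R}_\infty=\left\{[0,s_\infty)\ni s\mapsto(\mu(s),u(s))\in[0,+\infty)\times C^{2,r}_0(\overline\Omega)\right\},$$ where $$(\mu(s),u(s))=\left(\lambda(s)\alpha^{p-1}(s),\frac{\lambda(s)}{\alpha(s)}\psi(s)\right),$$ and $\alpha(s)\in(0,1]$, $\lambda(s)\in(\frac1p\Lambda(\Omega,2p),\overline{\lambda}(\Omega,p))$, $(\mu(0),u(0))=(0,0)$. Moreover, as $s\to s_\infty$, $\alpha(s)\to0^+$ and $\lambda(s)\to\lambda_\infty(\Omega,p)$, so that $\mu(s)\to0^+$, and in particular for any sequence $s_n\to s_\infty$ there exists a subsequence $\{t_n\}\subseteq\{s_n\}$ such that $\lambda^{\frac1{p-1}}(t_n)\alpha(t_n)u(t_n)\to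 U_\infty$ in $C^2_0(\overline\Omega)$, where $U_\infty$ is a solution of $$-\Delta U_\infty=U_\infty^p\ \text{ in }\Omega,\qquad U_\infty>0\ \text{ in }\Omega,\qquad U_\infty=0\ \text{ on }\partial\Omega .$$
   Context: $p_N=+\infty$ if $N=2$ and $p_N=\frac{N}{N-2}$ if $N\ge3$; $r\in(0,1)$; $|\cdot|$ is Lebesgue measure. $C^{2,r}_0(\overline\Omega)$ (resp. $C^2_0(\overline\Omega)$) is the space of $C^{2,r}(\overline\Omega)$ (resp. $C^2(\overline\Omega)$) functions vanishing on $\partial\Omega$. The Rabinowitz unbounded continuum of $(\ast)$ is the unbounded connected component containing $(0,0)$ of the set of pairs $(\mu,u)\in[0,+\infty)\times C^{2,r}_0(\overline\Omega)$ such that $u\ge0$ is a classical solution of $(\ast)$. Problem $(\mathbf{P})_\lambda$, for fixed $\lambda\ge0$: find $\alpha\in\mathbb{R}$, $\psi\in C^{2,r}(\overline{\Omega})$ with $$-\Delta\psi=(\alpha+\lambda\psi)^p\ \text{ in }\Omega,\quad \int_\Omega(\alpha+\lambda\psi)^p=1,\quad \psi>0\ \text{ in }\Omega,\quad \psi=0\ \text{ on }\partial\Omega,\quad \alpha\ge0 .$$ A solution is denoted $(\alpha_\lambda,\psi_\lambda)$; it is positive if $\alpha_\lambda>0$. Its energy is $E_\lambda=\frac12\int_\Omega|\nabla\psi_\lambda|^2$. $\Lambda(\Omega,t)=\inf_{w\in H^1_0(\Omega),\,w\not\equiv0}\dfrac{\int_\Omega|\nabla w|^2}{\left(\int_\Omega|w|^t\right)^{2/t}}$.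 $\overline{\lambda}(\Omega,p)>0$ denotes a constant depending only on $p,N,\Omega$ such that every solution of $(\mathbf{P})_\lambda$ on $\Omega$ has $\lambda\le\overline{\lambda}(\Omega,p)$ (such a constant exists). $\mathcal{G}(\Omega)$ is the set of solutions of $(\mathbf{P})_\lambda$ with $\lambda\in[0,\frac1p\Lambda(\Omega,2p))$; it is known that for $|\Omega|=1$ and each such $\lambda$ there is exactly one solution, and that $\mathcal{G}(\Omega)$ is a real analytic simple curve of positive solutions $\lambda\mapsto(\alpha_\lambda,\psi_\lambda)$. The Alternative for $\Omega$: either (i) there exists $\lambda_\infty(\Omega,p)\in(\frac1p\Lambda(\Omega,2p),\overline{\lambda}(\Omega,p)]$ such that $\mathcal{G}(\Omega)$ can be continued to a real analytic simple curve of positive solutions $(\alpha_\lambda,\psi_\lambda)$ defined in $[0,\lambda_\infty(\Omega,p))$ such that $\alpha_\lambda$ is strictly decreasing and $E_\lambda$ strictly increasing in $(0,\lambda_\infty(\Omega,p))$, $\alpha_\lambda\searrow0^+$ and $E_\lambda\nearrow E_\infty(\Omega,p)$ as $\lambda\nearrow\lambda_\infty(\Omega,p)$, and for any sequence $\lambda_n\to\lambda_\infty(\Omega,p)^-$ there is a subsequence along which $\psi_{\lambda_n}\to\psi_\infty$ in $C^2_0(\overline\Omega)$, where $\psi_\infty$ solves $(\mathbf{P})_\lambda$ with $\lambda=\lambda_\infty(\Omega,p)$ and $\alpha=0$ and has energy $E_\infty(\Omega,p)$; or (ii) there exists $\lambda_\infty(\Omega,p)\in(\frac1p\Lambda(\Omega,2p),\overline{\lambda}(\Omega,p)]$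 such that $\mathcal{G}(\Omega)$ can be continued to a continuous simple curve without bifurcation points $[0,s_\infty)\ni s\mapsto(\lambda(s),\alpha(s),\psi(s))$, which has locally also the structure of a $1$-dimensional real analytic manifold, such that for any $s$, $(\alpha(s),\psi(s))$ is a positive solution of $(\mathbf{P})_\lambda$ with $\lambda=\lambda(s)$ and, as $s\to s_\infty$, $\alpha(s)\to0^+$, $\lambda(s)\to\lambda_\infty(\Omega,p)$, and for any sequence $s_n\to s_\infty$ there is a subsequence $\{t_n\}\subseteq\{s_n\}$ such that $\psi(t_n)\to\psi_\infty$ in $C^2_0(\overline\Omega)$, where $\psi_\infty$ solves $(\mathbf{P})_\lambda$ with $\lambda=\lambda_\infty(\Omega,p)$ and $\alpha=0$. Curve conventions. Real analytic: locally a totally convergent power series. "Simple": injective. "No bifurcation points": near each point of the curve the set of all solutions $(\lambda,\alpha,\psi)$ coincides with the curve. "Locally a $1$-dimensional real analytic manifold": around each $s_0>0$ there is an injective continuous reparametrization $s=\beta_0(t)$, $t\in(-1,1)$, $\beta_0(0)=s_0$, making $t\mapsto(\lambda,\alpha,\psi)(\beta_0(t))$ real analytic. "Most" domains: given any bounded domain $\Omega_0\subset\mathbb{R}^N$ of class $C^4$, there is a meager set $\mathcal{F}$ in the space $\mathrm{Diff}^4(\Omega_0)$ of $C^4$ diffeomorphisms $h$ of $\overline{\Omega_0}$ onto their image (an open subset of $C^4(\overline{\Omega_0};\mathbb{R}^N)$) such that the property holds for $\Omega=|h(\Omega_0)|^{-1/N}h(\Omega_0)$ for all $h\in\mathrm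{Diff}^4(\Omega_0)\setminus\mathcal{F}$.
   Formalization: λ(s)>Λ(Ω,2p)/p is claimed only past G(Ω), since (μ(0),u(0))=(0,0) forces λ(0)=0; case (i) also assumes no bifurcation points (else the continuum can exceed the curve); λ̄ is taken not attained by a positive solution, so that λ(s)<λ̄. *)

theory Defs
  imports "HOL-Analysis.Analysis"
begin

section \<open>Spaces of differentiable functions\<close>

definition pd :: "'n::finite \<Rightarrow> (real^'n \<Rightarrow> real) \<Rightarrow> real^'n \<Rightarrow> real"
  where "pd i f x = frechet_derivative f (at x) (axis i 1)"

definition grad :: "(real^'n::finite \<Rightarrow> real) \<Rightarrow> real^'n \<Rightarrow> real^'n"
  where "grad f x = (\<chi> i. pd i f x)"

definition laplacian :: "(real^'n::finite \<Rightarrow> real) \<Rightarrow> real^'n \<Rightarrow> real"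
  where "laplacian f x = (\<Sum>i\<in>UNIV. pd i (pd i f) x)"

text \<open>\<open>Ck_on k S f\<close>: \<open>f\<close> is of class \<open>C\<^sup>k\<close> on the open set \<open>S\<close>.\<close>

primrec Ck_on :: "nat \<Rightarrow> (real^'n::finite) set \<Rightarrow> (real^'n \<Rightarrow> real) \<Rightarrow> bool" where
  "Ck_on 0 S f \<longleftrightarrow> continuous_on S f"
| "Ck_on (Suc k) S f \<longleftrightarrow> f differentiable_on S \<and> (\<forall>i. Ck_on k S (pd i f))"

definition extends_to_closure :: "(real^'n::finite) set \<Rightarrow> (real^'n \<Rightarrow> real) \<Rightarrow> bool"
  where "extends_to_closure S g \<longleftrightarrow>
    (\<exists>h. continuous_on (closure S) h \<and> (\<forall>x\<in>S. h x = g x))"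

definition C2_closure :: "(real^'n::finite) set \<Rightarrow> (real^'n \<Rightarrow> real) set"
  where "C2_closure S = {f. continuous_on (closure S) f \<and> Ck_on 2 S f \<and>
    (\<forall>i. extends_to_closure S (pd i f)) \<and> (\<forall>i j. extends_to_closure S (pd i (pd j f)))}"

definition C2r_closure :: "(real^'n::finite) set \<Rightarrow> real \<Rightarrow> (real^'n \<Rightarrow> real) set"
  where "C2r_closure S r = {f \<in> C2_closure S.
    \<forall>i j. \<exists>C. \<forall>x\<in>S. \<forall>y\<in>S. \<bar>pd i (pd j f) x - pd i (pd j f) y\<bar> \<le> C * dist x y powr r}"

text \<open>An element of the space of \<open>C\<^sup>2\<close> functions on the closure of \<open>S\<close> vanishing on the boundary
  is represented by its extension by zero, so that equality of such functions is equality in HOL.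
  For open \<open>S\<close> the condition below covers the boundary and normalizes the values elsewhere.\<close>

definition C20 :: "(real^'n::finite) set \<Rightarrow> (real^'n \<Rightarrow> real) set"
  where "C20 S = {f \<in> C2_closure S. \<forall>x. x \<notin> S \<longrightarrow> f x = 0}"

definition C2r0 :: "(real^'n::finite) set \<Rightarrow> real \<Rightarrow> (real^'n \<Rightarrow> real) set"
  where "C2r0 S r = {f \<in> C2r_closure S r. \<forall>x. x \<notin> S \<longrightarrow> f x = 0}"

definition sup_norm :: "(real^'n::finite) set \<Rightarrow> (real^'n \<Rightarrow> real) \<Rightarrow> real"
  where "sup_norm S g = (SUP x\<in>S. \<bar>g x\<bar>)"

definition hoelder_seminorm :: "(real^'n::finite) set \<Rightarrow> real \<Rightarrow> (real^'n \<Rightarrow> real) \<Rightarrow> real"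
  where "hoelder_seminorm S r g =
    (SUP (x, y)\<in>{(x, y). x \<in> S \<and> y \<in> S \<and> x \<noteq> y}. \<bar>g x - g y\<bar> / dist x y powr r)"

definition C2_norm :: "(real^'n::finite) set \<Rightarrow> (real^'n \<Rightarrow> real) \<Rightarrow> real"
  where "C2_norm S f = sup_norm S f + (\<Sum>i\<in>UNIV. sup_norm S (pd i f))
    + (\<Sum>i\<in>UNIV. \<Sum>j\<in>UNIV. sup_norm S (pd i (pd j f)))"

definition C2r_norm :: "(real^'n::finite) set \<Rightarrow> real \<Rightarrow> (real^'n \<Rightarrow> real) \<Rightarrow> real"
  where "C2r_norm S r f = C2_norm S f
    + (\<Sum>i\<in>UNIV. \<Sum>j\<in>UNIV. hoelder_seminorm S r (pd i (pd j f)))"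

text \<open>The locale \<open>Metric_space\<close> asks for nonnegativity and symmetry of the distance also
  outside the carrier, whence the value 0 there.\<close>

definition C2r_dist ::
    "(real^'n::finite) set \<Rightarrow> real \<Rightarrow> (real^'n \<Rightarrow> real) \<Rightarrow> (real^'n \<Rightarrow> real) \<Rightarrow> real"
  where "C2r_dist S r f g =
    (if f \<in> C2r0 S r \<and> g \<in> C2r0 S r then C2r_norm S r (\<lambda>x. f x - g x) else 0)"

definition C2r0_topology :: "(real^'n::finite) set \<Rightarrow> real \<Rightarrow> (real^'n \<Rightarrow> real) topology"
  where "C2r0_topology S r = Metric_space.mtopology (C2r0 S r) (C2r_dist S r)"


section \<open>Bounded domains of class \<open>C\<^sup>k\<close>\<close>

text \<open>Every boundary point has a ball that is mapped by a \<open>C\<^sup>k\<close> diffeomorphism onto an open set,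
  with the part in \<open>S\<close> going to an open half space and the part in the boundary of \<open>S\<close> to the
  bounding hyperplane (Gilbarg-Trudinger, Section 6.2).\<close>

definition bounded_domain_of_class :: "nat \<Rightarrow> (real^'n::finite) set \<Rightarrow> bool"
  where "bounded_domain_of_class k S \<longleftrightarrow>
    open S \<and> connected S \<and> S \<noteq> {} \<and> bounded S \<and>
    (\<forall>z\<in>frontier S. \<exists>e>0. \<exists>D (\<Phi> :: real^'n \<Rightarrow> real^'n) \<Psi> m. open D \<and> homeomorphism (ball z e) D \<Phi> \<Psi> \<and>
      (\<forall>j. Ck_on k (ball z e) (\<lambda>x. \<Phi> x $ j)) \<and> (\<forall>j. Ck_on k D (\<lambda>y. \<Psi> y $ j)) \<and>
      \<Phi> ` (ball z e \<inter> S) \<subseteq> {y. y $ m > 0} \<and>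
      \<Phi> ` (ball z e \<inter> frontier S) \<subseteq> {y. y $ m = 0})"


section \<open>The space \<open>H\<^sup>1\<^sub>0\<close> and the Sobolev constant\<close>

definition test_functions :: "(real^'n::finite) set \<Rightarrow> (real^'n \<Rightarrow> real) set"
  where "test_functions S = {\<phi>. Ck_on 1 UNIV \<phi> \<and>
    (\<exists>K. compact K \<and> K \<subseteq> S \<and> (\<forall>x. x \<notin> K \<longrightarrow> \<phi> x = 0))}"

text \<open>\<open>H10 S w g\<close>: \<open>w\<close> belongs to \<open>H\<^sup>1\<^sub>0(S)\<close>, the closure of \<open>C\<^sup>1\<^sub>c(S)\<close> in \<open>H\<^sup>1(S)\<close>
  (Gilbarg-Trudinger, Section 7.5), and \<open>g\<close> is its weak gradient.\<close>

definition H10 :: "(real^'n::finite) set \<Rightarrow> (real^'n \<Rightarrow> real) \<Rightarrow> (real^'n \<Rightarrow> real^'n) \<Rightarrow> bool"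
  where "H10 S w g \<longleftrightarrow>
    set_borel_measurable lebesgue S w \<and> set_integrable lebesgue S (\<lambda>x. (w x)\<^sup>2) \<and>
    set_borel_measurable lebesgue S g \<and> set_integrable lebesgue S (\<lambda>x. (norm (g x))\<^sup>2) \<and>
    (\<exists>\<phi>. (\<forall>k. \<phi> k \<in> test_functions S) \<and>
      (\<lambda>k::nat. LINT x:S|lebesgue. (\<phi> k x - w x)\<^sup>2) \<longlonglongrightarrow> 0 \<and>
      (\<lambda>k. LINT x:S|lebesgue. (norm (grad (\<phi> k) x - g x))\<^sup>2) \<longlonglongrightarrow> 0)"

text \<open>If \<open>|w|\<^sup>t\<close> is not integrable, both the Lebesgue integral and the quotient take the value 0
  in HOL, in accordance with the convention that the quotient is 0 for an infinite denominator.\<close>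

definition sobolev_const :: "(real^'n::finite) set \<Rightarrow> real \<Rightarrow> real"
  where "sobolev_const S t =
    Inf {(LINT x:S|lebesgue. (norm (g x))\<^sup>2) / (LINT x:S|lebesgue. \<bar>w x\<bar> powr t) powr (2 / t) | w g.
      H10 S w g \<and> \<not> (AE x in lebesgue. x \<in> S \<longrightarrow> w x = 0)}"


section \<open>The two boundary value problems\<close>

definition p_crit :: "nat \<Rightarrow> ereal"
  where "p_crit N = (if N = 2 then \<infinity> else ereal (real N / (real N - 2)))"

definition solves_P ::
    "(real^'n::finite) set \<Rightarrow> real \<Rightarrow> real \<Rightarrow> real \<Rightarrow> real \<Rightarrow> (real^'n \<Rightarrow> real) \<Rightarrow> bool"
  where "solves_P S r p l a f \<longleftrightarrow>
    0 \<le> l \<and> 0 \<le> a \<and> f \<in> C2r0 S r \<and>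
    (\<forall>x\<in>S. - laplacian f x = (a + l * f x) powr p) \<and>
    (LINT x:S|lebesgue. (a + l * f x) powr p) = 1 \<and>
    (\<forall>x\<in>S. f x > 0)"

definition energy :: "(real^'n::finite) set \<Rightarrow> (real^'n \<Rightarrow> real) \<Rightarrow> real"
  where "energy S f = (1/2) * (LINT x:S|lebesgue. (norm (grad f x))\<^sup>2)"

text \<open>The constant is only required to be an upper bound for all \<open>\<lambda>\<close> admitting a solution.
  It is taken such that it is not attained by a positive solution, since it occurs below as
  the open end of the range of \<open>\<lambda>\<close> along curves of positive solutions.\<close>

definition is_lambda_bar :: "(real^'n::finite) set \<Rightarrow> real \<Rightarrow> real \<Rightarrow> real \<Rightarrow> bool"
  where "is_lambda_bar S r p L \<longleftrightarrow> 0 < L \<and>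
    (\<forall>l a f. solves_P S r p l a f \<longrightarrow> l \<le> L) \<and>
    (\<forall>l a f. solves_P S r p l a f \<and> 0 < a \<longrightarrow> l < L)"

definition G_set :: "(real^'n::finite) set \<Rightarrow> real \<Rightarrow> real \<Rightarrow> (real \<times> real \<times> (real^'n \<Rightarrow> real)) set"
  where "G_set S r p = {(l, a, f). solves_P S r p l a f \<and> l < sobolev_const S (2 * p) / p}"

definition rabinowitz_solutions ::
    "(real^'n::finite) set \<Rightarrow> real \<Rightarrow> real \<Rightarrow> (real \<times> (real^'n \<Rightarrow> real)) set"
  where "rabinowitz_solutions S r p = {(m, u). 0 \<le> m \<and> u \<in> C2r0 S r \<and> (\<forall>x\<in>S. 0 \<le> u x) \<and>
    (\<forall>x\<in>S. - laplacian u x = m * (1 + u x) powr p)}"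

definition rabinowitz_continuum ::
    "(real^'n::finite) set \<Rightarrow> real \<Rightarrow> real \<Rightarrow> (real \<times> (real^'n \<Rightarrow> real)) set"
  where "rabinowitz_continuum S r p =
    connected_component_of_set
      (subtopology (prod_topology (top_of_set {0..}) (C2r0_topology S r))
        (rabinowitz_solutions S r p)) (0, \<lambda>_. 0)"

definition unbounded_pairs ::
    "(real^'n::finite) set \<Rightarrow> real \<Rightarrow> (real \<times> (real^'n \<Rightarrow> real)) set \<Rightarrow> bool"
  where "unbounded_pairs S r X \<longleftrightarrow> (\<forall>B. \<exists>(m, u)\<in>X. \<bar>m\<bar> + C2r_norm S r u > B)"


section \<open>Curves\<close>

text \<open>The parameter interval \<open>[0, s\<^sub>\<infinity>)\<close>, where \<open>s\<^sub>\<infinity> = \<infinity>\<close> is allowed, and the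
  filter of real parameters \<open>s \<rightarrow> s\<^sub>\<infinity>\<close> from the left.\<close>

definition param_dom :: "ereal \<Rightarrow> real set"
  where "param_dom sinf = {s. 0 \<le> s \<and> ereal s < sinf}"

definition at_end :: "ereal \<Rightarrow> real filter"
  where "at_end sinf = filtercomap ereal (at_left sinf)"

text \<open>Real analyticity on an interval: local totally convergent power series, for real functions
  and for functions with values in \<open>C2r0 S r\<close>.\<close>

definition analytic_real :: "real set \<Rightarrow> (real \<Rightarrow> real) \<Rightarrow> bool"
  where "analytic_real I f \<longleftrightarrow> (\<forall>t0\<in>I. \<exists>\<delta>>0. \<exists>c.
    summable (\<lambda>k. \<bar>c k\<bar> * \<delta> ^ k) \<and>
    (\<forall>t\<in>I. \<bar>t - t0\<bar> < \<delta> \<longrightarrow> (\<lambda>k. c k * (t - t0) ^ k) sums f t))"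

definition analytic_C2r0 ::
    "(real^'n::finite) set \<Rightarrow> real \<Rightarrow> real set \<Rightarrow> (real \<Rightarrow> real^'n \<Rightarrow> real) \<Rightarrow> bool"
  where "analytic_C2r0 S r I F \<longleftrightarrow> (\<forall>t0\<in>I. \<exists>\<delta>>0. \<exists>c.
    (\<forall>k. c k \<in> C2r0 S r) \<and> summable (\<lambda>k. C2r_norm S r (c k) * \<delta> ^ k) \<and>
    (\<forall>t\<in>I. \<bar>t - t0\<bar> < \<delta> \<longrightarrow>
      (\<lambda>n. C2r_norm S r (\<lambda>x. F t x - (\<Sum>k<n. (t - t0) ^ k * c k x))) \<longlonglongrightarrow> 0))"

definition positive_solution_curve ::
    "(real^'n::finite) set \<Rightarrow> real \<Rightarrow> real \<Rightarrow> real set \<Rightarrow>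
     (real \<Rightarrow> real) \<Rightarrow> (real \<Rightarrow> real) \<Rightarrow> (real \<Rightarrow> real^'n \<Rightarrow> real) \<Rightarrow> bool"
  where "positive_solution_curve S r p D lam alpha psi \<longleftrightarrow>
    (\<forall>s\<in>D. solves_P S r p (lam s) (alpha s) (psi s) \<and> 0 < alpha s)"

definition simple_curve ::
    "real set \<Rightarrow> (real \<Rightarrow> real) \<Rightarrow> (real \<Rightarrow> real) \<Rightarrow> (real \<Rightarrow> real^'n::finite \<Rightarrow> real) \<Rightarrow> bool"
  where "simple_curve D lam alpha psi \<longleftrightarrow> inj_on (\<lambda>s. (lam s, alpha s, psi s)) D"

definition continuous_curve ::
    "(real^'n::finite) set \<Rightarrow> real \<Rightarrow> real set \<Rightarrow>
     (real \<Rightarrow> real) \<Rightarrow> (real \<Rightarrow> real) \<Rightarrow> (real \<Rightarrow> real^'n \<Rightarrow> real) \<Rightarrow> bool"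
  where "continuous_curve S r D lam alpha psi \<longleftrightarrow>
    continuous_on D lam \<and> continuous_on D alpha \<and>
    continuous_map (top_of_set D) (C2r0_topology S r) psi"

definition analytic_curve ::
    "(real^'n::finite) set \<Rightarrow> real \<Rightarrow> real set \<Rightarrow>
     (real \<Rightarrow> real) \<Rightarrow> (real \<Rightarrow> real) \<Rightarrow> (real \<Rightarrow> real^'n \<Rightarrow> real) \<Rightarrow> bool"
  where "analytic_curve S r I lam alpha psi \<longleftrightarrow>
    analytic_real I lam \<and> analytic_real I alpha \<and> analytic_C2r0 S r I psi"

definition no_bifurcation_points ::
    "(real^'n::finite) set \<Rightarrow> real \<Rightarrow> real \<Rightarrow> real set \<Rightarrow>
     (real \<Rightarrow> real) \<Rightarrow> (real \<Rightarrow> real) \<Rightarrow> (real \<Rightarrow> real^'n \<Rightarrow> real) \<Rightarrow> bool"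
  where "no_bifurcation_points S r p D lam alpha psi \<longleftrightarrow>
    (\<forall>s\<in>D. \<exists>\<epsilon>>0. \<forall>l a f.
      f \<in> C2r0 S r \<and> \<bar>l - lam s\<bar> < \<epsilon> \<and> \<bar>a - alpha s\<bar> < \<epsilon> \<and> C2r_norm S r (\<lambda>x. f x - psi s x) < \<epsilon>
      \<longrightarrow> (solves_P S r p l a f \<longleftrightarrow> (l, a, f) \<in> (\<lambda>t. (lam t, alpha t, psi t)) ` D))"

definition locally_analytic_manifold ::
    "(real^'n::finite) set \<Rightarrow> real \<Rightarrow> real set \<Rightarrow>
     (real \<Rightarrow> real) \<Rightarrow> (real \<Rightarrow> real) \<Rightarrow> (real \<Rightarrow> real^'n \<Rightarrow> real) \<Rightarrow> bool"
  where "locally_analytic_manifold S r D lam alpha psi \<longleftrightarrow>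
    (\<forall>s0\<in>D. 0 < s0 \<longrightarrow> (\<exists>\<beta>. continuous_on {-1<..<1} \<beta> \<and> inj_on \<beta> {-1<..<1} \<and>
      \<beta> ` {-1<..<1} \<subseteq> D \<and> \<beta> 0 = s0 \<and>
      analytic_curve S r {-1<..<1} (lam \<circ> \<beta>) (alpha \<circ> \<beta>) (psi \<circ> \<beta>)))"

text \<open>The curve continues the curve \<open>\<lambda> \<mapsto> (\<alpha>\<^sub>\<lambda>, \<psi>\<^sub>\<lambda>)\<close>, \<open>\<lambda> \<in> [0, \<Lambda>(S,2p)/p)\<close>, which is
  \<open>G_set S r p\<close>: up to the change of parameter \<open>s \<mapsto> \<lambda>(s)\<close> the two agree for \<open>s < s0\<close>.\<close>

definition continues_G ::
    "(real^'n::finite) set \<Rightarrow> real \<Rightarrow> real \<Rightarrow> ereal \<Rightarrow>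
     (real \<Rightarrow> real) \<Rightarrow> (real \<Rightarrow> real) \<Rightarrow> (real \<Rightarrow> real^'n \<Rightarrow> real) \<Rightarrow> real \<Rightarrow> bool"
  where "continues_G S r p sinf lam alpha psi s0 \<longleftrightarrow>
    0 < s0 \<and> ereal s0 < sinf \<and>
    strict_mono_on {0..<s0} lam \<and> lam ` {0..<s0} = {0..<sobolev_const S (2 * p) / p} \<and>
    (\<lambda>s. (lam s, alpha s, psi s)) ` {0..<s0} = G_set S r p"


section \<open>The Alternative\<close>

text \<open>The arguments \<open>sinf lam alpha psi\<close> are the curve whose existence is asserted. In both cases
  the curve is without bifurcation points. In the first case this is part of the meaning of the
  continuation of \<open>G\<close>: monotonicity of \<open>\<alpha>\<close> and of the energy along an analytic curve does not
  exclude that other branches of solutions cross it.\<close>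

definition alternative_i ::
    "(real^'n::finite) set \<Rightarrow> real \<Rightarrow> real \<Rightarrow> real \<Rightarrow> ereal \<Rightarrow>
     (real \<Rightarrow> real) \<Rightarrow> (real \<Rightarrow> real) \<Rightarrow> (real \<Rightarrow> real^'n \<Rightarrow> real) \<Rightarrow> bool"
  where "alternative_i S r p lbar sinf lam alpha psi \<longleftrightarrow>
    (\<exists>linf Einf. linf \<in> {sobolev_const S (2 * p) / p <.. lbar} \<and> sinf = ereal linf \<and>
      (\<forall>s\<in>{0..<linf}. lam s = s) \<and>
      (\<exists>s0. continues_G S r p sinf lam alpha psi s0) \<and>
      positive_solution_curve S r p {0..<linf} lam alpha psi \<and>
      simple_curve {0..<linf} lam alpha psi \<and>
      analytic_curve S r {0..<linf} lam alpha psi \<and>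
      no_bifurcation_points S r p {0..<linf} lam alpha psi \<and>
      strict_antimono_on {0<..<linf} alpha \<and>
      strict_mono_on {0<..<linf} (\<lambda>s. energy S (psi s)) \<and>
      filterlim alpha (at_right 0) (at_left linf) \<and>
      ((\<lambda>s. energy S (psi s)) \<longlongrightarrow> Einf) (at_left linf) \<and>
      (\<forall>\<sigma>. (\<forall>n. \<sigma> n \<in> {0..<linf}) \<and> \<sigma> \<longlonglongrightarrow> linf \<longrightarrow>
        (\<exists>k psi_inf. strict_mono (k :: nat \<Rightarrow> nat) \<and> solves_P S r p linf 0 psi_inf \<and>
          energy S psi_inf = Einf \<and>
          (\<lambda>n. C2_norm S (\<lambda>x. psi (\<sigma> (k n)) x - psi_inf x)) \<longlonglongrightarrow> 0)))"

definition alternative_ii ::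
    "(real^'n::finite) set \<Rightarrow> real \<Rightarrow> real \<Rightarrow> real \<Rightarrow> ereal \<Rightarrow>
     (real \<Rightarrow> real) \<Rightarrow> (real \<Rightarrow> real) \<Rightarrow> (real \<Rightarrow> real^'n \<Rightarrow> real) \<Rightarrow> bool"
  where "alternative_ii S r p lbar sinf lam alpha psi \<longleftrightarrow>
    (\<exists>linf. linf \<in> {sobolev_const S (2 * p) / p <.. lbar} \<and>
      (\<exists>s0. continues_G S r p sinf lam alpha psi s0) \<and>
      positive_solution_curve S r p (param_dom sinf) lam alpha psi \<and>
      simple_curve (param_dom sinf) lam alpha psi \<and>
      continuous_curve S r (param_dom sinf) lam alpha psi \<and>
      no_bifurcation_points S r p (param_dom sinf) lam alpha psi \<and>
      locally_analytic_manifold S r (param_dom sinf) lam alpha psi \<and>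
      filterlim alpha (at_right 0) (at_end sinf) \<and>
      (lam \<longlongrightarrow> linf) (at_end sinf) \<and>
      (\<forall>\<sigma>. (\<forall>n. \<sigma> n \<in> param_dom sinf) \<and> (\<lambda>n. ereal (\<sigma> n)) \<longlonglongrightarrow> sinf \<longrightarrow>
        (\<exists>k psi_inf. strict_mono (k :: nat \<Rightarrow> nat) \<and> solves_P S r p linf 0 psi_inf \<and>
          (\<lambda>n. C2_norm S (\<lambda>x. psi (\<sigma> (k n)) x - psi_inf x)) \<longlonglongrightarrow> 0)))"


section \<open>\<open>C2r_dist\<close> is a metric\<close>


lemma pd_diff:
  assumes "f differentiable_on S" "g differentiable_on S" "open S" "x \<in> S"
  shows "pd i (\<lambda>x. f x - g x) x = pd i f x - pd i g x"
proof -
  have "f differentiable (at x)" "g differentiable (at x)"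
    using assms at_within_open[OF assms(4,3)] unfolding differentiable_on_def by metis+
  then have "(f has_derivative frechet_derivative f (at x)) (at x)"
    and "(g has_derivative frechet_derivative g (at x)) (at x)"
    by (simp_all add: frechet_derivative_works[symmetric])
  from has_derivative_diff[OF this] have "frechet_derivative (\<lambda>x. f x - g x) (at x) =
      (\<lambda>h. frechet_derivative f (at x) h - frechet_derivative g (at x) h)"
    by (rule frechet_derivative_at[symmetric])
  then show ?thesis
    unfolding pd_def by (rule fun_cong)
qed

lemma pd_cong:
  assumes "open S" "x \<in> S" "\<And>y. y \<in> S \<Longrightarrow> f y = g y"
  shows "pd i f x = pd i g x"
proof -
  have "(f has_derivative D) (at x) \<longleftrightarrow> (g has_derivative D) (at x)" for D
    using assms by (metis has_derivative_transform_within_open)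
  thus ?thesis unfolding pd_def frechet_derivative_def by simp
qed

lemma Ck_on_cong:
  assumes "open S" "\<And>y. y \<in> S \<Longrightarrow> f y = g y"
  shows "Ck_on k S f \<longleftrightarrow> Ck_on k S g"
  using assms(2)
proof (induction k arbitrary: f g)
  case 0 thus ?case by (auto cong: continuous_on_cong)
next
  case (Suc k)
  have "Ck_on k S (pd i f) \<longleftrightarrow> Ck_on k S (pd i g)" for i
    by (rule Suc.IH) (use pd_cong assms Suc.prems in blast)
  moreover have "f differentiable_on S \<longleftrightarrow> g differentiable_on S"
    using Suc.prems by (metis differentiable_on_def differentiable_transform_within zero_less_one)
  ultimately show ?case by simp
qed

lemma Ck_on_diff:
  assumes "open S" "Ck_on k S f" "Ck_on k S g"
  shows "Ck_on k S (\<lambda>x. f x - g x)"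
  using assms(2,3)
proof (induction k arbitrary: f g)
  case 0 thus ?case by (auto intro: continuous_intros)
next
  case (Suc k)
  have "Ck_on k S (pd i (\<lambda>x. f x - g x))" for i
  proof -
    have "Ck_on k S (\<lambda>x. pd i f x - pd i g x)" using Suc by auto
    thus ?thesis
      using Ck_on_cong[OF assms(1), of "\<lambda>x. pd i f x - pd i g x" "pd i (\<lambda>x. f x - g x)" k]
        pd_diff[of f S g _ i] Suc.prems assms(1) by auto
  qed
  thus ?case using Suc.prems by (auto intro: derivative_intros differentiable_on_diff)
qed

lemma pd_pd_diff:
  assumes "Ck_on 2 S f" "Ck_on 2 S g" "open S" "x \<in> S"
  shows "pd i (pd j (\<lambda>x. f x - g x)) x = pd i (pd j f) x - pd i (pd j g) x"
proof -
  have *: "f differentiable_on S" "g differentiable_on S" "pd j f differentiable_on S" "pd j g differentiable_on S"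
    using assms by (auto simp: numeral_2_eq_2)
  have "pd i (pd j (\<lambda>x. f x - g x)) x = pd i (\<lambda>x. pd j f x - pd j g x) x"
    by (rule pd_cong[of S]) (use assms * pd_diff in blast)+
  also have "\<dots> = pd i (pd j f) x - pd i (pd j g) x"
    by (rule pd_diff) (use * assms in auto)
  finally show ?thesis .
qed

lemma extends_bdd:
  assumes "bounded S" "extends_to_closure S g"
  shows "\<exists>B. \<forall>x\<in>S. \<bar>g x\<bar> \<le> B"
proof -
  obtain h where h: "continuous_on (closure S) h" "\<forall>x\<in>S. h x = g x"
    using assms unfolding extends_to_closure_def by blast
  have "bounded (h ` closure S)"
    using compact_continuous_image[OF h(1)] assms(1) compact_closure compact_imp_bounded by blast
  then obtain B where "\<forall>x\<in>closure S. \<bar>h x\<bar> \<le> B" by (auto simp: bounded_iff)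
  thus ?thesis using h(2) closure_subset by (metis subsetD)
qed

lemma extends_diff:
  assumes "extends_to_closure S f" "extends_to_closure S g" "\<And>x. x \<in> S \<Longrightarrow> k x = f x - g x"
  shows "extends_to_closure S k"
proof -
  obtain h h' where "continuous_on (closure S) h" "\<forall>x\<in>S. h x = f x"
   "continuous_on (closure S) h'" "\<forall>x\<in>S. h' x = g x"
    using assms unfolding extends_to_closure_def by blast
  thus ?thesis unfolding extends_to_closure_def
    by (intro exI[of _ "\<lambda>x. h x - h' x"]) (auto intro: continuous_intros simp: assms)
qed

lemma C2_closure_diff:
  assumes "open S" "f \<in> C2_closure S" "g \<in> C2_closure S"
  shows "(\<lambda>x. f x - g x) \<in> C2_closure S"
proof -
  have d: "f differentiable_on S" "g differentiable_on S"
    using assms by (auto simp: C2_closure_def numeral_2_eq_2)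
  have "extends_to_closure S (pd i (\<lambda>x. f x - g x))" for i
    by (rule extends_diff[of S "pd i f" "pd i g"]) (use assms d pd_diff[of f S g _ i] in \<open>auto simp: C2_closure_def\<close>)
  moreover have "extends_to_closure S (pd i (pd j (\<lambda>x. f x - g x)))" for i j
    by (rule extends_diff[of S "pd i (pd j f)" "pd i (pd j g)"])
      (use assms d pd_pd_diff[of S f g _ i j] in \<open>auto simp: C2_closure_def\<close>)
  ultimately show ?thesis using assms
    by (auto simp: C2_closure_def intro!: continuous_intros Ck_on_diff)
qed

lemma C2r0_diff:
  assumes "open S" "f \<in> C2r0 S r" "g \<in> C2r0 S r"
  shows "(\<lambda>x. f x - g x) \<in> C2r0 S r"
proof -
  have c: "f \<in> C2_closure S" "g \<in> C2_closure S" using assms by (auto simp: C2r0_def C2r_closure_def)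
  have k: "Ck_on 2 S f" "Ck_on 2 S g" using c by (auto simp: C2_closure_def)
  have "\<exists>C. \<forall>x\<in>S. \<forall>y\<in>S. \<bar>pd i (pd j (\<lambda>x. f x - g x)) x - pd i (pd j (\<lambda>x. f x - g x)) y\<bar> \<le> C * dist x y powr r" for i j
  proof -
    obtain C D where C: "\<forall>x\<in>S. \<forall>y\<in>S. \<bar>pd i (pd j f) x - pd i (pd j f) y\<bar> \<le> C * dist x y powr r"
      and D: "\<forall>x\<in>S. \<forall>y\<in>S. \<bar>pd i (pd j g) x - pd i (pd j g) y\<bar> \<le> D * dist x y powr r"
      using assms unfolding C2r0_def C2r_closure_def by blast
    have "\<bar>pd i (pd j (\<lambda>x. f x - g x)) x - pd i (pd j (\<lambda>x. f x - g x)) y\<bar> \<le> (C+D) * dist x y powr r"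
      if "x\<in>S" "y\<in>S" for x y
    proof -
      have "\<bar>pd i (pd j f) x - pd i (pd j f) y\<bar> \<le> C * dist x y powr r" "\<bar>pd i (pd j g) x - pd i (pd j g) y\<bar> \<le> D * dist x y powr r"
        using C D that by auto
      moreover have "pd i (pd j (\<lambda>x. f x - g x)) x = pd i (pd j f) x - pd i (pd j g) x"
        "pd i (pd j (\<lambda>x. f x - g x)) y = pd i (pd j f) y - pd i (pd j g) y"
        using pd_pd_diff[OF k assms(1)] that by auto
      ultimately show ?thesis by (simp add: algebra_simps)
    qed
    thus ?thesis by blast
  qed
  thus ?thesis using C2_closure_diff[OF assms(1) c] assms by (auto simp: C2r0_def C2r_closure_def)
qed

lemma sup_norm_le: "S \<noteq> {} \<Longrightarrow> (\<And>x. x \<in> S \<Longrightarrow> \<bar>g x\<bar> \<le> B) \<Longrightarrow> sup_norm S g \<le> B"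
  unfolding sup_norm_def by (rule cSUP_least)

lemma sup_norm_ge: "(\<exists>B. \<forall>x\<in>S. \<bar>g x\<bar> \<le> B) \<Longrightarrow> x \<in> S \<Longrightarrow> \<bar>g x\<bar> \<le> sup_norm S g"
  unfolding sup_norm_def by (rule cSUP_upper) (auto simp: bdd_above_def)

lemma sup_norm_triangle:
  assumes "S \<noteq> {}" "\<exists>B. \<forall>x\<in>S. \<bar>f x\<bar> \<le> B" "\<exists>B. \<forall>x\<in>S. \<bar>g x\<bar> \<le> B"
    "\<And>x. x \<in> S \<Longrightarrow> h x = f x + g x"
  shows "sup_norm S h \<le> sup_norm S f + sup_norm S g"
  by (rule sup_norm_le[OF assms(1)])
    (use sup_norm_ge[OF assms(2)] sup_norm_ge[OF assms(3)] assms(4) in \<open>fastforce intro: order_trans[OF abs_triangle_ineq] add_mono\<close>)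

abbreviation off_diagonal where "off_diagonal S \<equiv> {(x, y). x \<in> S \<and> y \<in> S \<and> x \<noteq> y}"

lemma off_diagonal_nonempty: "open S \<Longrightarrow> S \<noteq> {} \<Longrightarrow> off_diagonal (S :: (real^'n::finite) set) \<noteq> {}"
proof -
  assume S: "open S" "S \<noteq> {}"
  then have "infinite S" using finite_imp_not_open by blast
  then obtain x y where "x\<in>S" "y\<in>S" "x \<noteq> y"
    using S by (metis finite.emptyI finite.insertI finite_subset insertCI subsetI)
  thus ?thesis by auto
qed

lemma hoelder_ge:
  assumes "\<exists>C. \<forall>x\<in>S. \<forall>y\<in>S. \<bar>g x - g y\<bar> \<le> C * dist x y powr r" "x \<in> S" "y \<in> S" "x \<noteq> y"
  shows "\<bar>g x - g y\<bar> / dist x y powr r \<le> hoelder_seminorm S r g"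
proof -
  obtain C where "\<forall>x\<in>S. \<forall>y\<in>S. \<bar>g x - g y\<bar> \<le> C * dist x y powr r" using assms by blast
  hence "bdd_above ((\<lambda>(x, y). \<bar>g x - g y\<bar> / dist x y powr r) ` off_diagonal S)"
    by (auto simp: bdd_above_def divide_simps intro!: exI[of _ C])
  from cSUP_upper[OF _ this, of "(x,y)"] show ?thesis using assms by (simp add: hoelder_seminorm_def)
qed

lemma hoelder_triangle:
  fixes S :: "(real^'n::finite) set"
  assumes "open S" "S \<noteq> {}" "\<exists>C. \<forall>x\<in>S. \<forall>y\<in>S. \<bar>f x - f y\<bar> \<le> C * dist x y powr r"
    "\<exists>C. \<forall>x\<in>S. \<forall>y\<in>S. \<bar>g x - g y\<bar> \<le> C * dist x y powr r"
    "\<And>x. x \<in> S \<Longrightarrow> h x = f x + g x"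
  shows "hoelder_seminorm S r h \<le> hoelder_seminorm S r f + hoelder_seminorm S r g"
proof -
  have "\<bar>h x - h y\<bar> / dist x y powr r \<le> hoelder_seminorm S r f + hoelder_seminorm S r g"
    if "x \<in> S" "y \<in> S" "x \<noteq> y" for x y
  proof -
    have "\<bar>h x - h y\<bar> / dist x y powr r \<le> (\<bar>f x - f y\<bar> + \<bar>g x - g y\<bar>) / dist x y powr r"
      using assms(5) that by (intro divide_right_mono) auto
    also have "\<dots> = \<bar>f x - f y\<bar> / dist x y powr r + \<bar>g x - g y\<bar> / dist x y powr r" by (simp add: add_divide_distrib)
    also have "\<dots> \<le> hoelder_seminorm S r f + hoelder_seminorm S r g"
      using hoelder_ge[OF assms(3) that] hoelder_ge[OF assms(4) that] by linarith
    finally show ?thesis .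
  qed
  thus ?thesis unfolding hoelder_seminorm_def[of S r h] using off_diagonal_nonempty[OF assms(1,2)]
    by (intro cSUP_least) auto
qed

lemma C2r0_bdd:
  assumes "bounded S" "f \<in> C2r0 S r"
  shows "\<exists>B. \<forall>x\<in>S. \<bar>f x\<bar> \<le> B" "\<exists>B. \<forall>x\<in>S. \<bar>pd i f x\<bar> \<le> B" "\<exists>B. \<forall>x\<in>S. \<bar>pd i (pd j f) x\<bar> \<le> B"
    "\<exists>C. \<forall>x\<in>S. \<forall>y\<in>S. \<bar>pd i (pd j f) x - pd i (pd j f) y\<bar> \<le> C * dist x y powr r"
proof -
  have "extends_to_closure S f" using assms(2)
    by (auto simp: C2r0_def C2r_closure_def C2_closure_def extends_to_closure_def)
  thus "\<exists>B. \<forall>x\<in>S. \<bar>f x\<bar> \<le> B" using extends_bdd assms by blast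
  have "extends_to_closure S (pd i f)" "extends_to_closure S (pd i (pd j f))"
    using assms by (auto simp: C2r0_def C2r_closure_def C2_closure_def)
  thus "\<exists>B. \<forall>x\<in>S. \<bar>pd i f x\<bar> \<le> B" "\<exists>B. \<forall>x\<in>S. \<bar>pd i (pd j f) x\<bar> \<le> B"
    using extends_bdd assms(1) by blast+
  show "\<exists>C. \<forall>x\<in>S. \<forall>y\<in>S. \<bar>pd i (pd j f) x - pd i (pd j f) y\<bar> \<le> C * dist x y powr r"
    using assms by (auto simp: C2r0_def C2r_closure_def)
qed

lemma C2r_norm_triangle:
  assumes S: "open S" "S \<noteq> {}" "bounded S" and f: "f \<in> C2r0 S r" and g: "g \<in> C2r0 S r"
    and h: "h \<in> C2r0 S r" and *: "\<And>x. f x = h x - g x"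
  shows "C2r_norm S r h \<le> C2r_norm S r f + C2r_norm S r g"
proof -
  have k: "Ck_on 2 S h" "Ck_on 2 S g" "h differentiable_on S" "g differentiable_on S"
    using g h by (auto simp: C2r0_def C2r_closure_def C2_closure_def numeral_2_eq_2)
  have f': "f = (\<lambda>x. h x - g x)" using * by auto
  have 0: "h x = f x + g x" for x using * by simp
  have 1: "pd i h x = pd i f x + pd i g x" if "x \<in> S" for i x
    using pd_diff[OF k(3,4) S(1) that, of i] by (simp add: f')
  have 2: "pd i (pd j h) x = pd i (pd j f) x + pd i (pd j g) x" if "x \<in> S" for i j x
    using pd_pd_diff[OF k(1,2) S(1) that, of i j] by (simp add: f')
  have "sup_norm S h \<le> sup_norm S f + sup_norm S g"
    by (rule sup_norm_triangle[OF S(2) C2r0_bdd(1)[OF S(3) f] C2r0_bdd(1)[OF S(3) g] 0])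
  moreover have "(\<Sum>i\<in>UNIV. sup_norm S (pd i h)) \<le> (\<Sum>i\<in>UNIV. sup_norm S (pd i f)) + (\<Sum>i\<in>UNIV. sup_norm S (pd i g))"
    unfolding sum.distrib[symmetric]
    by (intro sum_mono sup_norm_triangle[OF S(2) C2r0_bdd(2)[OF S(3) f] C2r0_bdd(2)[OF S(3) g] 1])
  moreover have "(\<Sum>i\<in>UNIV. \<Sum>j\<in>UNIV. sup_norm S (pd i (pd j h))) \<le> (\<Sum>i\<in>UNIV. \<Sum>j\<in>UNIV. sup_norm S (pd i (pd j f))) + (\<Sum>i\<in>UNIV. \<Sum>j\<in>UNIV. sup_norm S (pd i (pd j g)))"
    unfolding sum.distrib[symmetric]
    by (intro sum_mono sup_norm_triangle[OF S(2) C2r0_bdd(3)[OF S(3) f] C2r0_bdd(3)[OF S(3) g] 2])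
  moreover have "(\<Sum>i\<in>UNIV. \<Sum>j\<in>UNIV. hoelder_seminorm S r (pd i (pd j h))) \<le> (\<Sum>i\<in>UNIV. \<Sum>j\<in>UNIV. hoelder_seminorm S r (pd i (pd j f))) + (\<Sum>i\<in>UNIV. \<Sum>j\<in>UNIV. hoelder_seminorm S r (pd i (pd j g)))"
    unfolding sum.distrib[symmetric]
    by (intro sum_mono hoelder_triangle[OF S(1,2) C2r0_bdd(4)[OF S(3) f] C2r0_bdd(4)[OF S(3) g] 2])
  ultimately show ?thesis unfolding C2r_norm_def C2_norm_def by linarith
qed

lemma sup_norm_pos: "S \<noteq> {} \<Longrightarrow> (\<exists>B. \<forall>x\<in>S. \<bar>f x\<bar> \<le> B) \<Longrightarrow> 0 \<le> sup_norm S f"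
proof -
  assume "S \<noteq> {}" and b: "\<exists>B. \<forall>x\<in>S. \<bar>f x\<bar> \<le> B"
  then obtain x where "x \<in> S" by blast
  from sup_norm_ge[OF b this] show ?thesis by linarith
qed

lemma hoelder_pos:
  fixes S :: "(real^'n::finite) set"
  assumes "open S" "S \<noteq> {}" "\<exists>C. \<forall>x\<in>S. \<forall>y\<in>S. \<bar>f x - f y\<bar> \<le> C * dist x y powr r"
  shows "0 \<le> hoelder_seminorm S r f"
proof -
  obtain x y where "x\<in>S" "y\<in>S" "x\<noteq>y" using off_diagonal_nonempty[OF assms(1,2)] by auto
  from hoelder_ge[OF assms(3) this] show ?thesis by (rule order_trans[rotated]) simp
qed

lemma C2r_norm_ge_sup:
  assumes S: "open S" "S \<noteq> {}" "bounded S" and f: "f \<in> C2r0 S r"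
  shows "sup_norm S f \<le> C2r_norm S r f" "0 \<le> C2r_norm S r f"
proof -
  note b = C2r0_bdd[OF S(3) f]
  have "0 \<le> (\<Sum>i\<in>UNIV. sup_norm S (pd i f))" "0 \<le> (\<Sum>i\<in>UNIV. \<Sum>j\<in>UNIV. sup_norm S (pd i (pd j f)))"
    "0 \<le> (\<Sum>i\<in>UNIV. \<Sum>j\<in>UNIV. hoelder_seminorm S r (pd i (pd j f)))" "0 \<le> sup_norm S f"
    by (intro sum_nonneg sup_norm_pos hoelder_pos S b)+
  thus "sup_norm S f \<le> C2r_norm S r f" "0 \<le> C2r_norm S r f" unfolding C2r_norm_def C2_norm_def by linarith+
qed

lemma pd_zero: "pd i (\<lambda>_. 0) = (\<lambda>_. 0)"
  by (auto simp: pd_def fun_eq_iff frechet_derivative_const)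

lemma C2r0_zero: "(\<lambda>_. 0) \<in> C2r0 S r"
  by (auto simp: C2r0_def C2r_closure_def C2_closure_def pd_zero extends_to_closure_def numeral_2_eq_2
      intro!: exI[of _ "\<lambda>_. 0"] exI[of _ 0])

lemma C2r_norm_zero:
  assumes "open S" "S \<noteq> {}" shows "C2r_norm S r (\<lambda>_. 0) = 0"
proof -
  have "sup_norm S (\<lambda>_. 0) = 0" unfolding sup_norm_def using assms by simp
  moreover have "hoelder_seminorm S r (\<lambda>_. 0) = 0" unfolding hoelder_seminorm_def
    using off_diagonal_nonempty[OF assms] by (simp add: case_prod_beta)
  ultimately show ?thesis by (simp add: C2r_norm_def C2_norm_def pd_zero)
qed

lemma C2r_norm_sym:
  assumes S: "open S" "S \<noteq> {}" "bounded S" and f: "f \<in> C2r0 S r" and g: "g \<in> C2r0 S r"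
  shows "C2r_norm S r (\<lambda>x. f x - g x) \<le> C2r_norm S r (\<lambda>x. g x - f x)"
proof -
  let ?a = "\<lambda>x. f x - g x" let ?b = "\<lambda>x. g x - f x"
  have k: "Ck_on 2 S f" "Ck_on 2 S g" "f differentiable_on S" "g differentiable_on S"
    using f g by (auto simp: C2r0_def C2r_closure_def C2_closure_def numeral_2_eq_2)
  have 1: "\<bar>pd i ?a x\<bar> = \<bar>pd i ?b x\<bar>" if "x\<in>S" for i x
    using pd_diff[OF k(3,4) S(1) that, of i] pd_diff[OF k(4,3) S(1) that, of i] by simp
  have 2: "pd i (pd j ?a) x = - pd i (pd j ?b) x" if "x\<in>S" for i j x
    using pd_pd_diff[OF k(1,2) S(1) that, of i j] pd_pd_diff[OF k(2,1) S(1) that, of i j] by simp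
  have 3: "sup_norm S ?a = sup_norm S ?b"
    unfolding sup_norm_def by (simp add: abs_minus_commute)
  have 4: "sup_norm S (pd i ?a) = sup_norm S (pd i ?b)" for i
    unfolding sup_norm_def by (rule SUP_cong[OF refl]) (rule 1)
  have 5: "sup_norm S (pd i (pd j ?a)) = sup_norm S (pd i (pd j ?b))" for i j
    unfolding sup_norm_def by (rule SUP_cong[OF refl]) (simp only: 2 abs_minus_cancel)
  have 6: "hoelder_seminorm S r (pd i (pd j ?a)) = hoelder_seminorm S r (pd i (pd j ?b))" for i j
  proof -
    have "\<bar>pd i (pd j ?a) x - pd i (pd j ?a) y\<bar> = \<bar>pd i (pd j ?b) x - pd i (pd j ?b) y\<bar>"
      if "x \<in> S" "y \<in> S" for x y
      unfolding 2[OF that(1)] 2[OF that(2)] by linarith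
    note * = this
    show ?thesis unfolding hoelder_seminorm_def
    proof (rule SUP_cong[OF refl], clarify)
      fix x y assume "x \<in> S" "y \<in> S"
      show "\<bar>pd i (pd j ?a) x - pd i (pd j ?a) y\<bar> / dist x y powr r =
          \<bar>pd i (pd j ?b) x - pd i (pd j ?b) y\<bar> / dist x y powr r"
        by (simp only: *[OF \<open>x \<in> S\<close> \<open>y \<in> S\<close>])
    qed
  qed
  show ?thesis unfolding C2r_norm_def C2_norm_def 3 4 5 6 by (rule order_refl)
qed

lemma Metric_space_C2r0:
  assumes S: "open S" "S \<noteq> {}" "bounded S"
  shows "Metric_space (C2r0 S r) (C2r_dist S r)"
proof
  fix f g h
  show "0 \<le> C2r_dist S r f g" by (simp add: C2r_dist_def C2r_norm_ge_sup(2)[OF S] C2r0_diff[OF S(1)])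
  show "C2r_dist S r f g = C2r_dist S r g f"
  proof (cases "f \<in> C2r0 S r \<and> g \<in> C2r0 S r")
    case True
    then have "C2r_norm S r (\<lambda>x. f x - g x) = C2r_norm S r (\<lambda>x. g x - f x)"
      using C2r_norm_sym[OF S, of f r g] C2r_norm_sym[OF S, of g r f] by (simp add: order_antisym)
    with True show ?thesis by (simp add: C2r_dist_def)
  next
    case False
    then have "\<not> (g \<in> C2r0 S r \<and> f \<in> C2r0 S r)" by blast
    with False show ?thesis by (simp only: C2r_dist_def if_False)
  qed
  assume f: "f \<in> C2r0 S r" and g: "g \<in> C2r0 S r"
  show "C2r_dist S r f g = 0 \<longleftrightarrow> f = g"
  proof
    assume "f = g" thus "C2r_dist S r f g = 0" using C2r_norm_zero[OF S(1,2)] by (simp add: C2r_dist_def)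
  next
    assume 0: "C2r_dist S r f g = 0"
    have d: "(\<lambda>x. f x - g x) \<in> C2r0 S r" by (rule C2r0_diff[OF S(1) f g])
    have "\<bar>f x - g x\<bar> \<le> 0" if "x \<in> S" for x
      using sup_norm_ge[OF C2r0_bdd(1)[OF S(3) d] that] C2r_norm_ge_sup(1)[OF S d] 0 f g
      by (simp add: C2r_dist_def)
    moreover have "f x = g x" if "x \<notin> S" for x using f g that by (simp add: C2r0_def)
    ultimately show "f = g" by fastforce
  qed
  assume h: "h \<in> C2r0 S r"
  show "C2r_dist S r f h \<le> C2r_dist S r f g + C2r_dist S r g h"
    using C2r_norm_triangle[OF S C2r0_diff[OF S(1) f g] C2r0_diff[OF S(1) g h] C2r0_diff[OF S(1) f h]] f g h
    by (simp add: C2r_dist_def)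
qed

end

theory Submission
  imports Defs
begin

text \<open>
  The substitution \<open>\<mu> = \<lambda> \<alpha>\<^sup>p\<^sup>-\<^sup>1\<close>, \<open>u = (\<lambda>/\<alpha>) \<psi>\<close> turns \<open>\<alpha> + \<lambda> \<psi>\<close> into \<open>\<alpha> (1 + u)\<close>, so it maps
  solutions of the constrained problem with \<open>\<alpha> > 0\<close> to solutions of \<open>- \<Delta> u = \<mu> (1 + u)\<^sup>p\<close>. It can be
  inverted where \<open>\<mu> > 0\<close>: the constraint \<open>\<integral>(\<alpha> + \<lambda> \<psi>)\<^sup>p = 1\<close> forces \<open>\<alpha> = (\<integral>(1 + u)\<^sup>p)\<^sup>-\<^sup>1\<^sup>/\<^sup>p\<close>, which
  depends continuously on \<open>u\<close> (\<open>recovered_alpha_tendsto\<close>), and \<open>\<psi> > 0\<close> follows from the second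
  derivative test at a minimum of \<open>u\<close>. For \<open>\<mu> = 0\<close> the only solution is \<open>u = 0\<close>.

  The image of the given curve under this substitution is a connected set of solutions that contains
  \<open>(0, 0)\<close>. It is the whole connected component because it is open and closed in the set of all
  solutions. It is open (\<open>curve_image_open\<close>) since solutions near a point of the image
  correspond to solutions near the curve, which lie on the curve: if \<open>\<lambda>\<close> is below the threshold
  \<open>\<Lambda>/p\<close> because the curve continues \<open>G\<close>, otherwise because the curve has no bifurcation points. It is
  closed (\<open>curve_image_complement_open\<close>) since \<open>\<integral>(\<alpha> + \<lambda> \<psi>)\<^sup>p = 1\<close> and \<open>|\<Omega>| = 1\<close> give
  \<open>\<alpha> (1 + sup u) \<ge> 1\<close>, so that a bound on \<open>u\<close> keeps \<open>\<alpha>\<close> away from 0 and confines the parameter to a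
  compact interval. The same inequality and \<open>\<alpha> \<rightarrow> 0\<close> show that the image is unbounded.

  The strict inequality \<open>\<lambda>(s) > \<Lambda>/p\<close> beyond the part belonging to \<open>G\<close> needs uniqueness also at the value
  \<open>\<lambda> = \<Lambda>/p\<close> itself (\<open>solves_P_unique_le_threshold\<close>). With \<open>\<rho>\<^sub>i = (\<alpha>\<^sub>i + \<lambda> \<psi>\<^sub>i)\<^sup>p\<close>,
  \<open>g = \<rho>\<^sub>1 - \<rho>\<^sub>2\<close> and \<open>\<phi> = \<psi>\<^sub>1 - \<psi>\<^sub>2\<close>, strict convexity of the derivative of \<open>t\<^sup>1\<^sup>/\<^sup>p\<close>
  bounds \<open>\<lambda> \<integral>g \<phi>\<close> strictly from below by a weighted integral of \<open>g\<^sup>2\<close>, whereas the inequality \<open>\<Lambda> \<parallel>\<phi>\<parallel>\<^sup>2 \<le> \<integral>g \<phi>\<close> for the norm of \<open>L\<^sup>2\<^sup>p\<close>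
  and Hoelder's inequality give the opposite estimate. The former inequality
  (\<open>sobolev_inequality_laplacian\<close>) is proved without regularity theory: truncating \<open>\<phi>\<close> near the value 0
  produces functions of compact support, for which integration by parts only uses the translation
  invariance of Lebesgue measure.
\<close>


section \<open>Linear combinations in the function spaces\<close>

lemma pd_eqI: "(f has_derivative D) (at x) \<Longrightarrow> pd i f x = D (axis i 1)"
  by (metis frechet_derivative_at pd_def)

lemma differentiable_on_open_derivative:
  assumes "f differentiable_on S" "open S" "x \<in> S"
  shows "(f has_derivative frechet_derivative f (at x)) (at x)"
  using assms at_within_open[OF assms(3,2)] unfolding differentiable_on_def
  by (metis frechet_derivative_works)

lemma DERIV_along_axis:
  assumes "f differentiable_on S" "open S" "x + t *\<^sub>R axis i 1 \<in> S"
  shows "((\<lambda>t. f (x + t *\<^sub>R axis i 1)) has_real_derivative pd i f (x + t *\<^sub>R axis i 1)) (at t)"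
proof -
  let ?e = "axis i (1::real)"
  note df = differentiable_on_open_derivative[OF assms]
  have "((\<lambda>t. f (x + t *\<^sub>R ?e)) has_derivative
     (\<lambda>h. frechet_derivative f (at (x + t *\<^sub>R ?e)) (h *\<^sub>R ?e))) (at t)"
    by (rule has_derivative_compose[where f="\<lambda>t. x + t *\<^sub>R ?e" and g=f, OF _ df]) (auto intro!: derivative_eq_intros)
  moreover have "linear (frechet_derivative f (at (x + t *\<^sub>R ?e)))"
    using df has_derivative_linear by blast
  ultimately show ?thesis
    by (simp add: has_field_derivative_def pd_def linear_scale mult_commute_abs)
qed

lemma pd_lincomb:
  assumes "f differentiable_on S" "g differentiable_on S" "open S" "x \<in> S"
  shows "pd i (\<lambda>x. a * f x + b * g x) x = a * pd i f x + b * pd i g x"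
proof -
  have "((\<lambda>x. a * f x + b * g x) has_derivative
      (\<lambda>h. a * frechet_derivative f (at x) h + b * frechet_derivative g (at x) h)) (at x)"
    by (intro has_derivative_add has_derivative_mult_right differentiable_on_open_derivative[OF _ assms(3,4)] assms)
  from pd_eqI[OF this] show ?thesis by (simp add: pd_def)
qed

lemma differentiable_on_lincomb:
  fixes f g :: "real^'n::finite \<Rightarrow> real"
  assumes "f differentiable_on S" "g differentiable_on S"
  shows "(\<lambda>x. a * f x + b * g x) differentiable_on S"
  using assms by (intro differentiable_on_add differentiable_on_mult differentiable_on_const) auto

lemma Ck_on_lincomb:
  assumes "open S" "Ck_on k S f" "Ck_on k S g"
  shows "Ck_on k S (\<lambda>x. a * f x + b * g x)"
  using assms(2,3)
proof (induction k arbitrary: f g)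
  case 0 thus ?case by (auto intro!: continuous_intros)
next
  case (Suc k)
  have "Ck_on k S (pd i (\<lambda>x. a * f x + b * g x))" for i
  proof -
    have "Ck_on k S (\<lambda>x. a * pd i f x + b * pd i g x)" using Suc by auto
    thus ?thesis
      using Ck_on_cong[OF assms(1), of "\<lambda>x. a * pd i f x + b * pd i g x"
          "pd i (\<lambda>x. a * f x + b * g x)" k] pd_lincomb[of f S g] Suc.prems assms(1) by auto
  qed
  thus ?case using Suc.prems differentiable_on_lincomb by auto
qed

lemma pd_pd_lincomb:
  assumes "Ck_on 2 S f" "Ck_on 2 S g" "open S" "x \<in> S"
  shows "pd i (pd j (\<lambda>x. a * f x + b * g x)) x = a * pd i (pd j f) x + b * pd i (pd j g) x"
proof -
  have *: "f differentiable_on S" "g differentiable_on S"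
    "pd j f differentiable_on S" "pd j g differentiable_on S"
    using assms by (auto simp: numeral_2_eq_2)
  have "pd i (pd j (\<lambda>x. a * f x + b * g x)) x = pd i (\<lambda>x. a * pd j f x + b * pd j g x) x"
    by (rule pd_cong[of S]) (use assms * pd_lincomb in blast)+
  also have "\<dots> = a * pd i (pd j f) x + b * pd i (pd j g) x"
    by (rule pd_lincomb) (use * assms in auto)
  finally show ?thesis .
qed

lemma extends_to_closure_lincomb:
  assumes "extends_to_closure S f" "extends_to_closure S g"
    "\<And>x. x \<in> S \<Longrightarrow> k x = a * f x + b * g x"
  shows "extends_to_closure S k"
proof -
  obtain h h' where "continuous_on (closure S) h" "\<forall>x\<in>S. h x = f x"
   "continuous_on (closure S) h'" "\<forall>x\<in>S. h' x = g x"
    using assms unfolding extends_to_closure_def by blast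
  thus ?thesis unfolding extends_to_closure_def
    by (intro exI[of _ "\<lambda>x. a * h x + b * h' x"]) (auto intro!: continuous_intros simp: assms)
qed

lemma C2r0_D:
  assumes "f \<in> C2r0 S r"
  shows "continuous_on (closure S) f" "Ck_on 2 S f" "f differentiable_on S"
    "pd i f differentiable_on S" "continuous_on S (pd i (pd j f))"
    "extends_to_closure S (pd i f)" "extends_to_closure S (pd i (pd j f))"
    "\<And>x. x \<notin> S \<Longrightarrow> f x = 0"
    "\<exists>C. \<forall>x\<in>S. \<forall>y\<in>S. \<bar>pd i (pd j f) x - pd i (pd j f) y\<bar> \<le> C * dist x y powr r"
  using assms by (auto simp: C2r0_def C2r_closure_def C2_closure_def numeral_2_eq_2)

lemma C2r0_lincomb:
  assumes S: "open S" and f: "f \<in> C2r0 S r" and g: "g \<in> C2r0 S r"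
  shows "(\<lambda>x. a * f x + b * g x) \<in> C2r0 S r"
proof -
  let ?h = "\<lambda>x. a * f x + b * g x"
  have "extends_to_closure S (pd i ?h)" for i
    by (rule extends_to_closure_lincomb[OF C2r0_D(6)[OF f] C2r0_D(6)[OF g]])
      (rule pd_lincomb[OF C2r0_D(3)[OF f] C2r0_D(3)[OF g] S])
  moreover have "extends_to_closure S (pd i (pd j ?h))" for i j
    by (rule extends_to_closure_lincomb[OF C2r0_D(7)[OF f] C2r0_D(7)[OF g]])
      (rule pd_pd_lincomb[OF C2r0_D(2)[OF f] C2r0_D(2)[OF g] S])
  moreover have "\<exists>C. \<forall>x\<in>S. \<forall>y\<in>S. \<bar>pd i (pd j ?h) x - pd i (pd j ?h) y\<bar> \<le> C * dist x y powr r"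
    for i j
  proof -
    obtain C D where C: "\<forall>x\<in>S. \<forall>y\<in>S. \<bar>pd i (pd j f) x - pd i (pd j f) y\<bar> \<le> C * dist x y powr r"
      and D: "\<forall>x\<in>S. \<forall>y\<in>S. \<bar>pd i (pd j g) x - pd i (pd j g) y\<bar> \<le> D * dist x y powr r"
      using C2r0_D(9)[OF f] C2r0_D(9)[OF g] by blast
    have "\<bar>pd i (pd j ?h) x - pd i (pd j ?h) y\<bar> \<le> (\<bar>a\<bar> * C + \<bar>b\<bar> * D) * dist x y powr r"
      if xy: "x\<in>S" "y\<in>S" for x y
    proof -
      have "pd i (pd j ?h) x - pd i (pd j ?h) y =
          a * (pd i (pd j f) x - pd i (pd j f) y) + b * (pd i (pd j g) x - pd i (pd j g) y)"
        using pd_pd_lincomb[OF C2r0_D(2)[OF f] C2r0_D(2)[OF g] S] xy by (simp add: algebra_simps)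
      also have "\<bar>\<dots>\<bar> \<le> \<bar>a\<bar> * \<bar>pd i (pd j f) x - pd i (pd j f) y\<bar> +
          \<bar>b\<bar> * \<bar>pd i (pd j g) x - pd i (pd j g) y\<bar>"
        by (metis abs_mult abs_triangle_ineq)
      also have "\<dots> \<le> \<bar>a\<bar> * (C * dist x y powr r) + \<bar>b\<bar> * (D * dist x y powr r)"
        using C D xy by (intro add_mono mult_left_mono) auto
      finally show ?thesis by (simp add: algebra_simps)
    qed
    thus ?thesis by blast
  qed
  ultimately show ?thesis using Ck_on_lincomb[OF S C2r0_D(2)[OF f] C2r0_D(2)[OF g]]
      C2r0_D(1,8)[OF f] C2r0_D(1,8)[OF g]
    by (auto simp: C2r0_def C2r_closure_def C2_closure_def intro!: continuous_intros)
qed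

lemma laplacian_lincomb:
  assumes S: "open S" and f: "f \<in> C2r0 S r" and g: "g \<in> C2r0 S r" and x: "x \<in> S"
  shows "laplacian (\<lambda>x. a * f x + b * g x) x = a * laplacian f x + b * laplacian g x"
  unfolding laplacian_def pd_pd_lincomb[OF C2r0_D(2)[OF f] C2r0_D(2)[OF g] S x]
  by (simp add: sum.distrib sum_distrib_left)

lemma sup_norm_lincomb_le:
  assumes "S \<noteq> {}" "\<exists>B. \<forall>x\<in>S. \<bar>f x\<bar> \<le> B" "\<exists>B. \<forall>x\<in>S. \<bar>g x\<bar> \<le> B"
    "\<And>x. x \<in> S \<Longrightarrow> h x = a * f x + b * g x"
  shows "sup_norm S h \<le> \<bar>a\<bar> * sup_norm S f + \<bar>b\<bar> * sup_norm S g"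
proof (rule sup_norm_le[OF assms(1)])
  fix x assume x: "x \<in> S"
  have "\<bar>h x\<bar> \<le> \<bar>a\<bar> * \<bar>f x\<bar> + \<bar>b\<bar> * \<bar>g x\<bar>"
    unfolding assms(4)[OF x] by (metis abs_mult abs_triangle_ineq)
  also have "\<dots> \<le> \<bar>a\<bar> * sup_norm S f + \<bar>b\<bar> * sup_norm S g"
    by (intro add_mono mult_left_mono sup_norm_ge assms x) auto
  finally show "\<bar>h x\<bar> \<le> \<bar>a\<bar> * sup_norm S f + \<bar>b\<bar> * sup_norm S g" .
qed

lemma hoelder_seminorm_lincomb_le:
  fixes S :: "(real^'n::finite) set"
  assumes "open S" "S \<noteq> {}" "\<exists>C. \<forall>x\<in>S. \<forall>y\<in>S. \<bar>f x - f y\<bar> \<le> C * dist x y powr r"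
    "\<exists>C. \<forall>x\<in>S. \<forall>y\<in>S. \<bar>g x - g y\<bar> \<le> C * dist x y powr r"
    "\<And>x. x \<in> S \<Longrightarrow> h x = a * f x + b * g x"
  shows "hoelder_seminorm S r h \<le> \<bar>a\<bar> * hoelder_seminorm S r f + \<bar>b\<bar> * hoelder_seminorm S r g"
proof -
  have "\<bar>h x - h y\<bar> / dist x y powr r \<le> \<bar>a\<bar> * hoelder_seminorm S r f + \<bar>b\<bar> * hoelder_seminorm S r g"
    if "x \<in> S" "y \<in> S" "x \<noteq> y" for x y
  proof -
    have "h x - h y = a * (f x - f y) + b * (g x - g y)"
      using assms(5) that by (simp add: algebra_simps)
    hence "\<bar>h x - h y\<bar> / dist x y powr r \<le> (\<bar>a\<bar> * \<bar>f x - f y\<bar> + \<bar>b\<bar> * \<bar>g x - g y\<bar>) / dist x y powr r"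
      by (intro divide_right_mono) (metis abs_mult abs_triangle_ineq, simp)
    also have "\<dots> = \<bar>a\<bar> * (\<bar>f x - f y\<bar> / dist x y powr r) + \<bar>b\<bar> * (\<bar>g x - g y\<bar> / dist x y powr r)"
      by (simp add: add_divide_distrib)
    also have "\<dots> \<le> \<bar>a\<bar> * hoelder_seminorm S r f + \<bar>b\<bar> * hoelder_seminorm S r g"
      by (intro add_mono mult_left_mono hoelder_ge assms that) auto
    finally show ?thesis .
  qed
  thus ?thesis unfolding hoelder_seminorm_def[of S r h] using off_diagonal_nonempty[OF assms(1,2)]
    by (intro cSUP_least) auto
qed

lemma C2_norm_lincomb_le:
  assumes S: "open S" "S \<noteq> {}" "bounded S" and f: "f \<in> C2r0 S r" and g: "g \<in> C2r0 S r"
  shows "C2_norm S (\<lambda>x. a * f x + b * g x) \<le> \<bar>a\<bar> * C2_norm S f + \<bar>b\<bar> * C2_norm S g"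
proof -
  note f' = C2r0_D[OF f] and g' = C2r0_D[OF g] and bf = C2r0_bdd[OF S(3) f] and bg = C2r0_bdd[OF S(3) g]
  let ?h = "\<lambda>x. a * f x + b * g x"
  have 0: "sup_norm S ?h \<le> \<bar>a\<bar> * sup_norm S f + \<bar>b\<bar> * sup_norm S g"
    by (rule sup_norm_lincomb_le[OF S(2) bf(1) bg(1) refl])
  have 1: "(\<Sum>i\<in>UNIV. sup_norm S (pd i ?h)) \<le>
      (\<Sum>i\<in>UNIV. \<bar>a\<bar> * sup_norm S (pd i f) + \<bar>b\<bar> * sup_norm S (pd i g))"
    by (intro sum_mono sup_norm_lincomb_le[OF S(2) bf(2) bg(2)] pd_lincomb[OF f'(3) g'(3) S(1)])
  have 2: "(\<Sum>i\<in>UNIV. \<Sum>j\<in>UNIV. sup_norm S (pd i (pd j ?h))) \<le>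
      (\<Sum>i\<in>UNIV. \<Sum>j\<in>UNIV. \<bar>a\<bar> * sup_norm S (pd i (pd j f)) + \<bar>b\<bar> * sup_norm S (pd i (pd j g)))"
    by (intro sum_mono sup_norm_lincomb_le[OF S(2) bf(3) bg(3)] pd_pd_lincomb[OF f'(2) g'(2) S(1)])
  show ?thesis using 0 1 2 unfolding C2_norm_def
    by (simp add: sum.distrib algebra_simps sum_distrib_left)
qed

lemma C2r_norm_lincomb_le:
  assumes S: "open S" "S \<noteq> {}" "bounded S" and f: "f \<in> C2r0 S r" and g: "g \<in> C2r0 S r"
  shows "C2r_norm S r (\<lambda>x. a * f x + b * g x) \<le> \<bar>a\<bar> * C2r_norm S r f + \<bar>b\<bar> * C2r_norm S r g"
proof -
  note f' = C2r0_D[OF f] and g' = C2r0_D[OF g]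
  let ?h = "\<lambda>x. a * f x + b * g x"
  have "(\<Sum>i\<in>UNIV. \<Sum>j\<in>UNIV. hoelder_seminorm S r (pd i (pd j ?h))) \<le>
      (\<Sum>i\<in>UNIV. \<Sum>j\<in>UNIV. \<bar>a\<bar> * hoelder_seminorm S r (pd i (pd j f)) + \<bar>b\<bar> * hoelder_seminorm S r (pd i (pd j g)))"
    by (intro sum_mono hoelder_seminorm_lincomb_le[OF S(1,2) f'(9) g'(9)] pd_pd_lincomb[OF f'(2) g'(2) S(1)])
  thus ?thesis using C2_norm_lincomb_le[OF S f g, of a b] unfolding C2r_norm_def
    by (simp add: sum.distrib algebra_simps sum_distrib_left)
qed


section \<open>Integration by parts against test functions\<close>

text \<open>The difference quotients of \<open>F\<close> in the direction \<open>i\<close> have integral 0 by translation invariance. They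
  are bounded and supported in a common ball, so their limit has integral 0 as well.\<close>

lemma integral_pd_compact_support_eq_0:
  fixes F :: "real^'n::finite \<Rightarrow> real"
  assumes diff: "\<And>x. F differentiable (at x)" and cont: "continuous_on UNIV (pd i F)"
    and K: "compact K" "\<And>x. x \<notin> K \<Longrightarrow> F x = 0" 
  shows "integral\<^sup>L lborel (pd i F) = 0"
proof -
  let ?e = "axis i (1::real)"
  have "bounded K" using K(1) compact_imp_bounded by blast
  then obtain R where R: "R > 0" "K \<subseteq> cball 0 R"
    by (metis bounded_subset_ballD ball_subset_cball subset_trans)
  have KF: "F x = 0" if "x \<notin> cball 0 R" for x using K(2) R(2) that by blast
  let ?C = "cball (0::real^'n) (R + 1)"
  have line: "((\<lambda>t. F (x + t *\<^sub>R ?e)) has_real_derivative pd i F (x + t *\<^sub>R ?e)) (at t)" for x t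
    by (rule DERIV_along_axis[of F UNIV]) (use diff in \<open>auto simp: differentiable_on_def\<close>)
  have zero: "pd i F x = 0" if "x \<notin> cball 0 R" for x
  proof -
    have "pd i F x = pd i (\<lambda>_. 0) x"
    proof (rule pd_cong[of "- cball 0 R"])
      show "F y = 0" if "y \<in> - cball 0 R" for y using K(2) R(2) that by blast
    qed (use that in auto)
    thus ?thesis by (simp add: pd_zero)
  qed
  obtain B where B: "\<And>x. \<bar>pd i F x\<bar> \<le> B" "B \<ge> 0"
  proof -
    have "bounded (pd i F ` cball 0 R)"
      using cont by (intro compact_imp_bounded compact_continuous_image) (auto intro: continuous_on_subset)
    then obtain B where "\<And>x. x \<in> cball 0 R \<Longrightarrow> \<bar>pd i F x\<bar> \<le> B"
      unfolding bounded_iff by (metis image_eqI real_norm_def)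
    hence "\<bar>pd i F x\<bar> \<le> max B 0" for x
      using zero[of x] by (cases "x \<in> cball 0 R") (force simp: le_max_iff_disj)+
    thus ?thesis using that[of "max B 0"] by auto
  qed
  have Fc: "continuous_on UNIV F"
    by (auto intro!: continuous_at_imp_continuous_on differentiable_imp_continuous_within diff)
  have Fint: "integrable lborel F"
  proof -
    have "integrable lborel (\<lambda>x. indicator (cball 0 R) x *\<^sub>R F x)"
      by (rule borel_integrable_compact) (auto intro: continuous_on_subset[OF Fc])
    moreover have "(\<lambda>x. indicator (cball 0 R) x *\<^sub>R F x) = F"
    proof
      show "indicator (cball 0 R) x *\<^sub>R F x = F x" for x
        using KF[of x] by (cases "x \<in> cball 0 R") (simp_all del: mem_cball)
    qed
    ultimately show ?thesis by simp
  qed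
  define q where "q n x = (F (x + inverse (Suc n) *\<^sub>R ?e) - F x) * real (Suc n)" for n :: nat and x
  have q0: "integral\<^sup>L lborel (q n) = 0" for n
  proof -
    let ?t = "inverse (real (Suc n)) *\<^sub>R ?e"
    have "integrable lborel (\<lambda>x. F (?t + x))"
      using Fint integrable_distr_eq[of "(+) ?t" lborel borel F] borel_measurable_continuous_onI[OF Fc]
      by (simp add: lborel_distr_plus)
    moreover have "integral\<^sup>L lborel (\<lambda>x. F (?t + x)) = integral\<^sup>L lborel F"
      using integral_distr[of "(+) ?t" lborel borel F] borel_measurable_continuous_onI[OF Fc]
      by (simp add: lborel_distr_plus)
    ultimately show ?thesis using Fint unfolding q_def by (simp add: add.commute)
  qed
  have "(\<lambda>n. integral\<^sup>L lborel (q n)) \<longlonglongrightarrow> integral\<^sup>L lborel (pd i F)"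
  proof (rule integral_dominated_convergence[where w="\<lambda>x. indicator ?C x * B"])
    show "integrable lborel (\<lambda>x. indicator ?C x * B :: real)"
      using emeasure_bounded_finite[of ?C, OF bounded_cball] by (intro integrable_mult_left integrable_real_indicator) auto
    show "pd i F \<in> borel_measurable lborel" using borel_measurable_continuous_onI[OF cont] by simp
    show "q n \<in> borel_measurable lborel" for n
    proof -
      have "continuous_on UNIV (\<lambda>x. F (x + inverse (Suc n) *\<^sub>R ?e))"
        by (rule continuous_on_compose2[OF Fc]) (auto intro!: continuous_intros)
      thus ?thesis unfolding q_def
        by (auto intro!: borel_measurable_continuous_onI continuous_intros Fc simp del: of_nat_Suc)
    qed
    show "AE x in lborel. (\<lambda>n. q n x) \<longlonglongrightarrow> pd i F x"
    proof (rule AE_I2)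
      fix x
      have "((\<lambda>h. (F (x + (0 + h) *\<^sub>R ?e) - F (x + 0 *\<^sub>R ?e)) / h) \<longlongrightarrow> pd i F (x + 0 *\<^sub>R ?e)) (at 0)"
        using line[of x 0] unfolding DERIV_def .
      moreover have "filterlim (\<lambda>n. inverse (real (Suc n))) (at 0) sequentially"
        using LIMSEQ_inverse_real_of_nat by (auto simp: filterlim_at)
      ultimately have "(\<lambda>n. (F (x + inverse (real (Suc n)) *\<^sub>R ?e) - F x) / inverse (real (Suc n))) \<longlonglongrightarrow> pd i F x"
        by (auto dest: filterlim_compose)
      thus "(\<lambda>n. q n x) \<longlonglongrightarrow> pd i F x" by (simp add: q_def divide_inverse)
    qed
    show "AE x in lborel. norm (q n x) \<le> indicator ?C x * B" for n
    proof (rule AE_I2)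
      fix x
      let ?t = "inverse (real (Suc n))"
      have t: "0 < ?t" "?t \<le> 1" by (auto simp: field_simps)
      show "norm (q n x) \<le> indicator ?C x * B"
      proof (cases "x \<in> ?C")
        case True
        obtain z where "F (x + ?t *\<^sub>R ?e) - F (x + 0 *\<^sub>R ?e) = (?t - 0) * pd i F (x + z *\<^sub>R ?e)"
          using MVT2[of 0 ?t "\<lambda>t. F (x + t *\<^sub>R ?e)" "\<lambda>t. pd i F (x + t *\<^sub>R ?e)"] t line by auto
        hence "q n x = pd i F (x + z *\<^sub>R ?e)" by (simp add: q_def)
        thus ?thesis using True B by simp
      next
        case False
        have "norm (x + ?t *\<^sub>R ?e) \<ge> norm x - norm (?t *\<^sub>R ?e)"
          by (metis norm_diff_ineq)
        hence "x + ?t *\<^sub>R ?e \<notin> K" "x \<notin> K" using False R t by (auto simp: norm_axis_1)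
        thus ?thesis using K(2) B(2) by (simp add: q_def)
      qed
    qed
  qed
  thus ?thesis by (simp add: q0 LIMSEQ_const_iff)
qed

lemma set_integrable_bounded_continuous:
  fixes g :: "real^'n::finite \<Rightarrow> real"
  assumes S: "open S" "bounded S" and g: "continuous_on S g" "\<And>x. x \<in> S \<Longrightarrow> \<bar>g x\<bar> \<le> B"
  shows "set_integrable lebesgue S g"
proof -
  have m: "(\<lambda>x. indicator S x *\<^sub>R g x) \<in> borel_measurable lborel"
    using borel_measurable_continuous_on_indicator[OF _ g(1)] S by simp
  have "integrable lborel (\<lambda>x. indicator S x *\<^sub>R g x)"
  proof (rule integrableI_bounded_set[of S _ _ B])
    show "S \<in> sets lborel" using S by simp
    show "emeasure lborel S < \<infinity>" by (rule emeasure_bounded_finite[OF S(2)])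
  qed (use m g(2) in auto)
  thus ?thesis unfolding set_integrable_def by (subst integrable_completion[OF m])
qed

lemma compact_support_integral:
  fixes f :: "real^'n::finite \<Rightarrow> real"
  assumes K: "compact K" "K \<subseteq> S" "\<And>x. x \<notin> K \<Longrightarrow> f x = 0" and f: "continuous_on UNIV f"
  shows "integrable lborel f" "set_integrable lebesgue S f"
    "(LINT x:S|lebesgue. f x) = integral\<^sup>L lborel f"
proof -
  have fS: "(\<lambda>x. indicator S x *\<^sub>R f x) = f" and fK: "(\<lambda>x. indicator K x *\<^sub>R f x) = f"
    using K(2,3) by (fastforce simp: fun_eq_iff indicator_def)+
  have "integrable lborel (\<lambda>x. indicator K x *\<^sub>R f x)"
    by (rule borel_integrable_compact[OF K(1)]) (rule continuous_on_subset[OF f], simp)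
  thus 1: "integrable lborel f" by (simp only: fK)
  have m: "f \<in> borel_measurable lborel" using borel_measurable_continuous_onI[OF f] by simp
  show "set_integrable lebesgue S f" using 1 integrable_completion[OF m]
    by (simp only: set_integrable_def fS)
  show "(LINT x:S|lebesgue. f x) = integral\<^sup>L lborel f"
    unfolding set_lebesgue_integral_def fS by (rule integral_completion[OF m])
qed

text \<open>The product is continuous on \<open>S\<close> and vanishes on the complement of \<open>K\<close>; these two open sets cover the
  space. The behaviour of \<open>h\<close> at the boundary of \<open>S\<close> is arbitrary.\<close>

lemma continuous_mult_compact_support:
  fixes g h :: "'a::t2_space \<Rightarrow> real"
  assumes "open S" "compact K" "K \<subseteq> S" "\<And>x. x \<notin> K \<Longrightarrow> g x = 0"
    "continuous_on UNIV g" "continuous_on S h"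
  shows "continuous_on UNIV (\<lambda>x. g x * h x)"
proof -
  have 1: "continuous_on S (\<lambda>x. g x * h x)"
    using assms by (intro continuous_intros) (auto intro: continuous_on_subset)
  have 2: "continuous_on (- K) (\<lambda>x. g x * h x)"
    by (rule continuous_on_cong[THEN iffD1, OF refl _ continuous_on_const[of _ 0]]) (use assms(4) in auto)
  have "open (- K)" using assms compact_imp_closed by blast
  from continuous_on_open_Un[OF assms(1) this 1 2] show ?thesis
    using assms(3) by (metis Compl_partition sup.absorb_iff2 sup_assoc sup_commute Un_UNIV_left)
qed

text \<open>The boundary of \<open>S\<close> does not enter, because \<open>w * pd i \<phi>\<close> is a \<open>C\<^sup>1\<close> function on the whole space that
  vanishes off \<open>K\<close>.\<close>

lemma integral_by_parts_test_function:
  fixes w \<phi> :: "real^'n::finite \<Rightarrow> real"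
  assumes S: "open S" and w: "Ck_on 1 UNIV w" "compact K" "K \<subseteq> S" "\<And>x. x \<notin> K \<Longrightarrow> w x = 0"
    and \<phi>: "pd i \<phi> differentiable_on S" "continuous_on S (pd i (pd i \<phi>))"
  shows "(LINT x:S|lebesgue. pd i w x * pd i \<phi> x) = - (LINT x:S|lebesgue. w x * pd i (pd i \<phi>) x)"
    and "set_integrable lebesgue S (\<lambda>x. pd i w x * pd i \<phi> x)"
    and "set_integrable lebesgue S (\<lambda>x. w x * pd i (pd i \<phi>) x)"
proof -
  let ?F = "\<lambda>x. w x * pd i \<phi> x"
  have wd: "w differentiable_on UNIV" and wp: "continuous_on UNIV (pd i w)" using w(1) by auto
  have wc: "continuous_on UNIV w" using wd by (rule differentiable_imp_continuous_on)
  have cK: "open (- K)" using w(2) compact_imp_closed by blast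
  have w0: "pd j w x = 0" if "x \<notin> K" for x j
    using pd_cong[OF cK, of x w "\<lambda>_. 0" j] that w(4) by (simp add: pd_zero)
  have \<phi>c: "continuous_on S (pd i \<phi>)" using \<phi>(1) by (rule differentiable_imp_continuous_on)
  have inner: "?F differentiable (at x) \<and> pd i ?F x = pd i w x * pd i \<phi> x + w x * pd i (pd i \<phi>) x" for x
  proof (cases "x \<in> S")
    case True
    have d: "(?F has_derivative (\<lambda>h. w x * frechet_derivative (pd i \<phi>) (at x) h +
        frechet_derivative w (at x) h * pd i \<phi> x)) (at x)"
      by (intro has_derivative_mult differentiable_on_open_derivative[OF wd] 
           differentiable_on_open_derivative[OF \<phi>(1) S True]) auto
    show ?thesis using pd_eqI[OF d] d by (auto simp: differentiable_def pd_def)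
  next
    case False
    hence x: "x \<in> - K" using w(3) by blast
    have "((\<lambda>_. 0) has_derivative (\<lambda>_. 0)) (at x)" by simp
    hence d: "(?F has_derivative (\<lambda>_. 0)) (at x)"
      by (rule has_derivative_transform_within_open[OF _ cK x]) (use w(4) in auto)
    show ?thesis using pd_eqI[OF d] d x w(4) w0 by (auto simp: differentiable_def)
  qed
  have c1: "continuous_on UNIV (\<lambda>x. pd i w x * pd i \<phi> x)"
    by (rule continuous_mult_compact_support[OF S w(2,3) w0 wp \<phi>c])
  have c2: "continuous_on UNIV (\<lambda>x. w x * pd i (pd i \<phi>) x)"
    by (rule continuous_mult_compact_support[OF S w(2,3,4) wc \<phi>(2)])
  have pF: "pd i ?F = (\<lambda>x. pd i w x * pd i \<phi> x + w x * pd i (pd i \<phi>) x)" using inner by blast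
  have "integral\<^sup>L lborel (pd i ?F) = 0"
    by (rule integral_pd_compact_support_eq_0[OF _ _ w(2)])
       (use inner w(4) in \<open>auto simp: pF intro!: continuous_on_add c1 c2\<close>)
  moreover note i1 = compact_support_integral[OF w(2,3) _ c1] and i2 = compact_support_integral[OF w(2,3) _ c2]
  ultimately show "(LINT x:S|lebesgue. pd i w x * pd i \<phi> x) = - (LINT x:S|lebesgue. w x * pd i (pd i \<phi>) x)"
    using i1 i2 w0 w(4) unfolding pF by simp
  show "set_integrable lebesgue S (\<lambda>x. pd i w x * pd i \<phi> x)"
    "set_integrable lebesgue S (\<lambda>x. w x * pd i (pd i \<phi>) x)" using i1 i2 w0 w(4) by simp_all
qed


section \<open>A continuously differentiable truncation at zero\<close>

text \<open>The quadratic estimate of the remainder treats all points alike, including the kink of \<open>max s 0\<close>.\<close>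

lemma DERIV_square_positive_part:
  "((\<lambda>s. (max s 0)\<^sup>2) has_real_derivative 2 * max x 0) (at x)"
proof -
  have bound: "\<bar>(max y 0)\<^sup>2 - (max x 0)\<^sup>2 - 2 * max x 0 * (y - x)\<bar> \<le> (y - x)\<^sup>2" for y :: real
  proof -
    consider "0 \<le> x" "0 \<le> y" | "x < 0" "y < 0" | "0 \<le> x" "y < 0" | "x < 0" "0 \<le> y" by linarith
    thus ?thesis
    proof cases
      case 1
      hence "(max y 0)\<^sup>2 - (max x 0)\<^sup>2 - 2 * max x 0 * (y - x) = (y - x)\<^sup>2"
        by (simp add: power2_eq_square algebra_simps)
      thus ?thesis by simp
    next
      case 2 thus ?thesis by simp
    next
      case 3
      hence "x * y \<le> 0" by (simp add: mult_nonneg_nonpos)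
      moreover have "\<bar>- x\<^sup>2 - 2 * x * (y - x)\<bar> \<le> (y - x)\<^sup>2"
      proof -
        have "- x\<^sup>2 - 2 * x * (y - x) = x * x - 2 * (x * y)" "(y - x)\<^sup>2 = y * y - 2 * (x * y) + x * x"
          by (simp_all add: power2_eq_square algebra_simps)
        moreover have "0 \<le> x * x" "0 \<le> y * y" by simp_all
        ultimately show ?thesis using \<open>x * y \<le> 0\<close> by linarith
      qed
      ultimately show ?thesis using 3 by simp
    next
      case 4
      hence "x * y \<le> 0" by (simp add: mult_nonpos_nonneg)
      moreover have "y\<^sup>2 \<le> (y - x)\<^sup>2"
      proof -
        have "y\<^sup>2 = y * y" "(y - x)\<^sup>2 = y * y - 2 * (x * y) + x * x"
          by (simp_all add: power2_eq_square algebra_simps)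
        moreover have "0 \<le> x * x" by simp
        ultimately show ?thesis using \<open>x * y \<le> 0\<close> by linarith
      qed
      ultimately show ?thesis using 4 by simp
    qed
  qed
  have "(\<lambda>h. ((max (x + h) 0)\<^sup>2 - (max x 0)\<^sup>2) / h) \<midarrow>0\<rightarrow> 2 * max x 0"
  proof (rule LIM_I)
    fix e :: real assume "0 < e"
    show "\<exists>s>0. \<forall>h. h \<noteq> 0 \<and> norm (h - 0) < s \<longrightarrow>
        norm (((max (x + h) 0)\<^sup>2 - (max x 0)\<^sup>2) / h - 2 * max x 0) < e"
    proof (intro exI[of _ e] conjI allI impI \<open>0 < e\<close>)
      fix h :: real assume h: "h \<noteq> 0 \<and> norm (h - 0) < e"
      hence "((max (x + h) 0)\<^sup>2 - (max x 0)\<^sup>2) / h - 2 * max x 0 =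
          ((max (x + h) 0)\<^sup>2 - (max x 0)\<^sup>2 - 2 * max x 0 * h) / h" by (simp add: field_simps)
      moreover have "\<bar>((max (x + h) 0)\<^sup>2 - (max x 0)\<^sup>2 - 2 * max x 0 * h) / h\<bar> \<le> h\<^sup>2 / \<bar>h\<bar>"
        using bound[of "x + h"] by (simp add: abs_divide divide_right_mono)
      moreover have "h\<^sup>2 / \<bar>h\<bar> = \<bar>h\<bar>" using h by (simp add: power2_eq_square divide_simps abs_if)
      ultimately show "norm (((max (x + h) 0)\<^sup>2 - (max x 0)\<^sup>2) / h - 2 * max x 0) < e"
        using h by simp
    qed
  qed
  thus ?thesis by (simp add: DERIV_def)
qed

text \<open>An odd function that vanishes on \<open>[-e, e]\<close> and grows with slope between 0 and 1. The hyperbola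
  \<open>sqrt (s\<^sup>2 + e\<^sup>2) - e\<close> replaces the positive part \<open>s\<^sup>+\<close> of \<open>s = t - e\<close> in order to make the
  truncation continuously differentiable; the two constants \<open>e\<close> cancel.\<close>

definition trunc :: "real \<Rightarrow> real \<Rightarrow> real"
  where "trunc e t = sqrt ((max (t - e) 0)\<^sup>2 + e\<^sup>2) - sqrt ((max (- t - e) 0)\<^sup>2 + e\<^sup>2)"

definition dtrunc :: "real \<Rightarrow> real \<Rightarrow> real"
  where "dtrunc e t = max (t - e) 0 / sqrt ((max (t - e) 0)\<^sup>2 + e\<^sup>2)
    + max (- t - e) 0 / sqrt ((max (- t - e) 0)\<^sup>2 + e\<^sup>2)"

lemma sum_power2_pos: "0 < e \<Longrightarrow> 0 < (x::real)\<^sup>2 + e\<^sup>2"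
  by (meson add_nonneg_pos zero_le_power2 zero_less_power)

lemma DERIV_trunc:
  assumes "0 < e" shows "(trunc e has_real_derivative dtrunc e t) (at t)"
proof -
  have *: "((\<lambda>s. sqrt ((max s 0)\<^sup>2 + e\<^sup>2)) has_real_derivative max s 0 / sqrt ((max s 0)\<^sup>2 + e\<^sup>2)) (at s)" for s
  proof -
    have "((\<lambda>s. (max s 0)\<^sup>2 + e\<^sup>2) has_real_derivative 2 * max s 0 + 0) (at s)"
      by (intro DERIV_add DERIV_square_positive_part DERIV_const)
    with DERIV_real_sqrt[OF sum_power2_pos[OF assms, of "max s 0"]]
    have "((\<lambda>s. sqrt ((max s 0)\<^sup>2 + e\<^sup>2)) has_real_derivative
        inverse (sqrt ((max s 0)\<^sup>2 + e\<^sup>2)) / 2 * (2 * max s 0 + 0)) (at s)"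
      by (rule DERIV_chain2[where g="\<lambda>s. (max s 0)\<^sup>2 + e\<^sup>2" and f=sqrt])
    moreover have "inverse R / 2 * (2 * m + 0) = m / R" for R m :: real by (simp add: inverse_eq_divide)
    ultimately show ?thesis by simp
  qed
  have "((\<lambda>t. sqrt ((max (t - e) 0)\<^sup>2 + e\<^sup>2)) has_real_derivative
      max (t - e) 0 / sqrt ((max (t - e) 0)\<^sup>2 + e\<^sup>2) * 1) (at t)"
    by (rule DERIV_chain2[OF *]) (auto intro!: derivative_eq_intros)
  moreover have "((\<lambda>t. sqrt ((max (- t - e) 0)\<^sup>2 + e\<^sup>2)) has_real_derivative
      max (- t - e) 0 / sqrt ((max (- t - e) 0)\<^sup>2 + e\<^sup>2) * (- 1)) (at t)"
    by (rule DERIV_chain2[OF *]) (auto intro!: derivative_eq_intros)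
  ultimately show ?thesis unfolding trunc_def[abs_def] dtrunc_def
    using DERIV_diff by fastforce
qed

lemma continuous_on_dtrunc:
  assumes "0 < e" shows "continuous_on UNIV (dtrunc e)"
proof -
  have "sqrt ((max s 0)\<^sup>2 + e\<^sup>2) \<noteq> 0" for s using assms by simp
  thus ?thesis unfolding dtrunc_def by (intro continuous_intros) auto
qed

lemma div_sqrt_le_1: "0 < e \<Longrightarrow> 0 \<le> (x::real) \<Longrightarrow> x / sqrt (x\<^sup>2 + e\<^sup>2) \<le> 1"
  using sum_power2_pos[of e x] by (auto simp: divide_le_eq_1 intro: real_le_rsqrt)

lemma dtrunc_bounds:
  assumes "0 < e" shows "0 \<le> dtrunc e t" "dtrunc e t \<le> 1"
proof -
  show "0 \<le> dtrunc e t" unfolding dtrunc_def by (intro add_nonneg_nonneg divide_nonneg_nonneg) auto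
  have "max (t - e) 0 = 0 \<or> max (- t - e) 0 = 0" using assms by linarith
  thus "dtrunc e t \<le> 1" unfolding dtrunc_def
    using div_sqrt_le_1[OF assms, of "max (t - e) 0"] div_sqrt_le_1[OF assms, of "max (- t - e) 0"] by auto
qed

lemma trunc_eq_0: "0 < e \<Longrightarrow> \<bar>t\<bar> \<le> e \<Longrightarrow> trunc e t = 0"
  by (simp add: trunc_def max_def abs_le_iff)

lemma sqrt_sum_squares_bounds:
  assumes "0 < e" "0 \<le> (x::real)"
  shows "x \<le> sqrt (x\<^sup>2 + e\<^sup>2)" "sqrt (x\<^sup>2 + e\<^sup>2) \<le> x + e" "e \<le> sqrt (x\<^sup>2 + e\<^sup>2)"
  using assms by (auto intro!: real_le_rsqrt real_le_lsqrt simp: power2_sum)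

lemma trunc_bounds:
  assumes "0 < e" shows "\<bar>trunc e t\<bar> \<le> \<bar>t\<bar>" "\<bar>trunc e t - t\<bar> \<le> 2 * e"
proof -
  have "\<bar>trunc e t\<bar> \<le> \<bar>t\<bar> \<and> \<bar>trunc e t - t\<bar> \<le> 2 * e"
  proof -
    consider "\<bar>t\<bar> \<le> e" | "t > e" | "t < - e" by linarith
    thus ?thesis
    proof cases
      case 1 thus ?thesis using trunc_eq_0[OF assms 1] by simp
    next
      case 2
      hence "trunc e t = sqrt ((t - e)\<^sup>2 + e\<^sup>2) - e" using assms by (simp add: trunc_def max_def)
      with sqrt_sum_squares_bounds[OF assms, of "t - e"] 2 assms show ?thesis by linarith
    next
      case 3
      hence "trunc e t = e - sqrt ((- t - e)\<^sup>2 + e\<^sup>2)" using assms by (simp add: trunc_def max_def)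
      with sqrt_sum_squares_bounds[OF assms, of "- t - e"] 3 assms show ?thesis by linarith
    qed
  qed
  thus "\<bar>trunc e t\<bar> \<le> \<bar>t\<bar>" "\<bar>trunc e t - t\<bar> \<le> 2 * e" by auto
qed


section \<open>The Sobolev inequality in terms of the Laplacian\<close>

text \<open>The set where \<open>\<bar>f\<bar> \<ge> e\<close> is compact and contained in \<open>S\<close>, since \<open>f\<close> is continuous on the closure and
  vanishes on the boundary.\<close>

lemma truncation_test_function:
  fixes f :: "real^'n::finite \<Rightarrow> real"
  assumes S: "open S" "bounded S" and f: "f \<in> C2r0 S r" and e: "0 < e"
  obtains K where "compact K" "K \<subseteq> S" "\<And>x. x \<notin> K \<Longrightarrow> trunc e (f x) = 0"
    "Ck_on 1 UNIV (\<lambda>x. trunc e (f x))"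
    "\<And>x i. x \<in> S \<Longrightarrow> pd i (\<lambda>x. trunc e (f x)) x = dtrunc e (f x) * pd i f x"
proof -
  let ?w = "\<lambda>x. trunc e (f x)"
  define K where "K = closure S \<inter> (\<lambda>x. \<bar>f x\<bar>) -` {e..}"
  note f' = C2r0_D[OF f]
  have "closed K" unfolding K_def
    by (rule continuous_closed_preimage) (auto intro!: continuous_intros f'(1))
  moreover have "bounded K" unfolding K_def using bounded_closure[OF S(2)] by (rule bounded_subset) auto
  ultimately have K: "compact K" by (simp add: compact_eq_bounded_closed)
  have KS: "K \<subseteq> S" unfolding K_def using f'(8) e by fastforce
  have out: "\<bar>f x\<bar> \<le> e" if "x \<notin> K" for x
    using that f'(8)[of x] e closure_subset[of S] unfolding K_def by (cases "x \<in> S") auto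
  have w0: "?w x = 0" if "x \<notin> K" for x by (rule trunc_eq_0[OF e out[OF that]])
  have cK: "open (- K)" using K compact_imp_closed by blast
  have inS: "(?w has_derivative (\<lambda>h. dtrunc e (f x) * frechet_derivative f (at x) h)) (at x)"
    if "x \<in> S" for x
  proof -
    have "(trunc e has_derivative (\<lambda>h. dtrunc e (f x) * h)) (at (f x))"
      using DERIV_trunc[OF e] by (simp add: has_field_derivative_def)
    from has_derivative_compose[OF differentiable_on_open_derivative[OF f'(3) S(1) that] this]
    show ?thesis .
  qed
  have outK: "(?w has_derivative (\<lambda>_. 0)) (at x)" if "x \<notin> K" for x
  proof -
    have "((\<lambda>_. 0) has_derivative (\<lambda>_. 0)) (at x)" by simp
    thus ?thesis by (rule has_derivative_transform_within_open[OF _ cK]) (use that w0 in auto)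
  qed
  have pdS: "pd i ?w x = dtrunc e (f x) * pd i f x" if "x \<in> S" for x i
    using pd_eqI[OF inS[OF that]] by (simp add: pd_def)
  have pdK: "pd i ?w x = 0" if "x \<notin> K" for x i using pd_eqI[OF outK[OF that]] by simp
  have "?w differentiable_on UNIV"
    unfolding differentiable_on_def using inS outK KS by (metis differentiable_def subsetD)
  moreover have "continuous_on UNIV (pd i ?w)" for i
  proof -
    have "continuous_on S (\<lambda>x. dtrunc e (f x) * pd i f x)"
      by (intro continuous_on_mult continuous_on_compose2[OF continuous_on_dtrunc[OF e]]
           differentiable_imp_continuous_on f') auto
    hence 1: "continuous_on S (pd i ?w)" by (simp only: pdS cong: continuous_on_cong)
    have 2: "continuous_on (- K) (pd i ?w)"
      by (rule continuous_on_cong[THEN iffD1, OF refl _ continuous_on_const[of _ 0]]) (use pdK in auto)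
    have "S \<union> - K = UNIV" using KS by auto
    with continuous_on_open_Un[OF S(1) cK 1 2] show ?thesis by simp
  qed
  ultimately have "Ck_on 1 UNIV ?w" by simp
  with K KS w0 pdS show ?thesis using that by blast
qed

lemma sobolev_const_bdd_below:
  "bdd_below {(LINT x:S|lebesgue. (norm (g x))\<^sup>2) / (LINT x:S|lebesgue. \<bar>w x\<bar> powr t) powr (2 / t) | w g.
      H10 S w g \<and> \<not> (AE x in lebesgue. x \<in> S \<longrightarrow> w x = 0)}"
  unfolding bdd_below_def
  by (intro exI[of _ 0])
     (auto simp: set_lebesgue_integral_def intro!: divide_nonneg_nonneg integral_nonneg_AE)

text \<open>A test function is its own approximating sequence in the definition of \<open>H10\<close>. If \<open>w\<close> vanishes almost
  everywhere, it is not admitted in the infimum, but then the left-hand side is 0.\<close>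

lemma sobolev_inequality_test_function:
  fixes w :: "real^'n::finite \<Rightarrow> real"
  assumes S: "open S" "bounded S" and K: "compact K" "K \<subseteq> S" "\<And>x. x \<notin> K \<Longrightarrow> w x = 0"
    and w: "Ck_on 1 UNIV w"
  shows "sobolev_const S t * (LINT x:S|lebesgue. \<bar>w x\<bar> powr t) powr (2 / t)
    \<le> (LINT x:S|lebesgue. (norm (grad w x))\<^sup>2)"
proof -
  have wc: "continuous_on UNIV w" and gi: "\<And>i. continuous_on UNIV (pd i w)"
    using w by (auto intro: differentiable_imp_continuous_on)
  have gc: "continuous_on UNIV (grad w)"
    unfolding grad_def[abs_def] by (intro continuous_on_vec_lambda gi)
  have cK: "open (- K)" using K compact_imp_closed by blast
  have g0: "grad w x = 0" if "x \<notin> K" for x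
    using pd_cong[OF cK, of x w "\<lambda>_. 0"] that K(3) by (simp add: grad_def pd_zero vec_eq_iff)
  have gint: "set_integrable lebesgue S (\<lambda>x. (norm (grad w x))\<^sup>2)"
    by (rule compact_support_integral(2)[OF K(1,2)]) (use g0 in \<open>auto intro!: continuous_intros gc\<close>)
  have wint: "set_integrable lebesgue S (\<lambda>x. (w x)\<^sup>2)"
    by (rule compact_support_integral(2)[OF K(1,2)]) (use K(3) in \<open>auto intro!: continuous_intros wc\<close>)
  have Sm: "S \<in> sets lebesgue" using S by simp
  have "set_borel_measurable lebesgue S w"
    unfolding set_borel_measurable_def
    by (intro borel_measurable_scaleR borel_measurable_indicator Sm measurable_completion)
      (simp add: borel_measurable_continuous_onI[OF wc])
  moreover have "set_borel_measurable lebesgue S (grad w)"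
    unfolding set_borel_measurable_def
    by (intro borel_measurable_scaleR borel_measurable_indicator Sm measurable_completion)
      (simp add: borel_measurable_continuous_onI[OF gc])
  moreover have "w \<in> test_functions S" unfolding test_functions_def using K w by blast
  ultimately have H: "H10 S w (grad w)"
    unfolding H10_def using wint gint
    by (auto intro!: exI[of _ "\<lambda>_. w"] simp: set_lebesgue_integral_def)
  let ?W = "LINT x:S|lebesgue. \<bar>w x\<bar> powr t" and ?G = "LINT x:S|lebesgue. (norm (grad w x))\<^sup>2"
  have G: "0 \<le> ?G" unfolding set_lebesgue_integral_def by (intro integral_nonneg_AE) auto
  show ?thesis
  proof (cases "?W = 0")
    case True thus ?thesis using G by simp
  next
    case False
    have W: "0 \<le> ?W" unfolding set_lebesgue_integral_def by (intro integral_nonneg_AE) auto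
    have "\<not> (AE x in lebesgue. x \<in> S \<longrightarrow> w x = 0)"
    proof
      assume "AE x in lebesgue. x \<in> S \<longrightarrow> w x = 0"
      hence "AE x in lebesgue. indicator S x *\<^sub>R (\<bar>w x\<bar> powr t) = 0"
        by (rule AE_mp) (auto intro!: AE_I2 simp: indicator_def)
      hence "?W = 0" unfolding set_lebesgue_integral_def by (rule integral_eq_zero_AE)
      with False show False ..
    qed
    with H have "sobolev_const S t \<le> ?G / ?W powr (2 / t)"
      unfolding sobolev_const_def by (intro cInf_lower sobolev_const_bdd_below) blast
    moreover have "0 < ?W powr (2 / t)" using False W by simp
    ultimately show ?thesis by (simp add: pos_le_divide_eq)
  qed
qed
lemma set_integrable_sum:
  fixes f :: "'i \<Rightarrow> 'a \<Rightarrow> real"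
  assumes "finite I" "\<And>i. i \<in> I \<Longrightarrow> set_integrable M A (f i)"
  shows "set_integrable M A (\<lambda>x. \<Sum>i\<in>I. f i x)"
  using assms(2) unfolding set_integrable_def scaleR_sum_right by (rule Bochner_Integration.integrable_sum)

lemma set_integral_sum:
  fixes f :: "'i \<Rightarrow> 'a \<Rightarrow> real"
  assumes "finite I" "\<And>i. i \<in> I \<Longrightarrow> set_integrable M A (f i)"
  shows "(LINT x:A|M. \<Sum>i\<in>I. f i x) = (\<Sum>i\<in>I. LINT x:A|M. f i x)"
  unfolding set_lebesgue_integral_def scaleR_sum_right
  by (rule Bochner_Integration.integral_sum) (use assms in \<open>simp add: set_integrable_def\<close>)

lemma C2r0_bounded_laplacian:
  assumes "bounded S" "f \<in> C2r0 S r"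
  obtains B where "0 \<le> B" "\<And>x. x \<in> S \<Longrightarrow> \<bar>f x\<bar> \<le> B" "\<And>x. x \<in> S \<Longrightarrow> \<bar>laplacian f x\<bar> \<le> B"
proof -
  obtain B1 where B1: "\<And>x. x \<in> S \<Longrightarrow> \<bar>f x\<bar> \<le> B1" using C2r0_bdd(1)[OF assms] by blast
  have "\<forall>i. \<exists>B. \<forall>x\<in>S. \<bar>pd i (pd i f) x\<bar> \<le> B" using C2r0_bdd(3)[OF assms] by blast
  then obtain b where b: "\<And>i x. x \<in> S \<Longrightarrow> \<bar>pd i (pd i f) x\<bar> \<le> b i" by metis
  have B2: "\<bar>laplacian f x\<bar> \<le> (\<Sum>i\<in>UNIV. b i)" if "x \<in> S" for x
    unfolding laplacian_def by (rule order_trans[OF sum_abs]) (intro sum_mono b that)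
  show ?thesis
    by (rule that[of "max 0 (max B1 (\<Sum>i\<in>UNIV. b i))"]) (use B1 B2 in \<open>auto simp: le_max_iff_disj\<close>)
qed

lemma continuous_on_laplacian: "f \<in> C2r0 S r \<Longrightarrow> continuous_on S (laplacian f)"
  unfolding laplacian_def[abs_def] by (intro continuous_on_sum C2r0_D(5))

text \<open>For the truncation \<open>w\<close> of \<open>f\<close> the slope is between 0 and 1, whence
  \<open>\<integral>|\<nabla>w|\<^sup>2 \<le> \<integral>\<nabla>w \<cdot> \<nabla>f = - \<integral>w \<Delta>f\<close>. Both sides of the resulting inequality for \<open>w\<close> converge
  as the truncation level tends to 0, by dominated convergence.\<close>

theorem sobolev_inequality_laplacian:
  fixes f :: "real^'n::finite \<Rightarrow> real"
  assumes S: "open S" "bounded S" and f: "f \<in> C2r0 S r" and t: "0 < t"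
    and L: "0 \<le> sobolev_const S t"
  shows "sobolev_const S t * (LINT x:S|lebesgue. \<bar>f x\<bar> powr t) powr (2 / t)
    \<le> (LINT x:S|lebesgue. - laplacian f x * f x)"
proof -
  note f' = C2r0_D[OF f]
  define e where "e n = inverse (real (Suc n))" for n
  have e: "0 < e n" for n by (simp add: e_def)
  have e0: "e \<longlonglongrightarrow> 0" unfolding e_def by (rule LIMSEQ_inverse_real_of_nat)
  define w where "w n x = trunc (e n) (f x)" for n x
  obtain B where B: "0 \<le> B" "\<And>x. x \<in> S \<Longrightarrow> \<bar>f x\<bar> \<le> B" "\<And>x. x \<in> S \<Longrightarrow> \<bar>laplacian f x\<bar> \<le> B"
    by (rule C2r0_bounded_laplacian[OF S(2) f]) (use that in blast)
  have fc: "continuous_on S f" using f'(3) by (rule differentiable_imp_continuous_on)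
  have lc: "continuous_on S (laplacian f)" by (rule continuous_on_laplacian[OF f])
  have one: "sobolev_const S t * (LINT x:S|lebesgue. \<bar>w n x\<bar> powr t) powr (2 / t)
      \<le> (LINT x:S|lebesgue. - laplacian f x * w n x)" for n
  proof -
    obtain K where K: "compact K" "K \<subseteq> S" "\<And>x. x \<notin> K \<Longrightarrow> w n x = 0" and w: "Ck_on 1 UNIV (w n)"
      and pdw: "\<And>x i. x \<in> S \<Longrightarrow> pd i (w n) x = dtrunc (e n) (f x) * pd i f x"
      using truncation_test_function[OF S f e[of n]] unfolding w_def by metis
    note ibp = integral_by_parts_test_function[OF S(1) w K f'(4) f'(5)]
    have wc: "continuous_on UNIV (w n)" and gi: "\<And>i. continuous_on UNIV (pd i (w n))"
      using w by (auto intro: differentiable_imp_continuous_on)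
    have cK: "open (- K)" using K compact_imp_closed by blast
    have gc: "continuous_on UNIV (grad (w n))"
      unfolding grad_def[abs_def] by (intro continuous_on_vec_lambda gi)
    have g0: "grad (w n) x = 0" if "x \<notin> K" for x
      using pd_cong[OF cK, of x "w n" "\<lambda>_. 0"] that K(3) by (simp add: grad_def pd_zero vec_eq_iff)
    have gint: "set_integrable lebesgue S (\<lambda>x. (norm (grad (w n) x))\<^sup>2)"
      by (rule compact_support_integral(2)[OF K(1,2)]) (use g0 in \<open>auto intro!: continuous_intros gc\<close>)
    have "sobolev_const S t * (LINT x:S|lebesgue. \<bar>w n x\<bar> powr t) powr (2 / t)
        \<le> (LINT x:S|lebesgue. (norm (grad (w n) x))\<^sup>2)"
      by (rule sobolev_inequality_test_function[OF S K w])
    also have "\<dots> \<le> (LINT x:S|lebesgue. \<Sum>i\<in>UNIV. pd i (w n) x * pd i f x)"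
    proof (rule set_integral_mono[OF gint])
      show "set_integrable lebesgue S (\<lambda>x. \<Sum>i\<in>UNIV. pd i (w n) x * pd i f x)"
        by (intro set_integrable_sum ibp(2)) simp
      fix x assume x: "x \<in> S"
      have "(norm (grad (w n) x))\<^sup>2 = (\<Sum>i\<in>UNIV. (pd i (w n) x)\<^sup>2)"
        unfolding grad_def power2_norm_eq_inner inner_vec_def by (simp add: power2_eq_square)
      also have "\<dots> \<le> (\<Sum>i\<in>UNIV. pd i (w n) x * pd i f x)"
      proof (rule sum_mono)
        fix i
        have "(dtrunc (e n) (f x))\<^sup>2 \<le> dtrunc (e n) (f x)"
          using dtrunc_bounds[OF e[of n], of "f x"] by (simp add: power2_eq_square mult_left_le)
        from mult_right_mono[OF this, of "(pd i f x)\<^sup>2"]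
        show "(pd i (w n) x)\<^sup>2 \<le> pd i (w n) x * pd i f x"
          by (simp add: pdw[OF x] power2_eq_square algebra_simps)
      qed
      finally show "(norm (grad (w n) x))\<^sup>2 \<le> (\<Sum>i\<in>UNIV. pd i (w n) x * pd i f x)" .
    qed
    also have "\<dots> = (\<Sum>i\<in>UNIV. LINT x:S|lebesgue. pd i (w n) x * pd i f x)"
      by (rule set_integral_sum) (auto intro: ibp(2))
    also have "\<dots> = - (\<Sum>i\<in>UNIV. LINT x:S|lebesgue. w n x * pd i (pd i f) x)"
      by (simp add: ibp(1) sum_negf)
    also have "(\<Sum>i\<in>UNIV. LINT x:S|lebesgue. w n x * pd i (pd i f) x)
        = (LINT x:S|lebesgue. \<Sum>i\<in>UNIV. w n x * pd i (pd i f) x)"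
      by (rule set_integral_sum[symmetric]) (auto intro: ibp(3))
    also have "- \<dots> = (LINT x:S|lebesgue. - laplacian f x * w n x)"
      unfolding laplacian_def set_lebesgue_integral_def
      by (simp add: sum_distrib_left mult.commute flip: Bochner_Integration.integral_minus)
    finally show ?thesis .
  qed
  have wf: "(\<lambda>n. w n x) \<longlonglongrightarrow> f x" for x
  proof -
    have "(\<lambda>n. w n x - f x) \<longlonglongrightarrow> 0"
      by (rule Lim_null_comparison[of _ "\<lambda>n. 2 * e n"])
        (use trunc_bounds(2)[OF e] tendsto_mult_left[OF e0, of 2] in \<open>auto simp: w_def\<close>)
    thus ?thesis by (simp add: LIM_zero_iff)
  qed
  have wfl: "\<bar>w n x\<bar> \<le> \<bar>f x\<bar>" for n x unfolding w_def by (rule trunc_bounds(1)[OF e])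
  have wc: "continuous_on S (w n)" for n unfolding w_def
    by (rule continuous_on_compose2[of UNIV "trunc (e n)"])
      (use DERIV_trunc[OF e] fc in \<open>auto intro!: DERIV_continuous_on simp: has_field_derivative_at_within\<close>)
  have powc: "continuous_on S (\<lambda>x. \<bar>h x\<bar> powr t)" if "continuous_on S h" for h :: "real^'n \<Rightarrow> real"
    by (rule continuous_on_powr') (use t that in \<open>auto intro!: continuous_on_rabs continuous_on_const\<close>)
  have meas: "(\<lambda>x. indicator S x *\<^sub>R h x) \<in> borel_measurable lebesgue" if "continuous_on S h" for h :: "real^'n \<Rightarrow> real"
    using borel_measurable_continuous_on_indicator[OF _ that] S by (simp add: measurable_completion)
  have "set_integrable lebesgue S (\<lambda>x. \<bar>f x\<bar> powr t)"
    by (rule set_integrable_bounded_continuous[OF S powc[OF fc], of "B powr t"])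
      (use B t in \<open>auto intro!: powr_mono2\<close>)
  hence lim1: "(\<lambda>n. LINT x:S|lebesgue. \<bar>w n x\<bar> powr t) \<longlonglongrightarrow> (LINT x:S|lebesgue. \<bar>f x\<bar> powr t)"
    unfolding set_lebesgue_integral_def set_integrable_def
  proof (rule integral_dominated_convergence[rotated 2])
    show "(\<lambda>x. indicat_real S x *\<^sub>R \<bar>f x\<bar> powr t) \<in> borel_measurable lebesgue"
      "\<And>n. (\<lambda>x. indicat_real S x *\<^sub>R \<bar>w n x\<bar> powr t) \<in> borel_measurable lebesgue"
      by (rule meas[OF powc[OF fc]], rule meas[OF powc[OF wc]])
  qed (use t wfl in \<open>auto intro!: tendsto_intros wf AE_I2 mult_left_mono powr_mono2 tendsto_powr'\<close>)
  have "set_integrable lebesgue S (\<lambda>x. B * B)"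
    by (rule set_integrable_bounded_continuous[OF S, of _ "B * B"]) auto
  hence lim2: "(\<lambda>n. LINT x:S|lebesgue. - laplacian f x * w n x) \<longlonglongrightarrow> (LINT x:S|lebesgue. - laplacian f x * f x)"
    unfolding set_lebesgue_integral_def set_integrable_def
  proof (rule integral_dominated_convergence[rotated 2])
    show "AE x in lebesgue. norm (indicat_real S x *\<^sub>R (- laplacian f x * w n x)) \<le> indicat_real S x *\<^sub>R (B * B)" for n
      using B order_trans[OF wfl B(2)] by (auto simp: abs_mult indicator_def intro!: AE_I2 mult_mono)
    show "(\<lambda>x. indicat_real S x *\<^sub>R (- laplacian f x * f x)) \<in> borel_measurable lebesgue"
      "\<And>n. (\<lambda>x. indicat_real S x *\<^sub>R (- laplacian f x * w n x)) \<in> borel_measurable lebesgue"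
      by (intro meas continuous_intros lc fc wc)+
  qed (auto intro!: AE_I2 tendsto_intros wf)
  have "(\<lambda>n. sobolev_const S t * (LINT x:S|lebesgue. \<bar>w n x\<bar> powr t) powr (2 / t)) \<longlonglongrightarrow>
      sobolev_const S t * (LINT x:S|lebesgue. \<bar>f x\<bar> powr t) powr (2 / t)"
    by (intro tendsto_mult tendsto_const tendsto_powr'[OF lim1 tendsto_const])
      (use t in \<open>auto simp: set_lebesgue_integral_def intro!: always_eventually integral_nonneg_AE AE_I2\<close>)
  from LIMSEQ_le[OF this lim2] one show ?thesis by blast
qed


section \<open>Uniqueness up to the threshold\<close>

lemma set_integrable_continuous_on_closure:
  fixes g :: "real^'n::finite \<Rightarrow> real"
  assumes S: "open S" "bounded S" and g: "continuous_on (closure S) g"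
  shows "set_integrable lebesgue S g"
proof -
  have "extends_to_closure S g" using g by (auto simp: extends_to_closure_def)
  from extends_bdd[OF S(2) this] obtain B where "\<And>x. x \<in> S \<Longrightarrow> \<bar>g x\<bar> \<le> B" by blast
  thus ?thesis
    by (intro set_integrable_bounded_continuous[OF S continuous_on_subset[OF g closure_subset]])
qed

lemma continuous_integral_eq_0D:
  fixes h :: "real^'n::finite \<Rightarrow> real"
  assumes S: "open S" and h: "continuous_on S h" "\<And>x. x \<in> S \<Longrightarrow> 0 \<le> h x"
    and int: "set_integrable lebesgue S h" "(LINT x:S|lebesgue. h x) \<le> 0" and x: "x \<in> S"
  shows "h x = 0"
proof -
  have nn: "AE x in lebesgue. 0 \<le> indicat_real S x *\<^sub>R h x"
    using h(2) by (auto intro!: AE_I2 simp: indicator_def)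
  have "0 \<le> integral\<^sup>L lebesgue (\<lambda>x. indicat_real S x *\<^sub>R h x)" by (rule integral_nonneg_AE[OF nn])
  hence "integral\<^sup>L lebesgue (\<lambda>x. indicat_real S x *\<^sub>R h x) = 0"
    using int(2) unfolding set_lebesgue_integral_def by linarith
  hence ae: "AE x in lebesgue. indicat_real S x *\<^sub>R h x = 0"
    using integral_nonneg_eq_0_iff_AE[OF _ nn] int(1) unfolding set_integrable_def by blast
  let ?N = "S \<inter> h -` (- {0})"
  have o: "open ?N" by (rule continuous_open_preimage[OF h(1) S]) auto
  have "AE x in lebesgue. x \<notin> ?N" using ae by (rule AE_mp) (auto intro!: AE_I2 simp: indicator_def)
  hence "?N \<in> null_sets lebesgue" using o by (subst AE_iff_null_sets) auto
  hence "negligible ?N" by (simp add: negligible_iff_null_sets)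
  hence "?N = {}" using o open_not_negligible by blast
  thus ?thesis using x by auto
qed

text \<open>The left-hand side without \<open>x - y\<close> is the derivative of \<open>t\<^sup>\<theta>\<close> at the midpoint of \<open>[y, x]\<close>. This
  derivative is strictly convex, so it is less than its mean over the interval.\<close>

lemma powr_diff_gt_midpoint:
  fixes x y \<theta> :: real
  assumes "0 < y" "y < x" "0 < \<theta>" "\<theta> < 1"
  shows "\<theta> * (x - y) * ((x + y) / 2) powr (\<theta> - 1) < x powr \<theta> - y powr \<theta>"
proof -
  define m d where "m = (x + y) / 2" and "d = (x - y) / 2"
  have md: "x = m + d" "y = m - d" "0 < d" "d < m" using assms by (auto simp: m_def d_def field_simps)
  define F where "F t = (m + t) powr \<theta> - (m - t) powr \<theta> - 2 * \<theta> * t * m powr (\<theta> - 1)" for t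
  define F' where "F' t = \<theta> * ((m + t) powr (\<theta> - 1) + (m - t) powr (\<theta> - 1) - 2 * m powr (\<theta> - 1))" for t
  have der: "(F has_real_derivative F' t) (at t)" if t: "0 \<le> t" "t \<le> d" for t
  proof -
    have "((\<lambda>t. (m + t) powr \<theta>) has_real_derivative \<theta> * (m + t) powr (\<theta> - 1) * 1) (at t)"
      using t md by (intro DERIV_chain2[OF has_real_derivative_powr]) (auto intro!: derivative_eq_intros)
    moreover have "((\<lambda>t. (m - t) powr \<theta>) has_real_derivative \<theta> * (m - t) powr (\<theta> - 1) * (- 1)) (at t)"
      using t md by (intro DERIV_chain2[OF has_real_derivative_powr]) (auto intro!: derivative_eq_intros)
    moreover have "((\<lambda>t. 2 * \<theta> * t * m powr (\<theta> - 1)) has_real_derivative 2 * \<theta> * m powr (\<theta> - 1)) (at t)"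
      by (auto intro!: derivative_eq_intros)
    ultimately have "(F has_real_derivative \<theta> * (m + t) powr (\<theta> - 1) * 1 - \<theta> * (m - t) powr (\<theta> - 1) * (- 1)
        - 2 * \<theta> * m powr (\<theta> - 1)) (at t)" unfolding F_def by (intro DERIV_diff)
    thus ?thesis by (simp add: F'_def algebra_simps)
  qed
  obtain z where z: "0 < z" "z < d" "F d - F 0 = (d - 0) * F' z"
    using MVT2[OF md(3) der] by blast
  let ?A = "(m + z) powr (\<theta> - 1)" and ?B = "(m - z) powr (\<theta> - 1)" and ?C = "m powr (\<theta> - 1)"
  have "2 * ?C < ?A + ?B"
  proof (rule power2_less_imp_less)
    have "m powr (\<theta> - 1) * m powr (\<theta> - 1) = (m * m) powr (\<theta> - 1)" using md by (simp add: powr_mult)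
    also have "\<dots> < ((m + z) * (m - z)) powr (\<theta> - 1)"
    proof (rule powr_less_mono2_neg)
      show "0 < (m + z) * (m - z)" using z md by (intro mult_pos_pos) auto
      have "0 < z * z" using z by simp
      thus "(m + z) * (m - z) < m * m" by (simp add: algebra_simps)
    qed (use assms in auto)
    also have "\<dots> = ?A * ?B" using z md by (simp add: powr_mult)
    finally have "4 * (?C * ?C) < 4 * (?A * ?B)" by simp
    also have "\<dots> \<le> (?A + ?B)\<^sup>2" using zero_le_power2[of "?A - ?B"]
      by (simp add: power2_eq_square algebra_simps)
    finally show "(2 * ?C)\<^sup>2 < (?A + ?B)\<^sup>2" by (simp add: power2_eq_square)
  qed simp
  hence "0 < F' z" unfolding F'_def using assms by simp
  hence "0 < F d" using z by (simp add: F_def)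
  thus ?thesis by (simp add: F_def md algebra_simps)
qed

lemma C2r0_eq_0_if_integral_le_0:
  fixes f :: "real^'n::finite \<Rightarrow> real"
  assumes S: "open S" "bounded S" and f: "f \<in> C2r0 S r" and t: "0 < t"
    and L: "0 < sobolev_const S t" and le: "(LINT x:S|lebesgue. - laplacian f x * f x) \<le> 0"
  shows "f x = 0"
proof (cases "x \<in> S")
  case False thus ?thesis using C2r0_D(8)[OF f] by simp
next
  case True
  have c: "continuous_on (closure S) (\<lambda>x. \<bar>f x\<bar> powr t)"
    by (rule continuous_on_powr') (use t in \<open>auto intro!: continuous_on_rabs C2r0_D(1)[OF f] continuous_on_const\<close>)
  have "sobolev_const S t * (LINT x:S|lebesgue. \<bar>f x\<bar> powr t) powr (2 / t) \<le> 0"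
    using sobolev_inequality_laplacian[OF S f t] L le by linarith
  hence "(LINT x:S|lebesgue. \<bar>f x\<bar> powr t) powr (2 / t) \<le> 0" using L by (simp add: mult_le_0_iff)
  hence "(LINT x:S|lebesgue. \<bar>f x\<bar> powr t) \<le> 0" by (metis powr_gt_zero not_le order_less_irrefl)
  hence "\<bar>f x\<bar> powr t = 0"
    by (intro continuous_integral_eq_0D[OF S(1) continuous_on_subset[OF c closure_subset] _
          set_integrable_continuous_on_closure[OF S c] _ True]) auto
  thus ?thesis by simp
qed

text \<open>Put \<open>L = sobolev_const S (2 * p)\<close>, \<open>v\<^sub>i = a\<^sub>i + l f\<^sub>i\<close>, \<open>g = v\<^sub>1\<^sup>p - v\<^sub>2\<^sup>p\<close>, \<open>\<phi> = f\<^sub>1 - f\<^sub>2\<close> and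
  \<open>Q = \<integral>g \<phi>\<close>. With \<open>m\<close> the mean of \<open>v\<^sub>1\<^sup>p\<close> and \<open>v\<^sub>2\<^sup>p\<close>, which has integral 1, and \<open>k\<close> the power \<open>1/p - 1\<close> of \<open>m\<close>,
  Young's and Hoelder's inequalities give
  \<open>2 Q \<le> (1/L) \<integral>g\<^sup>2 k + L \<parallel>\<phi>\<parallel>\<^sup>2 \<le> (1/L) \<integral>g\<^sup>2 k + Q\<close>, that is, \<open>L Q \<le> \<integral>g\<^sup>2 k\<close>. On the other
  hand \<open>\<integral>g = 0\<close>, so \<open>l Q = \<integral>g (v\<^sub>1 - v\<^sub>2)\<close>, and \<open>g (v\<^sub>1 - v\<^sub>2)\<close> exceeds \<open>(1/p) g\<^sup>2 k\<close> wherever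
  \<open>g \<noteq> 0\<close>. For \<open>l p \<le> L\<close> this leaves only \<open>g = 0\<close>. Because the last inequality is strict, the borderline case
  \<open>l p = L\<close> is included.\<close>

lemma solves_P_unique_le_threshold:
  fixes S :: "(real^'n::finite) set"
  assumes S: "open S" "bounded S" and p: "1 < p"
    and L: "0 < sobolev_const S (2 * p)" and l: "l * p \<le> sobolev_const S (2 * p)"
    and s1: "solves_P S r p l a1 f1" "0 < a1" and s2: "solves_P S r p l a2 f2" "0 < a2"
  shows "a1 = a2 \<and> f1 = f2"
proof (cases "S = {}")
  case True
  thus ?thesis using s1 by (simp add: solves_P_def set_lebesgue_integral_def)
next
  case False
  define L' where "L' = sobolev_const S (2 * p)"
  have L0: "0 < L'" and lL: "l * p \<le> L'" using L l by (simp_all add: L'_def)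
  note f1 = s1(1)[unfolded solves_P_def] and f2 = s2(1)[unfolded solves_P_def]
  have l0: "0 \<le> l" and m1: "f1 \<in> C2r0 S r" and m2: "f2 \<in> C2r0 S r" using f1 f2 by auto
  have n1: "0 \<le> f1 x" and n2: "0 \<le> f2 x" for x
    using f1 f2 C2r0_D(8)[OF m1, of x] C2r0_D(8)[OF m2, of x] by (cases "x \<in> S"; force)+
  define v1 v2 where "v1 x = a1 + l * f1 x" and "v2 x = a2 + l * f2 x" for x
  have v1: "0 < v1 x" and v2: "0 < v2 x" for x
    using n1[of x] n2[of x] l0 s1(2) s2(2) by (simp_all add: v1_def v2_def add_pos_nonneg)
  define R1 R2 where "R1 x = v1 x powr p" and "R2 x = v2 x powr p" for x
  have R1: "0 < R1 x" and R2: "0 < R2 x" for x using v1[of x] v2[of x] by (simp_all add: R1_def R2_def)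
  define g where "g x = R1 x - R2 x" for x
  define m where "m x = (R1 x + R2 x) / 2" for x
  define k where "k x = m x powr (1 / p - 1)" for x
  define \<phi> where "\<phi> x = f1 x - f2 x" for x
  have m: "0 < m x" for x using R1[of x] R2[of x] by (simp add: m_def)
  have k: "0 < k x" for x using m[of x] by (simp add: k_def)
  have \<phi>: "\<phi> \<in> C2r0 S r" using C2r0_lincomb[OF S(1) m1 m2, of 1 "-1"] by (simp add: \<phi>_def[abs_def])
  have lap: "- laplacian \<phi> x = g x" if "x \<in> S" for x
    using laplacian_lincomb[OF S(1) m1 m2 that, of 1 "-1"] f1 f2 that
    by (simp add: \<phi>_def[abs_def] g_def R1_def R2_def v1_def v2_def)
  have cf: "continuous_on (closure S) f1" "continuous_on (closure S) f2" "continuous_on (closure S) \<phi>"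
    using C2r0_D(1) m1 m2 \<phi> by blast+
  have cv: "continuous_on (closure S) v1" "continuous_on (closure S) v2"
    unfolding v1_def v2_def by (intro continuous_intros cf)+
  have cR: "continuous_on (closure S) R1" "continuous_on (closure S) R2"
    unfolding R1_def R2_def using v1 v2 by (intro continuous_on_powr cv continuous_on_const; metis order_less_irrefl)+
  have cg: "continuous_on (closure S) g" unfolding g_def by (intro continuous_intros cR)
  have cm: "continuous_on (closure S) m" unfolding m_def by (intro continuous_intros cR) auto
  have cmp: "continuous_on (closure S) (\<lambda>x. m x powr c)" for c
    using m by (intro continuous_on_powr cm continuous_on_const; metis order_less_irrefl)
  have ck: "continuous_on (closure S) k" unfolding k_def by (rule cmp)
  have ct: "continuous_on (closure S) (\<lambda>x. \<bar>\<phi> x\<bar> powr (2 * p))"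
    by (rule continuous_on_powr') (use p in \<open>auto intro!: continuous_on_rabs cf continuous_on_const\<close>)
  note int = set_integrable_continuous_on_closure[OF S]
  define Q where "Q = (LINT x:S|lebesgue. g x * \<phi> x)"
  define I where "I = (LINT x:S|lebesgue. \<bar>\<phi> x\<bar> powr (2 * p))"
  define G where "G = (LINT x:S|lebesgue. (g x)\<^sup>2 * k x)"
  have I0: "0 \<le> I" unfolding I_def set_lebesgue_integral_def by (intro integral_nonneg_AE) auto
  have Q_lap: "(LINT x:S|lebesgue. - laplacian \<phi> x * \<phi> x) = Q"
    unfolding Q_def by (rule set_lebesgue_integral_cong) (use S lap in auto)
  have sob: "L' * I powr (1 / p) \<le> Q"
    using sobolev_inequality_laplacian[OF S \<phi>, of "2 * p"] p L0 unfolding Q_lap by (simp add: I_def L'_def)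
  have Q0: "0 \<le> Q" using sob L0 by (meson mult_nonneg_nonneg order_trans powr_ge_zero less_imp_le)
  have int1: "(LINT x:S|lebesgue. R1 x) = 1" "(LINT x:S|lebesgue. R2 x) = 1"
    using f1 f2 by (simp_all add: R1_def R2_def v1_def v2_def)
  have intg: "(LINT x:S|lebesgue. g x) = 0" unfolding g_def
    by (subst set_integral_diff(2)) (use int1 int cR in auto)
  have intm: "(LINT x:S|lebesgue. m x) = 1"
  proof -
    have "(LINT x:S|lebesgue. m x) = (LINT x:S|lebesgue. (1/2) * (R1 x + R2 x))"
      by (simp add: m_def)
    also have "\<dots> = (1/2) * ((LINT x:S|lebesgue. R1 x) + (LINT x:S|lebesgue. R2 x))"
      by (subst set_integral_mult_right, subst set_integral_add(2)) (use int cR in auto)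
    finally show ?thesis using int1 by simp
  qed
  \<comment> \<open>Hoelder's inequality with exponents \<open>p / (p - 1)\<close> and \<open>p\<close>, from the weighted inequality of the
    means applied to functions normalized to integral 1.\<close>
  have hoelder: "(LINT x:S|lebesgue. m x powr (1 - 1 / p) * (\<phi> x)\<^sup>2) \<le> I powr (1 / p)"
  proof (cases "I = 0")
    case True
    have "\<phi> x = 0" if "x \<in> S" for x
      using continuous_integral_eq_0D[OF S(1) continuous_on_subset[OF ct closure_subset] _ int[OF ct] _ that]
        True unfolding I_def by simp
    hence "(LINT x:S|lebesgue. m x powr (1 - 1 / p) * (\<phi> x)\<^sup>2) = (LINT x:S|lebesgue. 0)"
      by (intro set_lebesgue_integral_cong) (use S in auto)
    thus ?thesis by (simp add: set_lebesgue_integral_def)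
  next
    case False
    with I0 have I: "0 < I" by simp
    define J where "J = I powr (1 / p)"
    have J: "0 < J" using I by (simp add: J_def)
    have pw: "m x powr (1 - 1 / p) * (\<phi> x)\<^sup>2 \<le> J * ((1 - 1 / p) * m x + 1 / p * (\<bar>\<phi> x\<bar> powr (2 * p) / I))" for x
    proof (cases "\<phi> x = 0")
      case True
      thus ?thesis using J m[of x] p by simp
    next
      case False
      have e: "(\<bar>\<phi> x\<bar> powr (2 * p) / I) powr (1 / p) = (\<phi> x)\<^sup>2 / J"
        using p False I by (simp add: powr_divide powr_powr J_def)
      have "m x powr (1 - 1 / p) * (\<bar>\<phi> x\<bar> powr (2 * p) / I) powr (1 / p)
          \<le> (1 - 1 / p) * m x + 1 / p * (\<bar>\<phi> x\<bar> powr (2 * p) / I)"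
        by (rule Youngs_inequality_0) (use p m[of x] False I in auto)
      hence "m x powr (1 - 1 / p) * ((\<phi> x)\<^sup>2 / J) \<le> (1 - 1 / p) * m x + 1 / p * (\<bar>\<phi> x\<bar> powr (2 * p) / I)"
        unfolding e .
      from mult_left_mono[OF this less_imp_le[OF J]] show ?thesis using J by simp
    qed
    have "(LINT x:S|lebesgue. m x powr (1 - 1 / p) * (\<phi> x)\<^sup>2)
        \<le> (LINT x:S|lebesgue. J * (1 - 1 / p) * m x + J / (p * I) * \<bar>\<phi> x\<bar> powr (2 * p))"
    proof (rule set_integral_mono)
      show "m x powr (1 - 1 / p) * (\<phi> x)\<^sup>2 \<le> J * (1 - 1 / p) * m x + J / (p * I) * \<bar>\<phi> x\<bar> powr (2 * p)" for x
        using pw[of x] by (simp add: distrib_left mult.assoc)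
    qed (intro int continuous_on_add continuous_on_mult continuous_on_const continuous_on_power cmp cf cm ct)+
    also have "\<dots> = J * (1 - 1 / p) * (LINT x:S|lebesgue. m x) + J / (p * I) * I"
      unfolding I_def by (subst set_integral_add(2)) (intro int continuous_on_add continuous_on_mult continuous_on_diff continuous_on_const continuous_on_power cm ct | simp)+
    also have "\<dots> = J" using I p intm by (simp add: field_simps)
    finally show ?thesis by (simp add: J_def)
  qed
  \<comment> \<open>The weight \<open>k\<close> in the inequality of the means is the one that occurs in \<open>powr_diff_gt_midpoint\<close>.\<close>
  have "2 * Q \<le> G / L' + L' * (LINT x:S|lebesgue. m x powr (1 - 1 / p) * (\<phi> x)\<^sup>2)"
  proof -
    have pw: "2 * (g x * \<phi> x) \<le> 1 / L' * ((g x)\<^sup>2 * k x) + L' * (m x powr (1 - 1 / p) * (\<phi> x)\<^sup>2)" for x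
    proof -
      have ik: "m x powr (1 - 1 / p) = 1 / k x"
        using m[of x] by (simp add: k_def powr_diff)
      have "0 \<le> (g x * k x - L' * \<phi> x)\<^sup>2 / (L' * k x)" using k[of x] L0 by simp
      also have "\<dots> = 1 / L' * ((g x)\<^sup>2 * k x) + L' * (1 / k x * (\<phi> x)\<^sup>2) - 2 * (g x * \<phi> x)"
        using k[of x] L0 by (simp add: field_simps power2_eq_square)
      finally show ?thesis unfolding ik by simp
    qed
    have "2 * Q = (LINT x:S|lebesgue. 2 * (g x * \<phi> x))" unfolding Q_def by simp
    also have "\<dots> \<le> (LINT x:S|lebesgue. 1 / L' * ((g x)\<^sup>2 * k x) + L' * (m x powr (1 - 1 / p) * (\<phi> x)\<^sup>2))"
      by (rule set_integral_mono[OF _ _ pw]) (intro int continuous_on_add continuous_on_mult continuous_on_diff continuous_on_const continuous_on_power cmp cf cg ck | simp)+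
    also have "\<dots> = 1 / L' * G + L' * (LINT x:S|lebesgue. m x powr (1 - 1 / p) * (\<phi> x)\<^sup>2)"
      unfolding G_def by (subst set_integral_add(2)) (intro int continuous_on_add continuous_on_mult continuous_on_diff continuous_on_const continuous_on_power cmp cf cg ck | simp)+
    finally show ?thesis by simp
  qed
  also have "\<dots> \<le> G / L' + Q"
    using mult_left_mono[OF hoelder less_imp_le[OF L0]] sob by linarith
  finally have GQ: "L' * Q \<le> G" using L0 by (simp add: field_simps)
  define h where "h x = g x * (v1 x - v2 x) - 1 / p * ((g x)\<^sup>2 * k x)" for x
  have ch: "continuous_on (closure S) h" unfolding h_def by (intro continuous_intros cg cv ck)
  have hpos: "0 < h x" if gx: "g x \<noteq> 0" for x
  proof -
    have rv: "R1 x powr (1 / p) = v1 x" "R2 x powr (1 / p) = v2 x"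
      using v1[of x] v2[of x] p by (simp_all add: R1_def R2_def powr_powr)
    have p': "0 < 1 / p" "1 / p < 1" using p by auto
    consider "R2 x < R1 x" | "R1 x < R2 x" using gx unfolding g_def by linarith
    thus ?thesis
    proof cases
      case 1
      have "1 / p * (R1 x - R2 x) * k x < v1 x - v2 x"
        using powr_diff_gt_midpoint[OF R2 1 p'] unfolding rv k_def m_def .
      hence *: "1 / p * g x * k x < v1 x - v2 x" by (simp add: g_def)
      have "0 < g x" using 1 by (simp add: g_def)
      from mult_strict_left_mono[OF * this] show ?thesis
        by (simp add: h_def power2_eq_square mult.assoc)
    next
      case 2
      have "1 / p * (R2 x - R1 x) * k x < v2 x - v1 x"
        using powr_diff_gt_midpoint[OF R1 2 p'] unfolding rv k_def m_def by (simp add: add.commute)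
      moreover have "R2 x - R1 x = - g x" by (simp add: g_def)
      ultimately have *: "v1 x - v2 x < 1 / p * g x * k x" by simp
      have "g x < 0" using 2 by (simp add: g_def)
      from mult_strict_left_mono_neg[OF * this] show ?thesis
        by (simp add: h_def power2_eq_square mult.assoc)
    qed
  qed
  have h0: "0 \<le> h x" for x using hpos[of x] by (cases "g x = 0") (auto simp: h_def)
  have "(LINT x:S|lebesgue. g x * (v1 x - v2 x)) = l * Q"
  proof -
    have "(LINT x:S|lebesgue. g x * (v1 x - v2 x)) = (LINT x:S|lebesgue. (a1 - a2) * g x + l * (g x * \<phi> x))"
      by (simp add: v1_def v2_def \<phi>_def algebra_simps)
    also have "\<dots> = (a1 - a2) * (LINT x:S|lebesgue. g x) + l * Q"
      unfolding Q_def by (subst set_integral_add(2)) (intro int continuous_on_add continuous_on_mult continuous_on_diff continuous_on_const continuous_on_power cg cf | simp)+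
    finally show ?thesis using intg by simp
  qed
  hence "(LINT x:S|lebesgue. h x) = l * Q - 1 / p * G"
    unfolding h_def G_def by (subst set_integral_diff(2)) (intro int continuous_on_add continuous_on_mult continuous_on_diff continuous_on_const continuous_on_power cg cv ck | simp)+
  moreover have "l * Q \<le> 1 / p * G"
  proof -
    have "p * (l * Q) = (l * p) * Q" by simp
    also have "\<dots> \<le> L' * Q" by (rule mult_right_mono[OF lL Q0])
    also note GQ
    finally show ?thesis using p by (simp add: field_simps)
  qed
  ultimately have "(LINT x:S|lebesgue. h x) \<le> 0" by simp
  hence "h x = 0" if "x \<in> S" for x
    using continuous_integral_eq_0D[OF S(1) continuous_on_subset[OF ch closure_subset] h0 int[OF ch] _ that] by blast
  hence g0: "g x = 0" if "x \<in> S" for x using hpos[of x] that by fastforce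
  have vv: "v1 x = v2 x" if "x \<in> S" for x
    using g0[OF that] v1[of x] v2[of x] p powr_less_mono2[of p "v1 x" "v2 x"] powr_less_mono2[of p "v2 x" "v1 x"]
    by (simp add: g_def R1_def R2_def) (metis less_irrefl less_linear less_imp_le)
  have "Q = (LINT x:S|lebesgue. 0)" unfolding Q_def by (rule set_lebesgue_integral_cong) (use S g0 in auto)
  hence "\<phi> x = 0" for x
    using C2r0_eq_0_if_integral_le_0[OF S \<phi>, of "2 * p"] L p unfolding Q_lap
    by (simp add: set_lebesgue_integral_def)
  hence ff: "f1 = f2" by (auto simp: \<phi>_def fun_eq_iff)
  obtain x where "x \<in> S" using False by blast
  with vv[of x] ff show ?thesis by (simp add: v1_def v2_def)
qed


section \<open>Passage between the two boundary value problems\<close>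

lemma pd_pd_nonneg_at_local_min:
  assumes S: "open S" and f: "f \<in> C2r0 S r" and x: "x \<in> S" and min: "\<And>y. y \<in> S \<Longrightarrow> f x \<le> f y"
  shows "0 \<le> pd i (pd i f) x"
proof (rule ccontr)
  assume neg: "\<not> 0 \<le> pd i (pd i f) x"
  let ?y = "\<lambda>t. x + t *\<^sub>R axis i (1::real)"
  obtain e where e: "0 < e" "ball x e \<subseteq> S" using S x openE by blast
  have yS: "?y t \<in> S" if "\<bar>t\<bar> < e" for t
  proof -
    have "dist x (?y t) < e" using that by (simp add: dist_norm norm_axis_1)
    thus ?thesis using e by (auto simp: mem_ball)
  qed
  have d1: "((\<lambda>t. f (?y t)) has_real_derivative pd i f (?y t)) (at t)" if "\<bar>t\<bar> < e" for t
    by (rule DERIV_along_axis[OF C2r0_D(3)[OF f] S yS[OF that]])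
  have d2: "((\<lambda>t. pd i f (?y t)) has_real_derivative pd i (pd i f) (?y 0)) (at 0)"
    by (rule DERIV_along_axis[OF C2r0_D(4)[OF f] S yS]) (use e in simp)
  have z: "pd i f (?y 0) = 0"
    by (rule DERIV_local_min[OF d1 e(1)]) (use e min yS in auto)
  obtain d where d: "0 < d" "\<And>h. 0 < h \<Longrightarrow> h < d \<Longrightarrow> pd i f (?y (0 + h)) < pd i f (?y 0)"
    using DERIV_neg_dec_right[OF d2] neg by auto
  define h where "h = min d e / 2"
  have h: "0 < h" "h < d" "h < e" using d(1) e(1) by (auto simp: h_def)
  obtain c where c: "0 < c" "c < h" "f (?y h) - f (?y 0) = (h - 0) * pd i f (?y c)"
    using MVT2[OF h(1), of "\<lambda>t. f (?y t)" "\<lambda>t. pd i f (?y t)"] d1 h by auto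
  have "pd i f (?y c) < 0" using d(2)[of c] c h z by simp
  hence "h * pd i f (?y c) < 0" using h(1) by (simp add: mult_less_0_iff)
  hence "f (?y h) < f x" using c(3) by simp
  moreover have "f x \<le> f (?y h)" using h by (intro min yS) auto
  ultimately show False by simp
qed

lemma laplacian_nonneg_at_local_min:
  assumes "open S" "f \<in> C2r0 S r" "x \<in> S" "\<And>y. y \<in> S \<Longrightarrow> f x \<le> f y"
  shows "0 \<le> laplacian f x"
  unfolding laplacian_def by (intro sum_nonneg pd_pd_nonneg_at_local_min[OF assms])

text \<open>A zero of \<open>u\<close> in \<open>S\<close> would be a minimum, where the Laplacian is nonnegative, while it equals \<open>- m\<close> there.\<close>

lemma rabinowitz_solution_pos:
  assumes S: "open S" and R: "(m, u) \<in> rabinowitz_solutions S r p" and m: "0 < m" and x: "x \<in> S"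
  shows "0 < u x"
proof (rule ccontr)
  assume "\<not> 0 < u x"
  moreover have u: "u \<in> C2r0 S r" "\<And>x. x \<in> S \<Longrightarrow> 0 \<le> u x"
    and eq: "- laplacian u x = m * (1 + u x) powr p" using R x by (auto simp: rabinowitz_solutions_def)
  ultimately have "u x \<le> u y" if "y \<in> S" for y using that x by fastforce
  from laplacian_nonneg_at_local_min[OF S u(1) x this] have "m * (1 + u x) powr p \<le> 0" using eq by simp
  moreover have "0 < m * (1 + u x) powr p" using m u(2)[OF x] by simp
  ultimately show False by simp
qed

lemma rabinowitz_solution_0:
  fixes S :: "(real^'n::finite) set"
  assumes S: "open S" "bounded S" and t: "0 < t" "0 < sobolev_const S t"
    and R: "(0, u) \<in> rabinowitz_solutions S r p"
  shows "u = (\<lambda>_. 0)"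
proof
  fix x
  have u: "u \<in> C2r0 S r" and "\<And>x. x \<in> S \<Longrightarrow> laplacian u x = 0"
    using R by (auto simp: rabinowitz_solutions_def)
  hence "(LINT x:S|lebesgue. - laplacian u x * u x) = (LINT x:S|lebesgue. 0)"
    by (intro set_lebesgue_integral_cong) (use S in auto)
  also have "\<dots> = 0" by (simp add: set_lebesgue_integral_def)
  finally show "u x = 0" by (intro C2r0_eq_0_if_integral_le_0[OF S u t]) simp
qed

text \<open>The value of \<open>a\<close> in the constrained problem expressed by \<open>u = (l/a) f\<close>: since \<open>a + l f = a (1 + u)\<close>, the
  constraint reads \<open>a\<^sup>p \<integral>(1 + u)\<^sup>p = 1\<close>.\<close>

definition recovered_alpha :: "(real^'n::finite) set \<Rightarrow> real \<Rightarrow> (real^'n \<Rightarrow> real) \<Rightarrow> real"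
  where "recovered_alpha S p u = (LINT x:S|lebesgue. (1 + u x) powr p) powr (- 1 / p)"

lemma C2r0_nonneg: "f \<in> C2r0 S r \<Longrightarrow> (\<And>x. x \<in> S \<Longrightarrow> 0 \<le> f x) \<Longrightarrow> 0 \<le> f x"
  using C2r0_D(8)[of f S r x] by (cases "x \<in> S") auto

lemma set_integral_const_lebesgue: "bounded S \<Longrightarrow> open S \<Longrightarrow> (LINT x:S|lebesgue. (c::real)) = c * measure lebesgue (S :: (real^'n::finite) set)"
  by (simp add: set_lebesgue_integral_def)

lemma integral_one_plus_powr_ge_1:
  fixes S :: "(real^'n::finite) set"
  assumes S: "open S" "bounded S" "measure lebesgue S = 1" and p: "1 < p"
    and u: "u \<in> C2r0 S r" "\<And>x. x \<in> S \<Longrightarrow> 0 \<le> u x"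
  shows "1 \<le> (LINT x:S|lebesgue. (1 + u x) powr p)"
    "set_integrable lebesgue S (\<lambda>x. (1 + u x) powr p)"
proof -
  have u0: "0 \<le> u x" for x by (rule C2r0_nonneg[OF u])
  have c: "continuous_on (closure S) (\<lambda>x. (1 + u x) powr p)"
    by (intro continuous_on_powr continuous_intros C2r0_D(1)[OF u(1)]) (use u0 in \<open>smt (verit)\<close>)
  show i: "set_integrable lebesgue S (\<lambda>x. (1 + u x) powr p)"
    by (rule set_integrable_continuous_on_closure[OF S(1,2) c])
  have "(LINT x:S|lebesgue. 1) \<le> (LINT x:S|lebesgue. (1 + u x) powr p)"
    by (rule set_integral_mono[OF _ i])
      (use u0 p in \<open>auto intro!: set_integrable_continuous_on_closure[OF S(1,2)] ge_one_powr_ge_zero\<close>)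
  thus "1 \<le> (LINT x:S|lebesgue. (1 + u x) powr p)" using S set_integral_const_lebesgue[of S 1] by simp
qed

lemma recovered_alpha_pos:
  fixes S :: "(real^'n::finite) set"
  assumes S: "open S" "bounded S" "measure lebesgue S = 1" and p: "1 < p"
    and u: "u \<in> C2r0 S r" "\<And>x. x \<in> S \<Longrightarrow> 0 \<le> u x"
  shows "0 < recovered_alpha S p u" 
    "recovered_alpha S p u powr p * (LINT x:S|lebesgue. (1 + u x) powr p) = 1"
proof -
  have aux: "0 < I powr (- 1 / p)" "(I powr (- 1 / p)) powr p * I = 1" if "1 \<le> I" for I :: real
  proof -
    have "- 1 / p * p = - 1" using p by simp
    thus "(I powr (- 1 / p)) powr p * I = 1" using that
      by (simp only: powr_powr) (simp add: powr_minus_divide)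
  qed (use that in simp)
  have "1 \<le> (LINT x:S|lebesgue. (1 + u x) powr p)" by (rule integral_one_plus_powr_ge_1[OF assms])
  from aux[OF this] show "0 < recovered_alpha S p u" "recovered_alpha S p u powr p * (LINT x:S|lebesgue. (1 + u x) powr p) = 1"
    unfolding recovered_alpha_def .
qed

lemma solves_P_imp_rabinowitz_solution:
  fixes S :: "(real^'n::finite) set"
  assumes S: "open S" and p: "1 < p" and s: "solves_P S r p l a f" "0 < a"
  shows "(l * a powr (p - 1), \<lambda>x. l / a * f x) \<in> rabinowitz_solutions S r p"
proof -
  note f = s(1)[unfolded solves_P_def]
  have fm: "f \<in> C2r0 S r" and l: "0 \<le> l" using f by auto
  have u: "(\<lambda>x. l / a * f x) \<in> C2r0 S r"
    using C2r0_lincomb[OF S fm fm, of "l / a" 0] by simp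
  have "- laplacian (\<lambda>x. l / a * f x) x = l * a powr (p - 1) * (1 + l / a * f x) powr p" if x: "x \<in> S" for x
  proof -
    have eq: "- laplacian f x = (a + l * f x) powr p" using f x by auto
    have "- laplacian (\<lambda>x. l / a * f x) x = l / a * (a + l * f x) powr p"
      unfolding eq[symmetric] using laplacian_lincomb[OF S fm fm x, of "l / a" 0] by simp
    also have "(a + l * f x) powr p = (a * (1 + l / a * f x)) powr p" using s(2) by (simp add: distrib_left)
    also have "\<dots> = a powr p * (1 + l / a * f x) powr p"
      by (rule powr_mult)
    also have "l / a * (a powr p * (1 + l / a * f x) powr p) = l * (a powr p / a) * (1 + l / a * f x) powr p"
      by simp
    also have "a powr p / a = a powr (p - 1)" using s(2) by (simp add: powr_diff)
    finally show ?thesis .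
  qed
  thus ?thesis using u l s(2) f by (auto simp: rabinowitz_solutions_def less_imp_le)
qed

lemma recovered_alpha_solves_P:
  fixes S :: "(real^'n::finite) set"
  assumes S: "open S" "bounded S" and p: "1 < p" and s: "solves_P S r p l a f" "0 < a"
  shows "recovered_alpha S p (\<lambda>x. l / a * f x) = a"
proof -
  note f = s(1)[unfolded solves_P_def]
  have "(1 + l / a * f x) powr p = a powr (- p) * (a + l * f x) powr p" if x: "x \<in> S" for x
  proof -
    have "(a + l * f x) powr p = (a * (1 + l / a * f x)) powr p" using s(2) by (simp add: distrib_left)
    also have "\<dots> = a powr p * (1 + l / a * f x) powr p"
      by (rule powr_mult)
    finally show ?thesis using s(2) by (simp add: powr_minus)
  qed
  hence "(LINT x:S|lebesgue. (1 + l / a * f x) powr p) = (LINT x:S|lebesgue. a powr (- p) * (a + l * f x) powr p)"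
    by (intro set_lebesgue_integral_cong) (use S in auto)
  also have "\<dots> = a powr (- p)" using f by simp
  finally show ?thesis using p s(2) by (simp add: recovered_alpha_def powr_powr)
qed

lemma rabinowitz_solution_imp_solves_P:
  fixes S :: "(real^'n::finite) set"
  assumes S: "open S" "bounded S" "measure lebesgue S = 1" and p: "1 < p"
    and R: "(m, u) \<in> rabinowitz_solutions S r p" and m: "0 < m"
  defines "a \<equiv> recovered_alpha S p u"
  defines "l \<equiv> m * a powr (1 - p)" and "c \<equiv> a powr p / m"
  shows "solves_P S r p l a (\<lambda>x. c * u x)" "l * a powr (p - 1) = m" "l / a * c = 1"
proof -
  have u: "u \<in> C2r0 S r" "\<And>x. x \<in> S \<Longrightarrow> 0 \<le> u x" and eq: "\<And>x. x \<in> S \<Longrightarrow> - laplacian u x = m * (1 + u x) powr p"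
    using R by (auto simp: rabinowitz_solutions_def)
  have a: "0 < a" "a powr p * (LINT x:S|lebesgue. (1 + u x) powr p) = 1"
    unfolding a_def by (rule recovered_alpha_pos[OF S p u]; simp)+
  show la: "l * a powr (p - 1) = m" using a m by (simp add: l_def flip: powr_add)
  show lc: "l / a * c = 1"
    using a m by (simp add: l_def c_def powr_diff)
  have l: "0 < l" using a m by (simp add: l_def)
  have e: "a + l * (c * u x) = a * (1 + u x)" for x
  proof -
    have "l * c = a" using lc a by (simp add: field_simps)
    thus ?thesis by (simp add: algebra_simps flip: mult.assoc)
  qed
  have ep: "(a + l * (c * u x)) powr p = a powr p * (1 + u x) powr p" if "x \<in> S" for x
    unfolding e by (rule powr_mult)
  have "(LINT x:S|lebesgue. (a + l * (c * u x)) powr p) = (LINT x:S|lebesgue. a powr p * (1 + u x) powr p)"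
    by (intro set_lebesgue_integral_cong) (use S ep in auto)
  also have "\<dots> = 1" using a by simp
  finally have I: "(LINT x:S|lebesgue. (a + l * (c * u x)) powr p) = 1" .
  have "- laplacian (\<lambda>x. c * u x) x = (a + l * (c * u x)) powr p" if x: "x \<in> S" for x
  proof -
    have "- laplacian (\<lambda>x. c * u x) x = c * - laplacian u x"
      using laplacian_lincomb[OF S(1) u(1) u(1) x, of c 0] by simp
    also have "\<dots> = a powr p * (1 + u x) powr p" unfolding eq[OF x] using m by (simp add: c_def)
    finally show ?thesis unfolding ep[OF x] .
  qed
  moreover have "(\<lambda>x. c * u x) \<in> C2r0 S r" using C2r0_lincomb[OF S(1) u(1) u(1), of c 0] by simp
  moreover have "0 < c * u x" if "x \<in> S" for x
    using rabinowitz_solution_pos[OF S(1) R m that] a m by (simp add: c_def)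
  ultimately show "solves_P S r p l a (\<lambda>x. c * u x)"
    using I l a by (simp add: solves_P_def)
qed

lemma solves_P_nonneg:
  assumes "solves_P S r p l a f" shows "0 \<le> f x"
proof (rule C2r0_nonneg)
  show "f \<in> C2r0 S r" using assms by (simp add: solves_P_def)
  show "0 \<le> f y" if "y \<in> S" for y using assms that by (simp add: solves_P_def less_imp_le)
qed

lemma continuous_on_solves_P_rhs:
  assumes s: "solves_P S r p l a f" "0 < a"
  shows "continuous_on (closure S) (\<lambda>x. (a + l * f x) powr p)"
proof (rule continuous_on_powr)
  show "continuous_on (closure S) (\<lambda>x. a + l * f x)"
    using s by (intro continuous_intros C2r0_D(1)[of f S r]) (simp add: solves_P_def)
  have "0 \<le> l * f x" for x
    using s(1) solves_P_nonneg[OF s(1)] by (simp add: solves_P_def)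
  thus "\<forall>x\<in>closure S. a + l * f x \<noteq> 0" using s(2) by (metis add_pos_nonneg less_irrefl)
qed (rule continuous_on_const)

lemma solves_P_alpha_le_1:
  fixes S :: "(real^'n::finite) set"
  assumes S: "open S" "bounded S" "measure lebesgue S = 1" and p: "1 < p"
    and s: "solves_P S r p l a f" "0 < a"
  shows "a \<le> 1"
proof -
  note f = s(1)[unfolded solves_P_def]
  note f0 = solves_P_nonneg[OF s(1)]
  note c = continuous_on_solves_P_rhs[OF s]
  have "(LINT x:S|lebesgue. a powr p) \<le> (LINT x:S|lebesgue. (a + l * f x) powr p)"
    by (rule set_integral_mono)
      (use f f0 s(2) p c in \<open>auto intro!: set_integrable_continuous_on_closure[OF S(1,2)] powr_mono2\<close>)
  hence "a powr p \<le> 1" using f S set_integral_const_lebesgue[of S "a powr p"] by simp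
  thus ?thesis using gr_one_powr[of a p] p by linarith
qed

text \<open>As \<open>S\<close> has measure 1, the integral 1 of \<open>(a (1 + u))\<^sup>p\<close>, where \<open>u = (l/a) f\<close>, is at most
  \<open>(a (1 + sup u))\<^sup>p\<close>.\<close>

lemma solves_P_inverse_alpha_le:
  fixes S :: "(real^'n::finite) set"
  assumes S: "open S" "bounded S" "measure lebesgue S = 1" and p: "1 < p"
    and s: "solves_P S r p l a f" "0 < a" and B: "\<And>x. x \<in> S \<Longrightarrow> l / a * f x \<le> B"
  shows "1 / a \<le> 1 + B"
proof -
  note f = s(1)[unfolded solves_P_def]
  have S0: "S \<noteq> {}" using S(3) by auto
  note f0 = solves_P_nonneg[OF s(1)]
  have B0: "0 \<le> B" using S0 B f0 f s(2) by (meson divide_nonneg_pos ex_in_conv mult_nonneg_nonneg order_trans)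
  note c = continuous_on_solves_P_rhs[OF s]
  have "(LINT x:S|lebesgue. (a + l * f x) powr p) \<le> (LINT x:S|lebesgue. (a * (1 + B)) powr p)"
  proof (rule set_integral_mono)
    fix x assume x: "x \<in> S"
    have "a + l * f x = a * (1 + l / a * f x)" using s(2) by (simp add: distrib_left)
    also have "\<dots> \<le> a * (1 + B)" using B[OF x] s(2) by (intro mult_left_mono) auto
    finally show "(a + l * f x) powr p \<le> (a * (1 + B)) powr p"
      using f f0 s(2) p by (intro powr_mono2) auto
  qed (auto intro!: set_integrable_continuous_on_closure[OF S(1,2)] c)
  hence "1 \<le> (a * (1 + B)) powr p" using f S set_integral_const_lebesgue[of S "(a * (1 + B)) powr p"] by simp
  hence "1 \<le> a * (1 + B)" using p s(2) B0 powr_less_mono2[of p "a * (1 + B)" 1]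
    by (smt (verit) mult_nonneg_nonneg powr_one_eq_one)
  thus ?thesis using s(2) by (simp add: field_simps)
qed


section \<open>Convergence in the function spaces\<close>

text \<open>Stated for any function \<open>N\<close> with the properties of a seminorm on \<open>C\<close>, to be applied to both
  \<open>C2_norm\<close> and \<open>C2r_norm\<close>.\<close>

lemma scaled_tendsto:
  fixes N :: "('a \<Rightarrow> real) \<Rightarrow> real" and f :: "'t \<Rightarrow> 'a \<Rightarrow> real"
  assumes lin: "\<And>f g a b. f \<in> C \<Longrightarrow> g \<in> C \<Longrightarrow> (\<lambda>x. a * f x + b * g x) \<in> C"
    and N: "\<And>f g a b. f \<in> C \<Longrightarrow> g \<in> C \<Longrightarrow> N (\<lambda>x. a * f x + b * g x) \<le> \<bar>a\<bar> * N f + \<bar>b\<bar> * N g"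
    and pos: "\<And>f. f \<in> C \<Longrightarrow> 0 \<le> N f"
    and c: "(c \<longlongrightarrow> c0) F" and f: "((\<lambda>t. N (\<lambda>x. f t x - f0 x)) \<longlongrightarrow> 0) F"
    and C: "eventually (\<lambda>t. f t \<in> C) F" "f0 \<in> C"
  shows "((\<lambda>t. N (\<lambda>x. c t * f t x - c0 * f0 x)) \<longlongrightarrow> 0) F"
proof (rule tendsto_sandwich)
  show "eventually (\<lambda>t. 0 \<le> N (\<lambda>x. c t * f t x - c0 * f0 x)) F"
    using C(1)
  proof eventually_elim
    case (elim t)
    show ?case using pos[OF lin[OF elim C(2), of "c t" "- c0"]] by simp
  qed
  show "eventually (\<lambda>t. N (\<lambda>x. c t * f t x - c0 * f0 x)
      \<le> \<bar>c t\<bar> * N (\<lambda>x. f t x - f0 x) + \<bar>c t - c0\<bar> * N f0) F"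
    using C(1)
  proof eventually_elim
    case (elim t)
    have d: "(\<lambda>x. f t x - f0 x) \<in> C" using lin[OF elim C(2), of 1 "- 1"] by simp
    have "(\<lambda>x. c t * f t x - c0 * f0 x) = (\<lambda>x. c t * (f t x - f0 x) + (c t - c0) * f0 x)"
      by (auto simp: algebra_simps)
    thus ?case using N[OF d C(2), of "c t" "c t - c0"] by simp
  qed
  have "((\<lambda>t. \<bar>c t\<bar> * N (\<lambda>x. f t x - f0 x) + \<bar>c t - c0\<bar> * N f0) \<longlongrightarrow> \<bar>c0\<bar> * 0 + \<bar>c0 - c0\<bar> * N f0) F"
    by (intro tendsto_intros c f)
  thus "((\<lambda>t. \<bar>c t\<bar> * N (\<lambda>x. f t x - f0 x) + \<bar>c t - c0\<bar> * N f0) \<longlongrightarrow> 0) F" by simp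
qed simp

lemma C2_norm_nonneg:
  assumes S: "S \<noteq> {}" "bounded S" and f: "f \<in> C2r0 S r"
  shows "0 \<le> C2_norm S f"
  unfolding C2_norm_def
  by (intro add_nonneg_nonneg sum_nonneg sup_norm_pos S(1) C2r0_bdd[OF S(2) f])

lemma C2r_norm_scaled_tendsto:
  assumes S: "open S" "S \<noteq> {}" "bounded S"
    and "(c \<longlongrightarrow> c0) F" "((\<lambda>t. C2r_norm S r (\<lambda>x. f t x - f0 x)) \<longlongrightarrow> 0) F"
    "eventually (\<lambda>t. f t \<in> C2r0 S r) F" "f0 \<in> C2r0 S r"
  shows "((\<lambda>t. C2r_norm S r (\<lambda>x. c t * f t x - c0 * f0 x)) \<longlongrightarrow> 0) F"
  by (rule scaled_tendsto[where C="C2r0 S r"])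
    (use assms C2r0_lincomb[OF S(1)] C2r_norm_lincomb_le[OF S] C2r_norm_ge_sup(2)[OF S] in auto)

lemma C2_norm_scaled_tendsto:
  assumes S: "open S" "S \<noteq> {}" "bounded S"
    and "(c \<longlongrightarrow> c0) F" "((\<lambda>t. C2_norm S (\<lambda>x. f t x - f0 x)) \<longlongrightarrow> 0) F"
    "eventually (\<lambda>t. f t \<in> C2r0 S r) F" "f0 \<in> C2r0 S r"
  shows "((\<lambda>t. C2_norm S (\<lambda>x. c t * f t x - c0 * f0 x)) \<longlongrightarrow> 0) F"
  by (rule scaled_tendsto[where C="C2r0 S r"])
    (use assms C2r0_lincomb[OF S(1)] C2_norm_lincomb_le[OF S] C2_norm_nonneg[OF S(2,3)] in auto)

lemma abs_diff_le_C2r_norm: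
  assumes S: "open S" "S \<noteq> {}" "bounded S" and f: "f \<in> C2r0 S r" and g: "g \<in> C2r0 S r" and x: "x \<in> S"
  shows "\<bar>f x - g x\<bar> \<le> C2r_norm S r (\<lambda>x. f x - g x)"
proof -
  have d: "(\<lambda>x. f x - g x) \<in> C2r0 S r" by (rule C2r0_diff[OF S(1) f g])
  show ?thesis using sup_norm_ge[OF C2r0_bdd(1)[OF S(3) d] x] C2r_norm_ge_sup(1)[OF S d] by simp
qed

lemma atin_within_euclidean: "atin_within euclidean a D = at a within D"
  by (auto simp: filter_eq_iff eventually_atin_within eventually_at_topological)

lemma continuous_map_C2r0_iff:
  fixes S :: "(real^'n::finite) set" and D :: "real set"
  assumes S: "open S" "S \<noteq> {}" "bounded S"
  shows "continuous_map (top_of_set D) (C2r0_topology S r) F \<longleftrightarrow> (\<forall>s\<in>D. F s \<in> C2r0 S r) \<and>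
    (\<forall>s\<in>D. ((\<lambda>t. C2r_norm S r (\<lambda>x. F t x - F s x)) \<longlongrightarrow> 0) (at s within D))"
proof -
  interpret Metric_space "C2r0 S r" "C2r_dist S r" by (rule Metric_space_C2r0[OF S])
  have 1: "continuous_map (top_of_set D) (C2r0_topology S r) F \<longleftrightarrow>
    (\<forall>s\<in>D. F s \<in> C2r0 S r \<and> eventually (\<lambda>t. F t \<in> C2r0 S r) (at s within D) \<and>
        ((\<lambda>t. C2r_dist S r (F t) (F s)) \<longlongrightarrow> 0) (at s within D))"
    unfolding continuous_map_atin C2r0_topology_def limitin_metric_dist_null
    by (simp add: atin_subtopology_within atin_within_euclidean)
  have ev: "eventually (\<lambda>t. F t \<in> C2r0 S r) (at s within D)" if "\<forall>s\<in>D. F s \<in> C2r0 S r" for s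
    using that by (auto simp: eventually_at_filter)
  have 2: "((\<lambda>t. C2r_dist S r (F t) (F s)) \<longlongrightarrow> 0) (at s within D) \<longleftrightarrow>
      ((\<lambda>t. C2r_norm S r (\<lambda>x. F t x - F s x)) \<longlongrightarrow> 0) (at s within D)"
    if F: "\<forall>s\<in>D. F s \<in> C2r0 S r" and s: "s \<in> D" for s
    by (rule tendsto_cong) (use ev[OF F, of s] F s in \<open>auto elim!: eventually_mono simp: C2r_dist_def\<close>)
  show ?thesis unfolding 1 using 2 ev by blast
qed

lemma continuous_map_C2r0_sequentially:
  fixes S :: "(real^'n::finite) set" and D :: "real set"
  assumes S: "open S" "S \<noteq> {}" "bounded S" and F: "continuous_map (top_of_set D) (C2r0_topology S r) F"
    and s: "s \<in> D" "\<And>n. \<sigma> n \<in> D" "\<sigma> \<longlonglongrightarrow> s"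
  shows "(\<lambda>n. C2r_norm S r (\<lambda>x. F (\<sigma> n) x - F s x)) \<longlonglongrightarrow> 0"
proof -
  let ?g = "\<lambda>t. C2r_norm S r (\<lambda>x. F t x - F s x)"
  have z: "?g s = 0" using C2r_norm_zero[OF S(1,2)] by simp
  have "(?g \<longlongrightarrow> 0) (at s within D)" using F s(1) unfolding continuous_map_C2r0_iff[OF S] by blast
  hence "continuous (at s within D) ?g" unfolding continuous_within z .
  hence "(?g \<circ> \<sigma>) \<longlonglongrightarrow> ?g s" using s unfolding continuous_within_sequentially by blast
  thus ?thesis unfolding z o_def .
qed

text \<open>The space is metrizable, so relative openness can be tested on sequences. Applied to \<open>R - X\<close>
  in place of \<open>X\<close>, this is also the criterion for closedness.\<close>

lemma openin_if_sequentially_open: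
  fixes S :: "(real^'n::finite) set"
  assumes S: "open S" "S \<noteq> {}" "bounded S" and R: "R \<subseteq> {0..} \<times> C2r0 S r" and X: "X \<subseteq> R"
    and seq: "\<And>(m::real) u \<mu> v. (m, u) \<in> X \<Longrightarrow> (\<And>n::nat. (\<mu> n, v n) \<in> R) \<Longrightarrow> \<mu> \<longlonglongrightarrow> m \<Longrightarrow>
      (\<lambda>n. C2r_norm S r (\<lambda>x. v n x - u x)) \<longlonglongrightarrow> 0 \<Longrightarrow> \<exists>n. (\<mu> n, v n) \<in> X"
  shows "openin (subtopology (prod_topology (top_of_set {0..}) (C2r0_topology S r)) R) X"
proof (subst openin_subopen, clarify)
  fix m :: real and u assume mu: "(m, u) \<in> X"
  interpret Metric_space "C2r0 S r" "C2r_dist S r" by (rule Metric_space_C2r0[OF S])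
  have u: "u \<in> C2r0 S r" and m: "0 \<le> m" using mu X R by auto
  have "\<exists>e>0. \<forall>m' u'. (m', u') \<in> R \<and> \<bar>m' - m\<bar> < e \<and> C2r_norm S r (\<lambda>x. u' x - u x) < e \<longrightarrow> (m', u') \<in> X"
  proof (rule ccontr)
    assume neg: "\<not> ?thesis"
    define Q where "Q n m' u' \<longleftrightarrow> (m', u') \<in> R \<and> \<bar>m' - m\<bar> < inverse (real (Suc n)) \<and>
        C2r_norm S r (\<lambda>x. u' x - u x) < inverse (real (Suc n)) \<and> (m', u') \<notin> X" for n m' u'
    have "\<exists>m' u'. (m', u') \<in> R \<and> \<bar>m' - m\<bar> < inverse (real (Suc n)) \<and>
        C2r_norm S r (\<lambda>x. u' x - u x) < inverse (real (Suc n)) \<and> (m', u') \<notin> X" for n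
    proof (rule ccontr)
      assume "\<not> ?thesis"
      hence "\<forall>m' u'. (m', u') \<in> R \<and> \<bar>m' - m\<bar> < inverse (real (Suc n)) \<and>
          C2r_norm S r (\<lambda>x. u' x - u x) < inverse (real (Suc n)) \<longrightarrow> (m', u') \<in> X" by blast
      moreover have "0 < inverse (real (Suc n))" by simp
      ultimately have "\<exists>e>0. \<forall>m' u'. (m', u') \<in> R \<and> \<bar>m' - m\<bar> < e \<and>
          C2r_norm S r (\<lambda>x. u' x - u x) < e \<longrightarrow> (m', u') \<in> X" by (intro exI conjI)
      thus False using neg by (rule notE[rotated])
    qed
    hence "\<exists>m' u'. Q n m' u'" for n unfolding Q_def .
    then obtain \<mu> v where "\<And>n. Q n (\<mu> n) (v n)" by metis
    hence s: "\<And>n. (\<mu> n, v n) \<in> R" "\<And>n. \<bar>\<mu> n - m\<bar> < inverse (real (Suc n))"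
      "\<And>n. C2r_norm S r (\<lambda>x. v n x - u x) < inverse (real (Suc n))" "\<And>n. (\<mu> n, v n) \<notin> X"
      unfolding Q_def by blast+
    have "(\<lambda>n. \<mu> n - m) \<longlonglongrightarrow> 0"
      by (rule Lim_null_comparison[OF _ LIMSEQ_inverse_real_of_nat]) (use s(2) in \<open>auto intro!: always_eventually less_imp_le\<close>)
    hence "\<mu> \<longlonglongrightarrow> m" by (simp add: LIM_zero_iff)
    moreover have "(\<lambda>n. C2r_norm S r (\<lambda>x. v n x - u x)) \<longlonglongrightarrow> 0"
    proof (rule tendsto_sandwich[OF _ _ tendsto_const LIMSEQ_inverse_real_of_nat])
      have "v n \<in> C2r0 S r" for n using s(1)[of n] R by auto
      thus "eventually (\<lambda>n. 0 \<le> C2r_norm S r (\<lambda>x. v n x - u x)) sequentially"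
        by (intro always_eventually allI C2r_norm_ge_sup(2)[OF S] C2r0_diff[OF S(1)] u)
    qed (use s(3) in \<open>auto intro!: always_eventually less_imp_le\<close>)
    ultimately show False using seq[of m u \<mu> v, OF mu s(1)] s(4) by blast
  qed
  then obtain e where e: "0 < e" "\<And>m' u'. (m', u') \<in> R \<Longrightarrow> \<bar>m' - m\<bar> < e \<Longrightarrow>
      C2r_norm S r (\<lambda>x. u' x - u x) < e \<Longrightarrow> (m', u') \<in> X" by blast
  let ?U = "({0..} \<inter> ball m e) \<times> mball u e"
  have "openin (prod_topology (top_of_set {0..}) (C2r0_topology S r)) ?U"
    unfolding openin_prod_Times_iff C2r0_topology_def by (auto intro: openin_open_Int)
  hence "openin (subtopology (prod_topology (top_of_set {0..}) (C2r0_topology S r)) R) (?U \<inter> R)"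
    by (auto simp: openin_subtopology)
  moreover have "(m, u) \<in> ?U \<inter> R" using u m mu X e(1) by auto
  moreover have "?U \<inter> R \<subseteq> X"
  proof clarify
    fix m' u' assume a: "m' \<in> ball m e" "u' \<in> mball u e" "(m', u') \<in> R"
    have "C2r_dist S r u' u < e" using a(2) commute[of u u'] by simp
    hence "C2r_norm S r (\<lambda>x. u' x - u x) < e" using a(2) u by (simp add: C2r_dist_def)
    moreover have "\<bar>m' - m\<bar> < e" using a(1) by (simp add: dist_real_def abs_minus_commute)
    ultimately show "(m', u') \<in> X" using e(2) a(3) by blast
  qed
  ultimately show "\<exists>T. openin (subtopology (prod_topology (top_of_set {0..}) (C2r0_topology S r)) R) T \<and>
      (m, u) \<in> T \<and> T \<subseteq> X" by blast
qed

lemma recovered_alpha_tendsto: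
  fixes S :: "(real^'n::finite) set"
  assumes S: "open S" "bounded S" "measure lebesgue S = 1" and p: "1 < p"
    and u: "u \<in> C2r0 S r" "\<And>x. x \<in> S \<Longrightarrow> 0 \<le> u x"
    and v: "\<And>n. v n \<in> C2r0 S r" "\<And>n x. x \<in> S \<Longrightarrow> 0 \<le> v n x"
    and lim: "(\<lambda>n. C2r_norm S r (\<lambda>x. v n x - u x)) \<longlonglongrightarrow> 0"
  shows "(\<lambda>n. recovered_alpha S p (v n)) \<longlonglongrightarrow> recovered_alpha S p u"
proof -
  have S0: "S \<noteq> {}" using S(3) by auto
  note dle = abs_diff_le_C2r_norm[OF S(1) S0 S(2) v(1) u(1)]
  obtain B1 where B1: "\<And>x. x \<in> S \<Longrightarrow> \<bar>u x\<bar> \<le> B1" using C2r0_bdd(1)[OF S(2) u(1)] by blast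
  have "Bseq (\<lambda>n. C2r_norm S r (\<lambda>x. v n x - u x))" using lim by (intro convergent_imp_Bseq) (auto simp: convergent_def)
  then obtain B2 where B2: "\<And>n. norm (C2r_norm S r (\<lambda>x. v n x - u x)) \<le> B2" by (auto simp: Bseq_def)
  have vb: "v n x \<le> B1 + B2" if "x \<in> S" for n x
    using dle[OF that, of n] B1[OF that] B2[of n] by (simp add: abs_le_iff)
  have ptw: "(\<lambda>n. v n x) \<longlonglongrightarrow> u x" if x: "x \<in> S" for x
  proof -
    have "(\<lambda>n. v n x - u x) \<longlonglongrightarrow> 0"
      by (rule Lim_null_comparison[OF _ lim]) (use dle[OF x] in auto)
    thus ?thesis by (simp add: LIM_zero_iff)
  qed
  have "(\<lambda>n. LINT x:S|lebesgue. (1 + v n x) powr p) \<longlonglongrightarrow> (LINT x:S|lebesgue. (1 + u x) powr p)"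
    unfolding set_lebesgue_integral_def
  proof (rule integral_dominated_convergence[where w="\<lambda>x. indicat_real S x *\<^sub>R (1 + (B1 + B2)) powr p"])
    show "integrable lebesgue (\<lambda>x. indicat_real S x *\<^sub>R (1 + (B1 + B2)) powr p)"
      using set_integrable_continuous_on_closure[OF S(1,2) continuous_on_const] by (simp only: set_integrable_def)
    show "(\<lambda>x. indicat_real S x *\<^sub>R (1 + u x) powr p) \<in> borel_measurable lebesgue"
      using integral_one_plus_powr_ge_1(2)[OF S p u] by (auto simp only: set_integrable_def intro: borel_measurable_integrable)
    show "(\<lambda>x. indicat_real S x *\<^sub>R (1 + v n x) powr p) \<in> borel_measurable lebesgue" for n
      using integral_one_plus_powr_ge_1(2)[OF S p v(1)[of n] v(2)] by (auto simp only: set_integrable_def intro: borel_measurable_integrable)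
    show "AE x in lebesgue. (\<lambda>n. indicat_real S x *\<^sub>R (1 + v n x) powr p) \<longlonglongrightarrow> indicat_real S x *\<^sub>R (1 + u x) powr p"
    proof (rule AE_I2)
      fix x
      show "(\<lambda>n. indicat_real S x *\<^sub>R (1 + v n x) powr p) \<longlonglongrightarrow> indicat_real S x *\<^sub>R (1 + u x) powr p"
      proof (cases "x \<in> S")
        case True
        have "1 + u x \<noteq> 0" using u(2)[OF True] by simp
        thus ?thesis by (intro tendsto_scaleR tendsto_powr tendsto_add tendsto_const ptw[OF True])
      qed simp
    qed
    show "AE x in lebesgue. norm (indicat_real S x *\<^sub>R (1 + v n x) powr p) \<le> indicat_real S x *\<^sub>R (1 + (B1 + B2)) powr p" for n
      using v(2) vb p by (auto intro!: AE_I2 powr_mono2 simp: indicator_def)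
  qed
  moreover have "(LINT x:S|lebesgue. (1 + u x) powr p) \<noteq> 0" using integral_one_plus_powr_ge_1(1)[OF S p u] by linarith
  ultimately show ?thesis unfolding recovered_alpha_def by (intro tendsto_powr tendsto_const)
qed


section \<open>Analytic curves and the end of the parameter interval\<close>

lemma analytic_real_imp_continuous_on:
  assumes "analytic_real I f" shows "continuous_on I f"
proof (rule continuous_on_eq_continuous_within[THEN iffD2], rule ballI)
  fix t0 assume t0: "t0 \<in> I"
  obtain d c where d: "0 < d" and sm: "summable (\<lambda>k. \<bar>c k\<bar> * d ^ k)"
    and f: "\<And>t. t \<in> I \<Longrightarrow> \<bar>t - t0\<bar> < d \<Longrightarrow> (\<lambda>k. c k * (t - t0) ^ k) sums f t"
    using assms t0 unfolding analytic_real_def by blast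
  define g where "g x = (\<Sum>k. c k * x ^ k)" for x
  have "summable (\<lambda>k. norm (c k * d ^ k))" using sm d by (simp add: abs_mult power_abs)
  hence "summable (\<lambda>k. c k * d ^ k)" by (rule summable_norm_cancel)
  hence "isCont g 0" unfolding g_def[abs_def]
    by (rule isCont_powser) (use d in simp)
  hence "(g \<longlongrightarrow> g 0) (at 0)" by (simp add: isCont_def)
  hence g: "(g \<longlongrightarrow> g 0) (nhds 0)" by (simp add: tendsto_at_iff_tendsto_nhds)
  have "filterlim (\<lambda>t. t - t0) (nhds 0) (at t0 within I)"
    by (auto intro!: tendsto_eq_intros)
  from filterlim_compose[OF g this] have "((\<lambda>t. g (t - t0)) \<longlongrightarrow> g 0) (at t0 within I)" .
  moreover have fg: "f t = g (t - t0)" if "t \<in> I" "\<bar>t - t0\<bar> < d" for t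
    using f[OF that] unfolding g_def by (simp add: sums_iff)
  moreover have "eventually (\<lambda>t. f t = g (t - t0)) (at t0 within I)"
    unfolding eventually_at using d fg by (auto simp: dist_real_def intro!: exI[of _ d])
  ultimately have "(f \<longlongrightarrow> g 0) (at t0 within I)" by (simp add: tendsto_cong)
  moreover have "f t0 = g 0" using fg[OF t0] d by simp
  ultimately show "continuous (at t0 within I) f" by (simp add: continuous_within)
qed

text \<open>The remainders of the power series satisfy a telescoping estimate, which bounds the distance of
  \<open>F t\<close> from \<open>F t0\<close> by \<open>\<bar>t - t0\<bar> / d\<close> times the sum of the majorant.\<close>

lemma analytic_C2r0_imp_continuous_map:
  fixes S :: "(real^'n::finite) set"
  assumes S: "open S" "S \<noteq> {}" "bounded S" and F: "analytic_C2r0 S r I F" "\<And>t. t \<in> I \<Longrightarrow> F t \<in> C2r0 S r"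
  shows "continuous_map (top_of_set I) (C2r0_topology S r) F"
  unfolding continuous_map_C2r0_iff[OF S]
proof (intro conjI ballI F(2))
  fix t0 assume t0: "t0 \<in> I"
  from bspec[OF F(1)[unfolded analytic_C2r0_def] t0]
  obtain d c where d: "0 < d" and "\<forall>k. c k \<in> C2r0 S r"
    and sm: "summable (\<lambda>k. C2r_norm S r (c k) * d ^ k)"
    and "\<forall>t\<in>I. \<bar>t - t0\<bar> < d \<longrightarrow>
      (\<lambda>n. C2r_norm S r (\<lambda>x. F t x - (\<Sum>k<n. (t - t0) ^ k * c k x))) \<longlonglongrightarrow> 0"
    by (elim exE conjE)
  hence c: "\<And>k. c k \<in> C2r0 S r" and lim: "\<And>t. t \<in> I \<Longrightarrow> \<bar>t - t0\<bar> < d \<Longrightarrow>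
      (\<lambda>n. C2r_norm S r (\<lambda>x. F t x - (\<Sum>k<n. (t - t0) ^ k * c k x))) \<longlonglongrightarrow> 0"
    by simp_all
  define N where "N k = C2r_norm S r (c k)" for k
  have N: "0 \<le> N k" for k unfolding N_def by (rule C2r_norm_ge_sup(2)[OF S c])
  define e where "e t n = C2r_norm S r (\<lambda>x. F t x - (\<Sum>k<n. (t - t0) ^ k * c k x))" for t n
  have rem: "(\<lambda>x. F t x - (\<Sum>k<n. (t - t0) ^ k * c k x)) \<in> C2r0 S r" if t: "t \<in> I" for t n
  proof (induction n)
    case 0 show ?case using F(2)[OF t] by simp
  next
    case (Suc n)
    from C2r0_lincomb[OF S(1) Suc c[of n], of 1 "- ((t - t0) ^ n)"] show ?case by (simp add: algebra_simps)
  qed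
  have step: "e t n \<le> e t (Suc n) + \<bar>t - t0\<bar> ^ n * N n" if t: "t \<in> I" for t n
    using C2r_norm_lincomb_le[OF S rem[OF t, of "Suc n"] c[of n], of 1 "(t - t0) ^ n"]
    by (simp add: e_def N_def power_abs algebra_simps)
  have e1: "e t 1 \<le> e t (Suc n) + (\<Sum>k=1..n. \<bar>t - t0\<bar> ^ k * N k)" if t: "t \<in> I" for t n
  proof (induction n)
    case (Suc n) thus ?case using step[OF t, of "Suc n"] by simp
  qed simp
  define M where "M = (\<Sum>k. N k * d ^ k)"
  have e1M: "e t 1 \<le> \<bar>t - t0\<bar> / d * M" if t: "t \<in> I" "\<bar>t - t0\<bar> < d" for t
  proof -
    have b: "(\<Sum>k=1..n. \<bar>t - t0\<bar> ^ k * N k) \<le> \<bar>t - t0\<bar> / d * M" for n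
    proof -
      have "(\<Sum>k=1..n. \<bar>t - t0\<bar> ^ k * N k) \<le> (\<Sum>k=1..n. \<bar>t - t0\<bar> / d * (N k * d ^ k))"
      proof (rule sum_mono)
        fix k assume k: "k \<in> {1..n}"
        then obtain j where j: "k = Suc j" by (cases k) auto
        have "\<bar>t - t0\<bar> ^ j \<le> d ^ j" using t(2) by (intro power_mono) auto
        hence "\<bar>t - t0\<bar> * \<bar>t - t0\<bar> ^ j * N k \<le> \<bar>t - t0\<bar> * d ^ j * N k"
          using N by (intro mult_right_mono mult_left_mono) auto
        thus "\<bar>t - t0\<bar> ^ k * N k \<le> \<bar>t - t0\<bar> / d * (N k * d ^ k)" using d by (simp add: j ac_simps)
      qed
      also have "\<dots> = \<bar>t - t0\<bar> / d * (\<Sum>k=1..n. N k * d ^ k)" by (simp only: sum_distrib_left)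
      also have "(\<Sum>k=1..n. N k * d ^ k) \<le> M" unfolding M_def
        by (rule sum_le_suminf) (use sm N d in \<open>auto simp: N_def\<close>)
      finally show ?thesis using d by (simp add: mult_left_mono divide_right_mono)
    qed
    have le: "e t 1 \<le> e t (Suc n) + \<bar>t - t0\<bar> / d * M" for n using e1[OF t(1), of n] b[of n] by linarith
    have "(\<lambda>n. e t (Suc n) + \<bar>t - t0\<bar> / d * M) \<longlonglongrightarrow> 0 + \<bar>t - t0\<bar> / d * M"
      by (intro tendsto_add tendsto_const LIMSEQ_Suc) (use lim[OF t] in \<open>simp add: e_def\<close>)
    from LIMSEQ_le_const[OF this] le show ?thesis by auto
  qed
  have e0: "e t0 1 = 0"
  proof -
    have "e t0 1 \<le> 0" using e1M[OF t0] d by simp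
    moreover have "0 \<le> e t0 1" unfolding e_def by (rule C2r_norm_ge_sup(2)[OF S rem[OF t0]])
    ultimately show ?thesis by simp
  qed
  have bound: "C2r_norm S r (\<lambda>x. F t x - F t0 x) \<le> \<bar>t - t0\<bar> / d * M" if t: "t \<in> I" "\<bar>t - t0\<bar> < d" for t
  proof -
    have "C2r_norm S r (\<lambda>x. 1 * (F t x - (\<Sum>k<1. (t - t0) ^ k * c k x)) + (- 1) * (F t0 x - (\<Sum>k<1. (t0 - t0) ^ k * c k x)))
        \<le> \<bar>1\<bar> * e t 1 + \<bar>- 1\<bar> * e t0 1"
      unfolding e_def by (rule C2r_norm_lincomb_le[OF S rem[OF t(1)] rem[OF t0]])
    thus ?thesis using e1M[OF t] e0 by (simp add: algebra_simps)
  qed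
  show "((\<lambda>t. C2r_norm S r (\<lambda>x. F t x - F t0 x)) \<longlongrightarrow> 0) (at t0 within I)"
  proof (rule tendsto_sandwich)
    show "eventually (\<lambda>t. 0 \<le> C2r_norm S r (\<lambda>x. F t x - F t0 x)) (at t0 within I)"
      unfolding eventually_at_filter
      by (rule always_eventually) (auto intro!: C2r_norm_ge_sup(2)[OF S] C2r0_diff[OF S(1)] F(2) t0)
    show "eventually (\<lambda>t. C2r_norm S r (\<lambda>x. F t x - F t0 x) \<le> \<bar>t - t0\<bar> / d * M) (at t0 within I)"
      unfolding eventually_at using d bound by (auto simp: dist_real_def intro!: exI[of _ d])
    have "((\<lambda>t. \<bar>t - t0\<bar> / d * M) \<longlongrightarrow> \<bar>t0 - t0\<bar> / d * M) (at t0 within I)"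
      using d by (intro tendsto_intros) auto
    thus "((\<lambda>t. \<bar>t - t0\<bar> / d * M) \<longlongrightarrow> 0) (at t0 within I)" by simp
  qed simp
qed

lemma at_end_ereal: "at_end (ereal l) = at_left l"
  unfolding at_end_def at_left_ereal filter_eq_iff eventually_filtercomap eventually_filtermap
  by (auto intro: exI[of _ "\<lambda>y. P (real_of_ereal y)" for P] elim: eventually_mono)

lemma param_dom_ereal: "param_dom (ereal l) = {0..<l}"
  by (auto simp: param_dom_def)

lemma eventually_at_end_param_dom: "0 < sinf \<Longrightarrow> eventually (\<lambda>s. s \<in> param_dom sinf) (at_end sinf)"
  unfolding at_end_def eventually_filtercomap
  by (rule exI[of _ "\<lambda>y. 0 < y \<and> y < sinf"])
     (auto simp: param_dom_def eventually_at_left[of 0] intro!: exI[of _ 0])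

lemma eventually_at_endD:
  assumes "eventually P (at_end sinf)" "0 < sinf"
  obtains b where "b \<in> param_dom sinf" "\<And>s. s \<in> param_dom sinf \<Longrightarrow> b \<le> s \<Longrightarrow> P s"
proof -
  obtain Q where Q: "eventually Q (at_left sinf)" "\<And>s. Q (ereal s) \<Longrightarrow> P s"
    using assms(1) unfolding at_end_def eventually_filtercomap by blast
  obtain c where c: "c < sinf" "\<And>y. c < y \<Longrightarrow> y < sinf \<Longrightarrow> Q y"
    using Q(1) eventually_at_left[OF assms(2)] by blast
  obtain b where b: "max 0 c < ereal b" "ereal b < sinf" using ereal_dense2[of "max 0 c" sinf] c(1) assms(2) by auto
  show ?thesis
  proof (rule that[of b])
    show "b \<in> param_dom sinf" using b by (simp add: param_dom_def)
    fix s assume s: "s \<in> param_dom sinf" "b \<le> s"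
    have "c < ereal s" using b(1) s(2) by (metis ereal_less_eq(3) less_le_trans max_less_iff_conj)
    thus "P s" using Q(2) c(2) s(1) by (simp add: param_dom_def)
  qed
qed

lemma filterlim_at_end:
  assumes "\<And>n. \<sigma> n \<in> param_dom sinf" "((\<lambda>n. ereal (\<sigma> n)) \<longlongrightarrow> sinf) F"
  shows "filterlim \<sigma> (at_end sinf) F"
  unfolding at_end_def filterlim_filtercomap_iff o_def filterlim_at
  using assms by (auto simp: param_dom_def less_imp_neq)


section \<open>The curve of positive solutions\<close>

text \<open>What the two cases of the Alternative have in common, apart from the compactness of \<open>psi\<close> near the end
  of the parameter interval, whose conclusion is a hypothesis of \<open>rescaled_limit\<close>.\<close>

locale solution_curve =
  fixes S :: "(real^'n::finite) set" and r p :: real and sinf :: ereal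
    and lam alpha :: "real \<Rightarrow> real" and psi :: "real \<Rightarrow> real^'n \<Rightarrow> real" and s0 linf :: real
  assumes S: "open S" "bounded S" "measure lebesgue S = 1" and p: "1 < p"
    and sol: "positive_solution_curve S r p (param_dom sinf) lam alpha psi"
    and simple: "simple_curve (param_dom sinf) lam alpha psi"
    and cont: "continuous_curve S r (param_dom sinf) lam alpha psi"
    and no_bif: "no_bifurcation_points S r p (param_dom sinf) lam alpha psi"
    and contG: "continues_G S r p sinf lam alpha psi s0"
    and alpha_lim: "filterlim alpha (at_right 0) (at_end sinf)"
    and lam_lim: "(lam \<longlongrightarrow> linf) (at_end sinf)"
    and linf: "sobolev_const S (2 * p) / p < linf"
begin

abbreviation "D \<equiv> param_dom sinf"
abbreviation "lstar \<equiv> sobolev_const S (2 * p) / p"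

definition mu :: "real \<Rightarrow> real" where "mu s = lam s * alpha s powr (p - 1)"
definition u :: "real \<Rightarrow> real^'n \<Rightarrow> real" where "u s x = lam s / alpha s * psi s x"
definition curve_image :: "(real \<times> (real^'n \<Rightarrow> real)) set" where "curve_image = (\<lambda>s. (mu s, u s)) ` D"

lemma S_nonempty: "S \<noteq> {}" using S(3) by auto

lemma S': "open S" "S \<noteq> {}" "bounded S" using S S_nonempty by auto

lemma s0: "0 < s0" "ereal s0 < sinf" "strict_mono_on {0..<s0} lam" "lam ` {0..<s0} = {0..<lstar}"
    "(\<lambda>s. (lam s, alpha s, psi s)) ` {0..<s0} = G_set S r p"
  using contG by (auto simp: continues_G_def)

lemma sinf_pos: "0 < sinf" using s0(1,2) by (metis ereal_less(2) less_trans)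

lemma in_D: "s \<in> D \<longleftrightarrow> 0 \<le> s \<and> ereal s < sinf" by (simp add: param_dom_def)

lemma D_le: "s \<in> D \<Longrightarrow> 0 \<le> t \<Longrightarrow> t \<le> s \<Longrightarrow> t \<in> D"
  unfolding in_D by (auto intro: le_less_trans[of "ereal t" "ereal s" sinf])

lemma s0_D: "s0 \<in> D" "0 \<in> D" using s0(1,2) sinf_pos by (auto simp: in_D zero_ereal_def)

lemma solD: assumes "s \<in> D"
  shows "solves_P S r p (lam s) (alpha s) (psi s)" "0 < alpha s" "0 \<le> lam s" "psi s \<in> C2r0 S r"
  using sol assms by (auto simp: positive_solution_curve_def solves_P_def)

lemma lstar_pos: "0 < lstar"
proof -
  have "lam 0 \<in> {0..<lstar}" using s0(1,4) by force
  thus ?thesis by auto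
qed

lemma sobolev_pos: "0 < sobolev_const S (2 * p)" using lstar_pos p by (simp add: zero_less_divide_iff)

lemma lam_0: "lam 0 = 0"
proof -
  have "0 \<in> lam ` {0..<s0}" using s0(4) lstar_pos by simp
  then obtain s where s: "s \<in> {0..<s0}" "lam s = 0" by auto
  show ?thesis
  proof (cases "s = 0")
    case False
    hence "lam 0 < lam s" using s s0(1,3) by (intro strict_mono_onD[OF s0(3)]) auto
    thus ?thesis using s(2) solD(3)[OF s0_D(2)] by simp
  qed (use s in simp)
qed

lemma curve_continuous: "continuous_on D lam" "continuous_on D alpha"
    "continuous_map (top_of_set D) (C2r0_topology S r) psi"
  using cont by (auto simp: continuous_curve_def)

lemma lam_s0: "lam s0 = lstar"
proof -
  have sub: "{0..<s0} \<subseteq> D" using s0_D(1) D_le by auto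
  have "(lam \<longlongrightarrow> lam s0) (at s0 within D)" using curve_continuous(1) s0_D(1)
    by (simp add: continuous_on)
  hence lim: "(lam \<longlongrightarrow> lam s0) (at s0 within {0..<s0})" by (rule tendsto_within_subset[OF _ sub])
  have nb: "at s0 within {0..<s0} \<noteq> bot"
    using s0(1) by (simp add: at_within_eq_bot_iff closure_atLeastLessThan)
  have ev: "eventually (\<lambda>s. s \<in> {0..<s0}) (at s0 within {0..<s0})"
    by (simp add: eventually_at_filter)
  have "lam s \<le> lstar" if "s \<in> {0..<s0}" for s
    using imageI[OF that, of lam] unfolding s0(4) by simp
  with ev have "eventually (\<lambda>s. lam s \<le> lstar) (at s0 within {0..<s0})" by (rule eventually_mono)
  hence "lam s0 \<le> lstar" by (rule tendsto_upperbound[OF lim _ nb])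
  moreover have "y \<le> lam s0" if y: "y < lstar" for y
  proof (cases "0 \<le> y")
    case True
    with y have "y \<in> lam ` {0..<s0}" unfolding s0(4) by simp
    then obtain s where s: "s \<in> {0..<s0}" "lam s = y" by blast
    have "eventually (\<lambda>t. s < t) (at s0 within {0..<s0})"
      using s(1) by (intro eventually_at_topological[THEN iffD2] exI[of _ "{s<..}"]) auto
    with ev have "eventually (\<lambda>t. y \<le> lam t) (at s0 within {0..<s0})"
    proof eventually_elim
      case (elim t)
      thus ?case using strict_mono_onD[OF s0(3), of s t] s by auto
    qed
    thus ?thesis by (rule tendsto_lowerbound[OF lim _ nb])
  qed (use solD(3)[OF s0_D(1)] in simp)
  ultimately show ?thesis by (meson dense_le order_antisym)
qed

lemma eq_if_same_triple:
  assumes "s \<in> D" "t \<in> D" "lam s = lam t" "alpha s = alpha t" "psi s = psi t" shows "s = t"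
  using simple assms unfolding simple_curve_def inj_on_def by auto

text \<open>A value below the threshold would repeat a point of the part of the curve that makes up \<open>G_set\<close>, and a
  value equal to it would, by uniqueness, repeat the point at \<open>s0\<close>. The curve is simple.\<close>

lemma lam_gt: assumes s: "s \<in> D" "s0 < s" shows "lstar < lam s"
proof (rule ccontr)
  assume "\<not> lstar < lam s"
  then consider "lam s < lstar" | "lam s = lstar" by linarith
  thus False
  proof cases
    case 1
    hence "(lam s, alpha s, psi s) \<in> G_set S r p" using solD(1)[OF s(1)] by (simp add: G_set_def)
    then obtain t where t: "t \<in> {0..<s0}" "(lam s, alpha s, psi s) = (lam t, alpha t, psi t)"
      using s0(5) by (metis (no_types, lifting) imageE)
    have "t \<in> D" using t(1) s0_D(1) D_le by auto
    from eq_if_same_triple[OF s(1) this] have "s = t" using t(2) by blast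
    thus False using t(1) s(2) by simp
  next
    case 2
    have "alpha s = alpha s0 \<and> psi s = psi s0"
      using solves_P_unique_le_threshold[OF S(1,2) p sobolev_pos, of lstar r "alpha s" "psi s" "alpha s0" "psi s0"]
        solD[OF s(1)] solD[OF s0_D(1)] 2 lam_s0 p by simp
    hence "s = s0" using eq_if_same_triple[OF s(1) s0_D(1)] 2 lam_s0 by metis
    thus False using s(2) by simp
  qed
qed

lemma u_C2r0: "s \<in> D \<Longrightarrow> u s \<in> C2r0 S r"
  using C2r0_lincomb[OF S(1) solD(4) solD(4), of s s "lam s / alpha s" 0] unfolding u_def[abs_def] by simp

lemma curve_in_solutions: "s \<in> D \<Longrightarrow> (mu s, u s) \<in> rabinowitz_solutions S r p"
  using solves_P_imp_rabinowitz_solution[OF S(1) p solD(1,2)] unfolding mu_def u_def[abs_def] by simp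

lemma mu_u_0: "mu 0 = 0" "u 0 = (\<lambda>_. 0)"
  by (auto simp: mu_def u_def lam_0 fun_eq_iff)

lemma recovered_alpha_u: "s \<in> D \<Longrightarrow> recovered_alpha S p (u s) = alpha s"
  using recovered_alpha_solves_P[OF S(1,2) p solD(1,2)] unfolding u_def[abs_def] by simp

lemma mu_continuous: "continuous_on D mu"
  unfolding mu_def using solD(2) by (intro continuous_intros curve_continuous) force

lemma u_continuous: "continuous_map (top_of_set D) (C2r0_topology S r) u"
  unfolding continuous_map_C2r0_iff[OF S']
proof (intro conjI ballI)
  fix s assume s: "s \<in> D"
  show "u s \<in> C2r0 S r" by (rule u_C2r0[OF s])
  have "((\<lambda>t. lam t / alpha t) \<longlongrightarrow> lam s / alpha s) (at s within D)"
    using curve_continuous(1,2) s solD(2)[OF s] by (intro tendsto_divide) (auto simp: continuous_on)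
  moreover have "((\<lambda>t. C2r_norm S r (\<lambda>x. psi t x - psi s x)) \<longlongrightarrow> 0) (at s within D)"
    using curve_continuous(3) s unfolding continuous_map_C2r0_iff[OF S'] by blast
  moreover have "eventually (\<lambda>t. psi t \<in> C2r0 S r) (at s within D)"
    using solD(4) by (auto simp: eventually_at_filter)
  ultimately show "((\<lambda>t. C2r_norm S r (\<lambda>x. u t x - u s x)) \<longlongrightarrow> 0) (at s within D)"
    unfolding u_def by (rule C2r_norm_scaled_tendsto[OF S' _ _ _ solD(4)[OF s]])
qed

lemma curve_continuous_map:
  "continuous_map (top_of_set D) (prod_topology (top_of_set {0..}) (C2r0_topology S r)) (\<lambda>s. (mu s, u s))"
proof -
  have "mu ` D \<subseteq> {0..}" using curve_in_solutions by (auto simp: rabinowitz_solutions_def)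
  thus ?thesis using mu_continuous u_continuous
    by (auto simp: continuous_map_pairwise o_def continuous_map_in_subtopology)
qed

lemma curve_image_subset: "curve_image \<subseteq> rabinowitz_solutions S r p" unfolding curve_image_def using curve_in_solutions by auto

lemma solution_on_curve_if_triple:
  assumes "t \<in> D" "(l, a, f) = (lam t, alpha t, psi t)" "l * a powr (p - 1) = m" "\<And>x. v x = l / a * f x"
  shows "(m, v) \<in> curve_image"
  unfolding curve_image_def using assms by (auto simp: mu_def u_def[abs_def] fun_eq_iff intro!: image_eqI[of _ _ t])

lemma rabinowitz_subset: "rabinowitz_solutions S r p \<subseteq> {0..} \<times> C2r0 S r"
  by (auto simp: rabinowitz_solutions_def)

end


section \<open>The image of the curve is the continuum\<close>

context solution_curve begin

abbreviation "solution_space \<equiv> subtopology (prod_topology (top_of_set {0..}) (C2r0_topology S r))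
  (rabinowitz_solutions S r p)"

text \<open>By definition \<open>G_set\<close> contains every solution below the threshold, so membership needs no convergence of
  \<open>psi\<close>. This covers the point \<open>(0, 0)\<close>, where the inverse substitution divides by 0.\<close>

lemma subcritical_solution_on_curve:
  assumes R: "(m, v) \<in> rabinowitz_solutions S r p" "0 < m"
    and l: "m * recovered_alpha S p v powr (1 - p) < lstar"
  shows "(m, v) \<in> curve_image"
proof -
  let ?a = "recovered_alpha S p v"
  let ?l = "m * ?a powr (1 - p)" and ?f = "\<lambda>x. ?a powr p / m * v x"
  note P = rabinowitz_solution_imp_solves_P[OF S p R]
  have "(?l, ?a, ?f) \<in> G_set S r p" using P(1) l by (simp add: G_set_def)
  then obtain t where t: "t \<in> {0..<s0}" "(?l, ?a, ?f) = (lam t, alpha t, psi t)"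
    using s0(5) by (metis (no_types, lifting) imageE)
  have "t \<in> D" using t(1) s0_D(1) D_le by auto
  from this t(2) P(2) show ?thesis
  proof (rule solution_on_curve_if_triple)
    show "v x = ?l / ?a * (?a powr p / m * v x)" for x by (simp only: mult.assoc[symmetric] P(3) mult_1_left)
  qed
qed

text \<open>Sequences of solutions converging to a point of the curve are transformed back to the constrained problem.
  For \<open>\<lambda>(s)\<close> at or above the threshold, the limit \<open>mu s\<close> is positive, so that the transformed
  sequence converges in the Hoelder norm and the absence of bifurcation points applies.\<close>

lemma curve_image_open: "openin solution_space curve_image"
proof (rule openin_if_sequentially_open[OF S' rabinowitz_subset curve_image_subset])
  fix m w \<mu> v
  assume mw: "(m, w) \<in> curve_image" and R: "\<And>n::nat. (\<mu> n, v n) \<in> rabinowitz_solutions S r p"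
    and \<mu>: "\<mu> \<longlonglongrightarrow> m" and v: "(\<lambda>n. C2r_norm S r (\<lambda>x. v n x - w x)) \<longlonglongrightarrow> 0"
  obtain s where s: "s \<in> D" "m = mu s" "w = u s" using mw by (auto simp: curve_image_def)
  show "\<exists>n. (\<mu> n, v n) \<in> curve_image"
  proof (cases "\<exists>n. \<mu> n = 0")
    case True
    then obtain n where n: "\<mu> n = 0" by blast
    have "v n = (\<lambda>_. 0)"
      by (rule rabinowitz_solution_0[OF S(1,2) _ sobolev_pos]) (use R[of n] n p in auto)
    hence "(\<mu> n, v n) = (mu 0, u 0)" using n mu_u_0 by simp
    thus ?thesis unfolding curve_image_def using s0_D(2) by blast
  next
    case False
    hence \<mu>pos: "0 < \<mu> n" for n
      using R[of n] by (metis (no_types, lifting) case_prodD mem_Collect_eq order_le_less rabinowitz_solutions_def)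
    define a where "a n = recovered_alpha S p (v n)" for n
    define l where "l n = \<mu> n * a n powr (1 - p)" for n
    define c where "c n = a n powr p / \<mu> n" for n
    have vm: "v n \<in> C2r0 S r" and vnn: "x \<in> S \<Longrightarrow> 0 \<le> v n x" for n x
      using R[of n] by (auto simp: rabinowitz_solutions_def)
    have um: "u s \<in> C2r0 S r" and unn: "x \<in> S \<Longrightarrow> 0 \<le> u s x" for x
      using curve_in_solutions[OF s(1)] by (auto simp: rabinowitz_solutions_def)
    have "(\<lambda>n. recovered_alpha S p (v n)) \<longlonglongrightarrow> recovered_alpha S p (u s)"
      by (rule recovered_alpha_tendsto[OF S p um unn vm vnn]) (use v s(3) in simp_all)
    hence a: "a \<longlonglongrightarrow> alpha s" unfolding a_def recovered_alpha_u[OF s(1)] .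
    have as: "0 < alpha s" by (rule solD(2)[OF s(1)])
    have l: "l \<longlonglongrightarrow> lam s"
    proof -
      have "l \<longlonglongrightarrow> mu s * alpha s powr (1 - p)"
        unfolding l_def using \<mu> s(2) a as by (intro tendsto_mult tendsto_powr tendsto_const) auto
      also have "mu s * alpha s powr (1 - p) = lam s * (alpha s powr (p - 1) * alpha s powr (1 - p))"
        by (simp add: mu_def)
      also have "alpha s powr (p - 1) * alpha s powr (1 - p) = 1" using as by (simp flip: powr_add)
      finally show ?thesis by simp
    qed
    show ?thesis
    proof (cases "lam s < lstar")
      case True
      have "eventually (\<lambda>n. l n < lstar) sequentially" using l True by (rule order_tendstoD)
      then obtain n where "l n < lstar" by (auto simp: eventually_sequentially)
      thus ?thesis using subcritical_solution_on_curve[OF R \<mu>pos] unfolding l_def a_def by blast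
    next
      case False
      hence ls: "0 < lam s" using lstar_pos by linarith
      hence ms: "0 < mu s" using as by (simp add: mu_def)
      obtain e where e: "0 < e" "\<And>l a f. f \<in> C2r0 S r \<Longrightarrow> \<bar>l - lam s\<bar> < e \<Longrightarrow> \<bar>a - alpha s\<bar> < e \<Longrightarrow>
          C2r_norm S r (\<lambda>x. f x - psi s x) < e \<Longrightarrow> solves_P S r p l a f \<Longrightarrow>
          (l, a, f) \<in> (\<lambda>t. (lam t, alpha t, psi t)) ` D"
      proof -
        from bspec[OF no_bif[unfolded no_bifurcation_points_def] s(1)]
        obtain e where "0 < e" and "\<forall>l a f. f \<in> C2r0 S r \<and> \<bar>l - lam s\<bar> < e \<and> \<bar>a - alpha s\<bar> < e \<and>
            C2r_norm S r (\<lambda>x. f x - psi s x) < e \<longrightarrow>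
            solves_P S r p l a f = ((l, a, f) \<in> (\<lambda>t. (lam t, alpha t, psi t)) ` D)"
          by (elim exE conjE)
        thus ?thesis by (intro that[of e]) simp_all
      qed
      have c: "c \<longlonglongrightarrow> alpha s powr p / mu s"
        unfolding c_def using \<mu> s(2) a as ms by (intro tendsto_divide tendsto_powr tendsto_const) auto
      have psi: "alpha s powr p / mu s * u s x = psi s x" for x
      proof -
        have "alpha s powr p = alpha s * alpha s powr (p - 1)"
          using as by (simp add: powr_diff)
        thus ?thesis using as ls by (simp add: mu_def u_def)
      qed
      have "(\<lambda>n. C2r_norm S r (\<lambda>x. c n * v n x - alpha s powr p / mu s * u s x)) \<longlonglongrightarrow> 0"
        by (rule C2r_norm_scaled_tendsto[OF S' c]) (use v s(3) vm um in auto)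
      hence f: "(\<lambda>n. C2r_norm S r (\<lambda>x. c n * v n x - psi s x)) \<longlonglongrightarrow> 0" unfolding psi .
      have "eventually (\<lambda>n. \<bar>l n - lam s\<bar> < e \<and> \<bar>a n - alpha s\<bar> < e \<and>
          C2r_norm S r (\<lambda>x. c n * v n x - psi s x) < e) sequentially"
        using tendstoD[OF l e(1)] tendstoD[OF a e(1)] order_tendstoD(2)[OF f e(1)]
        by eventually_elim (simp add: dist_real_def)
      then obtain n where n: "\<bar>l n - lam s\<bar> < e" "\<bar>a n - alpha s\<bar> < e"
          "C2r_norm S r (\<lambda>x. c n * v n x - psi s x) < e" by (auto simp: eventually_sequentially)
      note P = rabinowitz_solution_imp_solves_P[OF S p R[of n] \<mu>pos[of n], folded a_def, folded l_def c_def]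
      have "(\<lambda>x. c n * v n x) \<in> C2r0 S r" using P(1) by (simp add: solves_P_def)
      from e(2)[OF this n P(1)] obtain t where t: "t \<in> D" "(l n, a n, \<lambda>x. c n * v n x) = (lam t, alpha t, psi t)"
        by blast
      have "(\<mu> n, v n) \<in> curve_image"
        by (rule solution_on_curve_if_triple[OF t P(2)]) (simp only: mult.assoc[symmetric] P(3) mult_1_left)
      thus ?thesis ..
    qed
  qed
qed

lemma alpha_small_near_end:
  assumes "0 < \<delta>"
  obtains b where "b \<in> D" "\<And>s. s \<in> D \<Longrightarrow> b \<le> s \<Longrightarrow> alpha s < \<delta>"
proof -
  have "(alpha \<longlongrightarrow> 0) (at_end sinf)" using alpha_lim by (simp add: filterlim_at)
  hence "eventually (\<lambda>s. alpha s < \<delta>) (at_end sinf)" using assms by (rule order_tendstoD)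
  from eventually_at_endD[OF this sinf_pos] that show ?thesis by blast
qed

lemma inverse_alpha_le:
  assumes s: "s \<in> D" and B: "\<And>x. x \<in> S \<Longrightarrow> u s x \<le> B"
  shows "1 / alpha s \<le> 1 + B"
  by (rule solves_P_inverse_alpha_le[OF S p solD(1,2)[OF s]]) (use B in \<open>simp add: u_def\<close>)

text \<open>A bound on \<open>u s\<close> keeps \<open>alpha s\<close> away from 0, its limit at the end of the parameter interval.\<close>

lemma bounded_part_parameter:
  obtains b where "b \<in> D" "\<And>s. s \<in> D \<Longrightarrow> (\<And>x. x \<in> S \<Longrightarrow> u s x \<le> B) \<Longrightarrow> s \<le> b"
proof -
  define B' where "B' = max B 0"
  have "0 < 1 / (1 + B')" by (simp add: B'_def add_pos_nonneg)
  then obtain b where b: "b \<in> D" "\<And>s. s \<in> D \<Longrightarrow> b \<le> s \<Longrightarrow> alpha s < 1 / (1 + B')"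
    using alpha_small_near_end by blast
  show ?thesis
  proof (rule that[OF b(1)], rule ccontr)
    fix s assume s: "s \<in> D" "\<And>x. x \<in> S \<Longrightarrow> u s x \<le> B" "\<not> s \<le> b"
    have "1 / alpha s \<le> 1 + B'" by (rule inverse_alpha_le[OF s(1)]) (use s(2) in \<open>force simp: B'_def\<close>)
    moreover have "alpha s < 1 / (1 + B')" using b(2) s by simp
    moreover have "0 < alpha s" "0 \<le> B'" using solD(2)[OF s(1)] by (auto simp: B'_def)
    ultimately show False by (simp add: field_simps)
  qed
qed

text \<open>A convergent sequence on the curve is bounded, so its parameters lie in a compact interval and
  accumulate at some \<open>s\<close>, whose point on the curve is then the limit.\<close>

lemma curve_image_complement_open: "openin solution_space (rabinowitz_solutions S r p - curve_image)"
proof (rule openin_if_sequentially_open[OF S' rabinowitz_subset])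
  fix m w \<mu> v
  assume mw: "(m, w) \<in> rabinowitz_solutions S r p - curve_image"
    and R: "\<And>n::nat. (\<mu> n, v n) \<in> rabinowitz_solutions S r p"
    and \<mu>: "\<mu> \<longlonglongrightarrow> m" and v: "(\<lambda>n. C2r_norm S r (\<lambda>x. v n x - w x)) \<longlonglongrightarrow> 0"
  show "\<exists>n. (\<mu> n, v n) \<in> rabinowitz_solutions S r p - curve_image"
  proof (rule ccontr)
    assume "\<not> ?thesis"
    hence "\<forall>n. \<exists>s. s \<in> D \<and> \<mu> n = mu s \<and> v n = u s" using R by (force simp: curve_image_def)
    then obtain \<sigma> where \<sigma>: "\<And>n. \<sigma> n \<in> D" "\<And>n. \<mu> n = mu (\<sigma> n)" "\<And>n. v n = u (\<sigma> n)" by metis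
    have wm: "w \<in> C2r0 S r" using mw rabinowitz_subset by auto
    note dle = abs_diff_le_C2r_norm[OF S' u_C2r0[OF \<sigma>(1)] wm]
    obtain B1 where B1: "\<And>x. x \<in> S \<Longrightarrow> \<bar>w x\<bar> \<le> B1" using C2r0_bdd(1)[OF S(2) wm] by blast
    have "Bseq (\<lambda>n. C2r_norm S r (\<lambda>x. v n x - w x))"
      using v by (intro convergent_imp_Bseq) (auto simp: convergent_def)
    then obtain B2 where B2: "\<And>n. norm (C2r_norm S r (\<lambda>x. v n x - w x)) \<le> B2" by (auto simp: Bseq_def)
    have ub: "u (\<sigma> n) x \<le> B1 + B2" if "x \<in> S" for n x
      using dle[OF that, of n] B1[OF that] B2[of n] \<sigma>(3)[of n] by (simp add: abs_le_iff)
    obtain b where b: "b \<in> D" "\<And>s. s \<in> D \<Longrightarrow> (\<And>x. x \<in> S \<Longrightarrow> u s x \<le> B1 + B2) \<Longrightarrow> s \<le> b"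
      using bounded_part_parameter by blast
    have "\<sigma> n \<in> {0..b}" for n using b(2)[OF \<sigma>(1) ub] \<sigma>(1)[of n] by (simp add: in_D)
    then obtain s k where s: "s \<in> {0..b}" "strict_mono (k :: nat \<Rightarrow> nat)" "(\<sigma> \<circ> k) \<longlonglongrightarrow> s"
      using compact_Icc[of 0 b] unfolding compact_def by metis
    have sD: "s \<in> D" using s(1) b(1) D_le by auto
    have "(\<lambda>n. mu ((\<sigma> \<circ> k) n)) \<longlonglongrightarrow> mu s"
      by (rule continuous_on_tendsto_compose[OF mu_continuous s(3) sD]) (simp add: \<sigma>(1))
    moreover have "(\<lambda>n. mu ((\<sigma> \<circ> k) n)) \<longlonglongrightarrow> m"
      using LIMSEQ_subseq_LIMSEQ[OF \<mu> s(2)] by (simp add: o_def \<sigma>(2))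
    ultimately have ms: "m = mu s" using LIMSEQ_unique by blast
    have lim1: "(\<lambda>n. C2r_norm S r (\<lambda>x. u ((\<sigma> \<circ> k) n) x - u s x)) \<longlonglongrightarrow> 0"
      by (rule continuous_map_C2r0_sequentially[OF S' u_continuous sD _ s(3)]) (simp add: \<sigma>(1))
    have lim2: "(\<lambda>n. C2r_norm S r (\<lambda>x. u ((\<sigma> \<circ> k) n) x - w x)) \<longlonglongrightarrow> 0"
      using LIMSEQ_subseq_LIMSEQ[OF v s(2)] by (simp add: o_def \<sigma>(3))
    have "w x = u s x" for x
    proof (cases "x \<in> S")
      case False thus ?thesis using C2r0_D(8)[OF wm] C2r0_D(8)[OF u_C2r0[OF sD]] by simp
    next
      case True
      have "(\<lambda>n. u ((\<sigma> \<circ> k) n) x - u s x) \<longlonglongrightarrow> 0"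
        by (rule Lim_null_comparison[OF _ lim1])
          (use abs_diff_le_C2r_norm[OF S' u_C2r0[OF \<sigma>(1)] u_C2r0[OF sD] True] in simp)
      moreover have "(\<lambda>n. u ((\<sigma> \<circ> k) n) x - w x) \<longlonglongrightarrow> 0"
        by (rule Lim_null_comparison[OF _ lim2]) (use dle[OF True] in simp)
      ultimately show ?thesis using LIMSEQ_unique by (metis LIM_zero_cancel)
    qed
    hence "(m, w) = (mu s, u s)" using ms by auto
    hence "(m, w) \<in> curve_image" unfolding curve_image_def using sD by blast
    thus False using mw by simp
  qed
qed blast

theorem rabinowitz_continuum_eq: "rabinowitz_continuum S r p = curve_image"
  unfolding rabinowitz_continuum_def
proof (rule connected_component_of_unique)
  have "(0, \<lambda>_. 0) = (mu 0, u 0)" using mu_u_0 by simp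
  thus 0: "(0, \<lambda>_. 0) \<in> curve_image" unfolding curve_image_def using s0_D(2) by blast
  have "x \<in> D" if "a \<in> D" "b \<in> D" "a \<le> x" "x \<le> b" for a b x
    by (rule D_le[OF that(2) _ that(4)]) (use that(1,3) in \<open>simp add: in_D\<close>)
  hence "is_interval D" unfolding is_interval_1 by blast
  hence "connectedin (top_of_set D) D"
    by (simp add: connectedin_subtopology is_interval_connected)
  from connectedin_continuous_map_image[OF curve_continuous_map this]
  show conn: "connectedin solution_space curve_image"
    unfolding connectedin_subtopology using curve_image_subset by (simp add: curve_image_def)
  have top: "topspace solution_space = rabinowitz_solutions S r p"
  proof -
    interpret Metric_space "C2r0 S r" "C2r_dist S r" by (rule Metric_space_C2r0[OF S'])
    show ?thesis using rabinowitz_subset by (auto simp: C2r0_topology_def)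
  qed
  have "closedin solution_space curve_image" unfolding closedin_def top using curve_image_subset curve_image_complement_open by simp
  fix C' assume C': "(0, \<lambda>_. 0) \<in> C' \<and> connectedin solution_space C'"
  with connectedin_clopen_cases[OF _ \<open>closedin solution_space curve_image\<close> curve_image_open] have "C' \<subseteq> curve_image \<or> disjnt C' curve_image" by blast
  thus "C' \<subseteq> curve_image" using 0 C' by (auto simp: disjnt_def)
qed

lemma curve_image_unbounded: "unbounded_pairs S r curve_image"
  unfolding unbounded_pairs_def
proof
  fix B
  obtain b where b: "b \<in> D" "\<And>s. s \<in> D \<Longrightarrow> (\<And>x. x \<in> S \<Longrightarrow> u s x \<le> B) \<Longrightarrow> s \<le> b"
    using bounded_part_parameter by blast
  have "ereal b < sinf" using b(1) in_D by blast
  then obtain s where s: "b < s" "ereal s < sinf" using ereal_dense2[of "ereal b" sinf] by auto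
  hence sD: "s \<in> D" using b(1) by (auto simp: in_D)
  obtain x where x: "x \<in> S" "\<not> u s x \<le> B" using b(2)[OF sD] s(1) by force
  have z: "(\<lambda>_. 0) \<in> C2r0 S r" by (rule C2r0_zero)
  have "\<bar>u s x - 0\<bar> \<le> C2r_norm S r (\<lambda>x. u s x - 0)"
    by (rule abs_diff_le_C2r_norm[OF S' u_C2r0[OF sD] z x(1)])
  hence "B < \<bar>mu s\<bar> + C2r_norm S r (u s)" using x(2) by simp
  moreover have "(mu s, u s) \<in> curve_image" unfolding curve_image_def using sD by blast
  ultimately show "\<exists>(m, u)\<in>curve_image. B < \<bar>m\<bar> + C2r_norm S r u" by blast
qed

lemma mu_lim: "filterlim mu (at_right 0) (at_end sinf)"
  unfolding filterlim_at
proof (intro conjI)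
  have a: "(alpha \<longlongrightarrow> 0) (at_end sinf)" using alpha_lim by (simp add: filterlim_at)
  note ev = eventually_at_end_param_dom[OF sinf_pos]
  have apos: "eventually (\<lambda>s. 0 \<le> alpha s) (at_end sinf)"
    using ev by eventually_elim (use solD(2) in \<open>auto intro: less_imp_le\<close>)
  have "((\<lambda>s. alpha s powr (p - 1)) \<longlongrightarrow> 0 powr (p - 1)) (at_end sinf)"
    using p apos by (intro tendsto_powr'[OF a tendsto_const]) auto
  from tendsto_mult[OF lam_lim this] show "(mu \<longlongrightarrow> 0) (at_end sinf)" by (simp add: mu_def[abs_def])
  have "0 < linf" using linf lstar_pos by linarith
  hence "eventually (\<lambda>s. 0 < lam s) (at_end sinf)" by (rule order_tendstoD[OF lam_lim])
  with ev have "eventually (\<lambda>s. 0 < mu s) (at_end sinf)"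
    by eventually_elim (use solD(2) in \<open>fastforce simp: mu_def\<close>)
  thus "eventually (\<lambda>s. mu s \<in> {0<..} \<and> mu s \<noteq> 0) (at_end sinf)"
    by eventually_elim simp
qed

text \<open>The exponent makes \<open>U\<close> a solution without parameter: multiplying \<open>f\<close> by \<open>c\<close> turns
  \<open>- \<Delta>f = (linf f)\<^sup>p\<close> into \<open>- \<Delta>U = U\<^sup>p\<close> precisely if \<open>c\<^sup>p\<^sup>-\<^sup>1 = linf\<^sup>p\<close>. The rescaling has the
  factor \<open>c\<close> in the limit because \<open>alpha s * u s\<close> equals \<open>lam s * psi s\<close>.\<close>

lemma rescaled_limit:
  assumes \<sigma>: "\<And>n. \<sigma> n \<in> D" "(\<lambda>n. ereal (\<sigma> n)) \<longlonglongrightarrow> sinf"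
    and f: "solves_P S r p linf 0 f" "(\<lambda>n. C2_norm S (\<lambda>x. psi (\<sigma> n) x - f x)) \<longlonglongrightarrow> 0"
  defines "U \<equiv> \<lambda>x. linf powr (p / (p - 1)) * f x"
  shows "U \<in> C20 S"
    "(\<lambda>n. C2_norm S (\<lambda>x. lam (\<sigma> n) powr (1 / (p - 1)) * alpha (\<sigma> n) * u (\<sigma> n) x - U x)) \<longlonglongrightarrow> 0"
    "\<And>x. x \<in> S \<Longrightarrow> - laplacian U x = U x powr p" "\<And>x. x \<in> S \<Longrightarrow> 0 < U x"
proof -
  have lpos: "0 < linf" using linf lstar_pos by linarith
  have fm: "f \<in> C2r0 S r" using f(1) by (simp add: solves_P_def)
  have "U \<in> C2r0 S r" unfolding U_def using C2r0_lincomb[OF S(1) fm fm, of "linf powr (p / (p - 1))" 0] by simp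
  thus "U \<in> C20 S" by (auto simp: C2r0_def C2r_closure_def C20_def)
  have fpos: "0 < f x" and fe: "- laplacian f x = (linf * f x) powr p" if "x \<in> S" for x
    using f(1) that by (auto simp: solves_P_def)
  show "0 < U x" if "x \<in> S" for x using fpos[OF that] lpos by (simp add: U_def)
  show "- laplacian U x = U x powr p" if x: "x \<in> S" for x
  proof -
    have "- laplacian U x = linf powr (p / (p - 1)) * - laplacian f x"
      unfolding U_def using laplacian_lincomb[OF S(1) fm fm x, of "linf powr (p / (p - 1))" 0] by simp
    also have "\<dots> = linf powr (p / (p - 1) + p) * f x powr p"
      unfolding fe[OF x] by (simp add: powr_mult powr_add)
    also have "p / (p - 1) + p = p / (p - 1) * p" using p by (simp add: field_simps)
    also have "linf powr (p / (p - 1) * p) * f x powr p = U x powr p"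
      by (simp add: U_def powr_mult powr_powr)
    finally show ?thesis .
  qed
  have lim: "(\<lambda>n. lam (\<sigma> n)) \<longlonglongrightarrow> linf"
    by (rule filterlim_compose[OF lam_lim filterlim_at_end[OF \<sigma>]])
  have c: "(\<lambda>n. lam (\<sigma> n) powr (1 / (p - 1)) * lam (\<sigma> n)) \<longlonglongrightarrow> linf powr (p / (p - 1))"
  proof -
    have "(\<lambda>n. lam (\<sigma> n) powr (1 / (p - 1)) * lam (\<sigma> n)) \<longlonglongrightarrow> linf powr (1 / (p - 1)) * linf"
      using lpos by (intro tendsto_mult tendsto_powr lim tendsto_const) auto
    also have "linf powr (1 / (p - 1)) * linf = linf powr (1 / (p - 1) + 1)" using lpos by (simp add: powr_add)
    also have "1 / (p - 1) + 1 = p / (p - 1)" using p by (simp add: field_simps)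
    finally show ?thesis .
  qed
  have e: "lam (\<sigma> n) powr (1 / (p - 1)) * alpha (\<sigma> n) * u (\<sigma> n) x = lam (\<sigma> n) powr (1 / (p - 1)) * lam (\<sigma> n) * psi (\<sigma> n) x" for n x
    using solD(2)[OF \<sigma>(1), of n] by (simp add: u_def)
  show "(\<lambda>n. C2_norm S (\<lambda>x. lam (\<sigma> n) powr (1 / (p - 1)) * alpha (\<sigma> n) * u (\<sigma> n) x - U x)) \<longlonglongrightarrow> 0"
    unfolding e U_def
    by (rule C2_norm_scaled_tendsto[OF S' c f(2) _ fm]) (use solD(4)[OF \<sigma>(1)] in simp)
qed

lemma alpha_le_1: "s \<in> D \<Longrightarrow> alpha s \<le> 1"
  by (rule solves_P_alpha_le_1[OF S p solD(1,2)])

end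


section \<open>The unbounded continuum\<close>

theorem theorem6p1:
  fixes \<Omega> :: "(real^'n::finite) set"
    and p r lbar :: real
    and sinf :: ereal
    and lam alpha :: "real \<Rightarrow> real"
    and psi :: "real \<Rightarrow> real^'n \<Rightarrow> real"
    and mu :: "real \<Rightarrow> real"
    and u :: "real \<Rightarrow> real^'n \<Rightarrow> real"
  assumes "CARD('n) \<ge> 2"
    and "1 < p" and "ereal p < p_crit CARD('n)"
    and "0 < r" and "r < 1"
    and "bounded_domain_of_class 4 \<Omega>" and "measure lebesgue \<Omega> = 1"
    and "is_lambda_bar \<Omega> r p lbar"
    and "alternative_i \<Omega> r p lbar sinf lam alpha psi \<or>
         alternative_ii \<Omega> r p lbar sinf lam alpha psi"
    and mu_def: "\<And>s. mu s = lam s * alpha s powr (p - 1)"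
    and u_def: "\<And>s x. u s x = lam s / alpha s * psi s x"
  shows "\<exists>linf. linf \<in> {sobolev_const \<Omega> (2 * p) / p <.. lbar} \<and>
    rabinowitz_continuum \<Omega> r p = (\<lambda>s. (mu s, u s)) ` param_dom sinf \<and>
    unbounded_pairs \<Omega> r (rabinowitz_continuum \<Omega> r p) \<and>
    continuous_map (top_of_set (param_dom sinf))
      (prod_topology (top_of_set {0..}) (C2r0_topology \<Omega> r)) (\<lambda>s. (mu s, u s)) \<and>
    (\<forall>s\<in>param_dom sinf. alpha s \<in> {0<..1}) \<and>
    (\<forall>s\<in>param_dom sinf. lam s \<in> {0..<lbar}) \<and>
    (\<exists>s0. continues_G \<Omega> r p sinf lam alpha psi s0 \<and>
      lam s0 = sobolev_const \<Omega> (2 * p) / p \<and>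
      (\<forall>s\<in>param_dom sinf. s0 < s \<longrightarrow> lam s \<in> {sobolev_const \<Omega> (2 * p) / p <..< lbar})) \<and>
    (mu 0, u 0) = (0, \<lambda>_. 0) \<and>
    filterlim alpha (at_right 0) (at_end sinf) \<and>
    (lam \<longlongrightarrow> linf) (at_end sinf) \<and>
    filterlim mu (at_right 0) (at_end sinf) \<and>
    (\<forall>\<sigma>. (\<forall>n. \<sigma> n \<in> param_dom sinf) \<and> (\<lambda>n. ereal (\<sigma> n)) \<longlonglongrightarrow> sinf \<longrightarrow>
      (\<exists>k U. strict_mono (k :: nat \<Rightarrow> nat) \<and> U \<in> C20 \<Omega> \<and>
        (\<lambda>n. C2_norm \<Omega> (\<lambda>x. lam (\<sigma> (k n)) powr (1 / (p - 1)) * alpha (\<sigma> (k n)) * u (\<sigma> (k n)) x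
                              - U x)) \<longlonglongrightarrow> 0 \<and>
        (\<forall>x\<in>\<Omega>. - laplacian U x = U x powr p) \<and> (\<forall>x\<in>\<Omega>. U x > 0)))"
proof -
  have \<Omega>: "open \<Omega>" "bounded \<Omega>" using assms(6) by (auto simp: bounded_domain_of_class_def)
  have ne: "\<Omega> \<noteq> {}" using assms(7) by auto
  have "\<exists>linf s0. linf \<in> {sobolev_const \<Omega> (2 * p) / p <.. lbar} \<and>
      solution_curve \<Omega> r p sinf lam alpha psi s0 linf \<and>
      (\<forall>\<sigma>. (\<forall>n. \<sigma> n \<in> param_dom sinf) \<and> (\<lambda>n. ereal (\<sigma> n)) \<longlonglongrightarrow> sinf \<longrightarrow>
        (\<exists>k psi_inf. strict_mono (k :: nat \<Rightarrow> nat) \<and> solves_P \<Omega> r p linf 0 psi_inf \<and>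
          (\<lambda>n. C2_norm \<Omega> (\<lambda>x. psi (\<sigma> (k n)) x - psi_inf x)) \<longlonglongrightarrow> 0))"
    using assms(9)
  proof
    assume "alternative_i \<Omega> r p lbar sinf lam alpha psi"
    then obtain linf Einf s0 where linf: "linf \<in> {sobolev_const \<Omega> (2 * p) / p <.. lbar}"
      and sinf: "sinf = ereal linf" and lam: "\<forall>s\<in>{0..<linf}. lam s = s"
      and s0: "continues_G \<Omega> r p sinf lam alpha psi s0"
      and sol: "positive_solution_curve \<Omega> r p {0..<linf} lam alpha psi"
      and simple: "simple_curve {0..<linf} lam alpha psi"
      and an: "analytic_curve \<Omega> r {0..<linf} lam alpha psi"
      and nb: "no_bifurcation_points \<Omega> r p {0..<linf} lam alpha psi"
      and al: "filterlim alpha (at_right 0) (at_left linf)"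
      and sub: "\<forall>\<sigma>. (\<forall>n. \<sigma> n \<in> {0..<linf}) \<and> \<sigma> \<longlonglongrightarrow> linf \<longrightarrow>
        (\<exists>k psi_inf. strict_mono (k :: nat \<Rightarrow> nat) \<and> solves_P \<Omega> r p linf 0 psi_inf \<and>
          energy \<Omega> psi_inf = Einf \<and>
          (\<lambda>n. C2_norm \<Omega> (\<lambda>x. psi (\<sigma> (k n)) x - psi_inf x)) \<longlonglongrightarrow> 0)"
      unfolding alternative_i_def by (elim exE conjE)
    have "0 < linf" using s0 sinf by (auto simp: continues_G_def)
    hence "eventually (\<lambda>s. s \<in> {0..<linf}) (at_left linf)"
      using eventually_at_left_real[of 0 linf] by (auto elim: eventually_mono)
    hence "eventually (\<lambda>s. lam s = s) (at_left linf)" by eventually_elim (use lam in blast)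
    hence lim: "(lam \<longlongrightarrow> linf) (at_left linf)" by (simp add: tendsto_cong)
    have "psi t \<in> C2r0 \<Omega> r" if "t \<in> {0..<linf}" for t
      using sol that by (auto simp: positive_solution_curve_def solves_P_def)
    hence "continuous_map (top_of_set {0..<linf}) (C2r0_topology \<Omega> r) psi"
      using an by (intro analytic_C2r0_imp_continuous_map[OF \<Omega>(1) ne \<Omega>(2)]) (simp_all add: analytic_curve_def)
    hence "continuous_curve \<Omega> r {0..<linf} lam alpha psi"
      using an by (simp add: analytic_curve_def continuous_curve_def analytic_real_imp_continuous_on)
    hence "solution_curve \<Omega> r p sinf lam alpha psi s0 linf"
      using \<Omega> assms(2,7) sol simple nb s0 al lim linf unfolding sinf
      by unfold_locales (auto simp: param_dom_ereal at_end_ereal)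
    moreover have "\<exists>k psi_inf. strict_mono (k :: nat \<Rightarrow> nat) \<and> solves_P \<Omega> r p linf 0 psi_inf \<and>
          (\<lambda>n. C2_norm \<Omega> (\<lambda>x. psi (\<sigma> (k n)) x - psi_inf x)) \<longlonglongrightarrow> 0"
      if \<sigma>: "(\<forall>n. \<sigma> n \<in> param_dom sinf) \<and> (\<lambda>n. ereal (\<sigma> n)) \<longlonglongrightarrow> sinf" for \<sigma>
    proof -
      have "(\<forall>n. \<sigma> n \<in> {0..<linf}) \<and> \<sigma> \<longlonglongrightarrow> linf" using \<sigma> unfolding sinf param_dom_ereal by simp
      from sub[rule_format, OF this] show ?thesis by (elim exE conjE) (intro exI conjI)
    qed
    ultimately show ?thesis using linf by (intro exI[of _ linf] exI[of _ s0]) simp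
  next
    assume "alternative_ii \<Omega> r p lbar sinf lam alpha psi"
    then obtain linf s0 where ii: "linf \<in> {sobolev_const \<Omega> (2 * p) / p <.. lbar}"
      "continues_G \<Omega> r p sinf lam alpha psi s0"
      "positive_solution_curve \<Omega> r p (param_dom sinf) lam alpha psi"
      "simple_curve (param_dom sinf) lam alpha psi"
      "continuous_curve \<Omega> r (param_dom sinf) lam alpha psi"
      "no_bifurcation_points \<Omega> r p (param_dom sinf) lam alpha psi"
      "filterlim alpha (at_right 0) (at_end sinf)" "(lam \<longlongrightarrow> linf) (at_end sinf)"
      "\<forall>\<sigma>. (\<forall>n. \<sigma> n \<in> param_dom sinf) \<and> (\<lambda>n. ereal (\<sigma> n)) \<longlonglongrightarrow> sinf \<longrightarrow>
        (\<exists>k psi_inf. strict_mono (k :: nat \<Rightarrow> nat) \<and> solves_P \<Omega> r p linf 0 psi_inf \<and>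
          (\<lambda>n. C2_norm \<Omega> (\<lambda>x. psi (\<sigma> (k n)) x - psi_inf x)) \<longlonglongrightarrow> 0)"
      unfolding alternative_ii_def by (elim exE conjE)
    have "solution_curve \<Omega> r p sinf lam alpha psi s0 linf"
      using \<Omega> assms(2,7) ii(1-8) by unfold_locales auto
    with ii(1,9) show ?thesis by (intro exI[of _ linf] exI[of _ s0] conjI)
  qed
  then obtain linf s0 where linf: "linf \<in> {sobolev_const \<Omega> (2 * p) / p <.. lbar}"
    and curve: "solution_curve \<Omega> r p sinf lam alpha psi s0 linf"
    and sub: "\<And>\<sigma>. (\<And>n. \<sigma> n \<in> param_dom sinf) \<Longrightarrow> (\<lambda>n. ereal (\<sigma> n)) \<longlonglongrightarrow> sinf \<Longrightarrow>
        \<exists>k psi_inf. strict_mono (k :: nat \<Rightarrow> nat) \<and> solves_P \<Omega> r p linf 0 psi_inf \<and>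
          (\<lambda>n. C2_norm \<Omega> (\<lambda>x. psi (\<sigma> (k n)) x - psi_inf x)) \<longlonglongrightarrow> 0"
    by (elim exE conjE) simp
  interpret C: solution_curve \<Omega> r p sinf lam alpha psi s0 linf by (rule curve)
  have mu: "mu = C.mu" by (auto simp: fun_eq_iff mu_def C.mu_def)
  have u: "u = C.u" by (auto simp: fun_eq_iff u_def C.u_def)
  have lbar: "lam s < lbar" if "s \<in> param_dom sinf" for s
    using assms(8) C.solD(1,2)[OF that] unfolding is_lambda_bar_def by blast
  have fin: "\<exists>k U. strict_mono (k :: nat \<Rightarrow> nat) \<and> U \<in> C20 \<Omega> \<and>
        (\<lambda>n. C2_norm \<Omega> (\<lambda>x. lam (\<sigma> (k n)) powr (1 / (p - 1)) * alpha (\<sigma> (k n)) * C.u (\<sigma> (k n)) x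
                              - U x)) \<longlonglongrightarrow> 0 \<and>
        (\<forall>x\<in>\<Omega>. - laplacian U x = U x powr p) \<and> (\<forall>x\<in>\<Omega>. U x > 0)"
    if \<sigma>: "\<And>n. \<sigma> n \<in> param_dom sinf" "(\<lambda>n. ereal (\<sigma> n)) \<longlonglongrightarrow> sinf" for \<sigma>
  proof -
    obtain k f where k: "strict_mono (k :: nat \<Rightarrow> nat)" and f: "solves_P \<Omega> r p linf 0 f"
      "(\<lambda>n. C2_norm \<Omega> (\<lambda>x. psi (\<sigma> (k n)) x - f x)) \<longlonglongrightarrow> 0" using sub[OF \<sigma>] by (elim exE conjE)
    have "(\<lambda>n. ereal (\<sigma> (k n))) \<longlonglongrightarrow> sinf" using LIMSEQ_subseq_LIMSEQ[OF \<sigma>(2) k] by (simp add: o_def)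
    note U = C.rescaled_limit[of "\<lambda>n. \<sigma> (k n)", OF \<sigma>(1) this f]
    show ?thesis by (intro exI conjI ballI) (rule k, rule U(1), rule U(2), erule U(3), erule U(4))
  qed
  show ?thesis
  proof (rule exI[of _ linf], intro conjI)
    show "rabinowitz_continuum \<Omega> r p = (\<lambda>s. (mu s, u s)) ` param_dom sinf"
      unfolding mu u C.rabinowitz_continuum_eq C.curve_image_def ..
    show "unbounded_pairs \<Omega> r (rabinowitz_continuum \<Omega> r p)"
      unfolding C.rabinowitz_continuum_eq by (rule C.curve_image_unbounded)
    show "continuous_map (top_of_set (param_dom sinf))
      (prod_topology (top_of_set {0..}) (C2r0_topology \<Omega> r)) (\<lambda>s. (mu s, u s))"
      unfolding mu u by (rule C.curve_continuous_map)
    show "\<forall>s\<in>param_dom sinf. alpha s \<in> {0<..1}" using C.solD(2) C.alpha_le_1 by simp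
    show "\<forall>s\<in>param_dom sinf. lam s \<in> {0..<lbar}" using C.solD(3) lbar by simp
    show "\<exists>s0. continues_G \<Omega> r p sinf lam alpha psi s0 \<and>
      lam s0 = sobolev_const \<Omega> (2 * p) / p \<and>
      (\<forall>s\<in>param_dom sinf. s0 < s \<longrightarrow> lam s \<in> {sobolev_const \<Omega> (2 * p) / p <..< lbar})"
      using C.contG C.lam_s0 C.lam_gt lbar by (intro exI[of _ s0]) simp
    show "(mu 0, u 0) = (0, \<lambda>_. 0)" unfolding mu u using C.mu_u_0 by simp
    show "filterlim mu (at_right 0) (at_end sinf)" unfolding mu by (rule C.mu_lim)
    show "\<forall>\<sigma>. (\<forall>n. \<sigma> n \<in> param_dom sinf) \<and> (\<lambda>n. ereal (\<sigma> n)) \<longlonglongrightarrow> sinf \<longrightarrow>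
      (\<exists>k U. strict_mono (k :: nat \<Rightarrow> nat) \<and> U \<in> C20 \<Omega> \<and>
        (\<lambda>n. C2_norm \<Omega> (\<lambda>x. lam (\<sigma> (k n)) powr (1 / (p - 1)) * alpha (\<sigma> (k n)) * u (\<sigma> (k n)) x
                              - U x)) \<longlonglongrightarrow> 0 \<and>
        (\<forall>x\<in>\<Omega>. - laplacian U x = U x powr p) \<and> (\<forall>x\<in>\<Omega>. U x > 0))"
      unfolding u by (intro allI impI fin) auto
  qed (rule linf C.alpha_lim C.lam_lim)+
qed

end
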